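(* Let $\alpha>0$ and let $a=\{a_k\}_{k\ge 1}\subset D$ be a sequence with $a_k\ne a_n$ if $k\ne n$ and $|a_k|\le |a_{k+1}|$ for all $k\ge 1$, satisfying the Newman–Carleson condition $(N\text{-}C)$ and the Stoltz condition $(S)$. Then: a) If $f\in m_\alpha$, then $\{f(a_k)\}_{k\ge 1}\in b_v$. b) For each sequence $x=\{x_k\}_{k\ge 1}\in b_v$ there is a function $f\in m_\alpha$ such that $f(a_k)=x_k$ for all $k=1,2,\ldots$.
   Context: $D$ is the open unit disk in $\mathbb{C}$ and $T$ is the unit circle. $M$ is the Banach space of all complex-valued Borel measures on $T$ with the variation norm. For $\alpha>0$, $F_\alpha$ is the family of all functions $g$ on $D$ for which there exists $\mu\in M$ such that $$g(z)=\int_T \frac{1}{(1-\overline{\zeta}z)^{\alpha}}\,d\mu(\zeta),\qquad z\in D,$$ where the power is the principal branch (equal to $1$ at $z=0$). A function $f$ holomorphic in $D$ is called a multiplier of $F_\alpha$ if $g\in F_\alpha$ implies $fg\in F_\alpha$; $m_\alpha$ denotes the set of all multipliers of $F_\alpha$. A sequence $a=\{a_k\}_{k\ge1}\subset D$ satisfies the Newman–Carleson condition $(N\text{-}C)$ if $$\delta(a)=\inf_{n\ge 1}\ \prod_{k\ne n}\left|\frac{a_k-a_n}{1-\overline{a}_k a_n}\right|>0.$$ It satisfies the Stoltz condition $(S)$ if $$\sup_{k\ge 1}\frac{|1-a_k|}{1-|a_k|}<\infty.$$ $b_v$ is the set of complex sequences $x=\{x_k\}_{k\ge1}$ with $\sum_{k\ge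 1}|x_{k+1}-x_k|<\infty$. *)

theory Defs
  imports "HOL-Analysis.Analysis"
begin

text \<open>
  A complex measure on the measurable space underlying \<open>S\<close> is a countably additive complex-valued
  set function on \<^term>\<open>sets S\<close>; the measure carried by \<open>S\<close> itself plays no role, and the values
  of the set function outside \<^term>\<open>sets S\<close> are irrelevant. Finiteness of the total variation is
  automatic.
\<close>

definition complex_measure :: "'a measure \<Rightarrow> ('a set \<Rightarrow> complex) \<Rightarrow> bool" where
  "complex_measure S \<mu> \<longleftrightarrow>
     (\<forall>A :: nat \<Rightarrow> 'a set. range A \<subseteq> sets S \<longrightarrow> disjoint_family A \<longrightarrow>
        (\<lambda>n. \<mu> (A n)) sums \<mu> (\<Union>n. A n))"

text \<open>
  The positive part in the Jordan decomposition of a real (signed) measure,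
  \<open>\<nu>\<^sup>+(A) = sup {\<nu>(B) | B \<subseteq> A}\<close>. Negative values are sent to \<open>0 = \<nu>({})\<close>
  by \<^const>\<open>ennreal\<close>, which does not affect the supremum.
\<close>

definition positive_variation :: "'a measure \<Rightarrow> ('a set \<Rightarrow> real) \<Rightarrow> 'a measure" where
  "positive_variation S \<nu> =
     measure_of (space S) (sets S) (\<lambda>A. SUP B \<in> {B \<in> sets S. B \<subseteq> A}. ennreal (\<nu> B))"

text \<open>The negative part of \<open>\<nu>\<close> is the positive part of \<open>-\<nu>\<close>.\<close>

definition signed_integral :: "'a measure \<Rightarrow> ('a set \<Rightarrow> real) \<Rightarrow> ('a \<Rightarrow> complex) \<Rightarrow> complex" where
  "signed_integral S \<nu> f =
     (LINT x|positive_variation S \<nu>. f x) - (LINT x|positive_variation S (\<lambda>A. - \<nu> A). f x)"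

definition complex_integral :: "'a measure \<Rightarrow> ('a set \<Rightarrow> complex) \<Rightarrow> ('a \<Rightarrow> complex) \<Rightarrow> complex" where
  "complex_integral S \<mu> f =
     signed_integral S (\<lambda>A. Re (\<mu> A)) f + \<i> * signed_integral S (\<lambda>A. Im (\<mu> A)) f"

abbreviation unit_disk :: "complex set" where
  "unit_disk \<equiv> ball 0 1"

definition circle_borel :: "complex measure" where
  "circle_borel = restrict_space borel (sphere 0 1)"

text \<open>
  Elements of \<open>F_space \<alpha>\<close> and \<open>multipliers \<alpha>\<close> are functions on the whole plane of which only the
  restriction to the disk is constrained. For \<open>z\<close> in the disk and \<open>\<zeta>\<close> on the circle,
  \<open>1 - cnj \<zeta> * z\<close> has positive real part, and \<^const>\<open>powr\<close> is the principal power there.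
\<close>

definition F_space :: "real \<Rightarrow> (complex \<Rightarrow> complex) set" where
  "F_space \<alpha> =
     {g. \<exists>\<mu>. complex_measure circle_borel \<mu> \<and>
           (\<forall>z\<in>unit_disk. g z =
              complex_integral circle_borel \<mu>
                (\<lambda>\<zeta>. 1 / (1 - cnj \<zeta> * z) powr complex_of_real \<alpha>))}"

definition multipliers :: "real \<Rightarrow> (complex \<Rightarrow> complex) set" where
  "multipliers \<alpha> =
     {f. f holomorphic_on unit_disk \<and> (\<forall>g\<in>F_space \<alpha>. (\<lambda>z. f z * g z) \<in> F_space \<alpha>)}"

text \<open>
  The infinite product is the limit of its partial products, which decrease since all factors lie
  in \<open>[0,1]\<close>. The operator \<^const>\<open>prodinf\<close> is not used, because the limit may be \<open>0\<close>
  without any factor being \<open>0\<close>, and such a product has no value in the sense of \<^const>\<open>has_prod\<close>.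
\<close>

definition newman_carleson_delta :: "(nat \<Rightarrow> complex) \<Rightarrow> real" where
  "newman_carleson_delta a =
     (INF n. lim (\<lambda>N. \<Prod>k\<in>{..<N} - {n}. norm ((a k - a n) / (1 - cnj (a k) * a n))))"

definition newman_carleson :: "(nat \<Rightarrow> complex) \<Rightarrow> bool" where
  "newman_carleson a \<longleftrightarrow> newman_carleson_delta a > 0"

definition stoltz :: "(nat \<Rightarrow> complex) \<Rightarrow> bool" where
  "stoltz a \<longleftrightarrow> bdd_above (range (\<lambda>k. norm (1 - a k) / (1 - norm (a k))))"

definition bounded_variation_seqs :: "(nat \<Rightarrow> complex) set" where
  "bounded_variation_seqs = {x. summable (\<lambda>k. norm (x (Suc k) - x k))}"

end

theory Submission
  imports Defs "HOL-Complex_Analysis.Cauchy_Integral_Formula" "HOL-Probability.Giry_Monad"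
begin

text \<open>
  Write \<open>k\<^sub>\<zeta>(z) = (1 - cnj \<zeta> * z)\<^bsup>-\<alpha>\<^esup>\<close>. Under (S), condition (N-C) forces \<open>1 - |a\<^sub>k|\<close> to decay
  geometrically, since \<open>\<Sum>\<^sub>j (1 - |b\<^sub>j(a\<^sub>k)|\<^sup>2) \<le> 2 log (1/\<delta>)\<close> for the Blaschke factors \<open>b\<^sub>j\<close>.

  For a), \<open>f k\<^sub>1 \<in> F\<^sub>\<alpha>\<close> gives \<open>f(a\<^sub>k) = \<integral> ((1 - a\<^sub>k) / (1 - cnj \<zeta> a\<^sub>k))\<^sup>\<alpha> d\<mu>(\<zeta>)\<close>, and geometric decay bounds the
  variation in \<open>k\<close> of the integrand uniformly in \<open>\<zeta>\<close>: it passes from near \<open>1\<close> to near \<open>0\<close> once, when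
  \<open>1 - |a\<^sub>k|\<close> becomes smaller than \<open>|1 - \<zeta>|\<close>.

  For b), the functions \<open>(1 - |v|) z / (1 - cnj v * z)\<close>, \<open>|v| < 1\<close>, have uniformly bounded multiplier norm:
  with \<open>G(t)\<close> the kernel at \<open>w\<^sub>t = (1-t) v + t \<zeta>\<close>, the product with \<open>k\<^sub>\<zeta>\<close> is a bounded multiple of
  \<open>\<integral> t\<^bsup>\<alpha>-1\<^esup> dG = G(1) - G(0) - (\<alpha>-1) \<integral> t\<^bsup>\<alpha>-2\<^esup> (G(t) - G(0)) dt\<close> over \<open>[0,1]\<close>, and
  \<open>G(t)\<close> is the Poisson integral of the kernels on the circle. Such functions with \<open>v = |a\<^sub>n|\<close> interpolate
  the step sequences \<open>1\<^bsub>j>n\<^esub>\<close> up to an error that decays geometrically in \<open>|j - n|\<close>. Correcting the values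
  with \<open>|j - n| \<le> M\<close> by finite Blaschke products, localised by a bump around \<open>a\<^sub>k\<close>, makes the remaining
  error small in \<open>\<ell>\<^sup>1\<close>, and a Neumann series for \<open>b\<^sub>v\<close> yields exact interpolation.
\<close>

section \<open>Superpositions of Cauchy kernels\<close>

lemma norm_integral_le:
  fixes f :: "'a \<Rightarrow> 'b::{banach, second_countable_topology}"
  assumes "integrable M f" "integrable M g" "\<And>x. x \<in> space M \<Longrightarrow> norm (f x) \<le> g x"
  shows "norm (LINT x|M. f x) \<le> (LINT x|M. g x)"
  by (rule order_trans[OF integral_norm_bound integral_mono[OF integrable_norm]]) (use assms in auto)

lemma integrable_mult_bounded:
  fixes h f :: "'a \<Rightarrow> complex"
  assumes h: "integrable M h" and f: "f \<in> borel_measurable M" "\<And>x. x \<in> space M \<Longrightarrow> norm (f x) \<le> B"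
  shows "integrable M (\<lambda>x. h x * f x)"
proof (rule Bochner_Integration.integrable_bound)
  show "integrable M (\<lambda>x. norm (h x) * B)" using h by auto
  show "(\<lambda>x. h x * f x) \<in> borel_measurable M" using h f(1) by auto
  show "AE x in M. norm (h x * f x) \<le> norm (norm (h x) * B)"
  proof (rule AE_I2)
    fix x assume "x \<in> space M"
    then have "norm (f x) \<le> \<bar>B\<bar>" using f(2)[of x] by simp
    then show "norm (h x * f x) \<le> norm (norm (h x) * B)" by (simp add: norm_mult abs_mult mult_left_mono)
  qed
qed

lemma borel_measurable_Arg [measurable]: "Arg \<in> borel_measurable borel"
proof -
  let ?Y = "\<real>\<^sub>\<le>\<^sub>0 :: complex set"
  have "Arg \<in> borel_measurable (restrict_space borel {z. z \<notin> ?Y})"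
    by (intro borel_measurable_continuous_on_restrict continuous_at_imp_continuous_on ballI
        continuous_at_Arg) auto
  moreover have "(\<lambda>z. if z = 0 then 0 else pi) \<in> borel_measurable (restrict_space borel {z. z \<in> ?Y})"
    by (rule measurable_restrict_space1) measurable
  ultimately have "(\<lambda>z. if z \<in> ?Y then if z = 0 then 0 else pi else Arg z) \<in> borel_measurable borel"
    by (subst measurable_If_restrict_space_iff) auto
  also have "(\<lambda>z. if z \<in> ?Y then if z = 0 then 0 else pi else Arg z) = Arg"
    by (rule ext) (auto simp: nonpos_Reals_def Arg_zero Arg_of_real)
  finally show ?thesis .
qed

lemma borel_measurable_cis [measurable]: "cis \<in> borel_measurable borel"
  by (intro borel_measurable_continuous_onI continuous_intros)

lemma cis_Arg_norm: "of_real (norm z) * cis (Arg z) = z"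
  by (metis rcis_cmod_Arg rcis_def)

definition kernel :: "real \<Rightarrow> complex \<Rightarrow> complex \<Rightarrow> complex" where
  "kernel \<alpha> \<zeta> z = 1 / (1 - cnj \<zeta> * z) powr of_real \<alpha>"

lemma one_minus_cnj_mult_nonzero:
  assumes "norm u < 1" "norm z \<le> 1" shows "1 - cnj u * z \<noteq> 0"
proof -
  have "norm (cnj u * z) \<le> norm u" using mult_left_mono[OF assms(2), of "norm u"] by (simp add: norm_mult)
  then show ?thesis using assms(1) by (metis eq_iff_diff_eq_0 norm_one not_less)
qed

lemma Re_one_minus_pos: "norm \<zeta> \<le> 1 \<Longrightarrow> norm z < 1 \<Longrightarrow> 0 < Re (1 - cnj \<zeta> * z)"
proof -
  assume "norm \<zeta> \<le> 1" "norm z < 1"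
  then have "norm (cnj \<zeta> * z) < 1"
    using mult_right_mono[of "norm \<zeta>" 1 "norm z"] by (simp add: norm_mult)
  then have "Re (cnj \<zeta> * z) < 1" using complex_Re_le_cmod order_le_less_trans by blast
  then show ?thesis by simp
qed

lemma one_minus_not_nonpos: "norm \<zeta> \<le> 1 \<Longrightarrow> norm z < 1 \<Longrightarrow> 1 - cnj \<zeta> * z \<notin> \<real>\<^sub>\<le>\<^sub>0"
  using Re_one_minus_pos[of \<zeta> z] complex_nonpos_Reals_iff not_less by blast

lemma continuous_on_kernel:
  assumes "norm z < 1" "\<And>x. x \<in> A \<Longrightarrow> norm (f x) \<le> 1" "continuous_on A f"
  shows "continuous_on A (\<lambda>x. kernel \<alpha> (f x) z)"
  unfolding kernel_def
proof (intro continuous_on_divide continuous_on_powr_complex continuous_intros assms)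
  have pos: "0 < Re (1 - cnj (f x) * z)" if "x \<in> A" for x
    using Re_one_minus_pos[OF assms(2)[OF that] assms(1)] .
  have nz: "1 - cnj (f x) * z \<noteq> 0" if "x \<in> A" for x
    using pos[OF that] by (metis less_irrefl zero_complex.sel(1))
  show "A \<subseteq> {x. 0 \<le> Re (1 - cnj (f x) * z) \<or> Im (1 - cnj (f x) * z) \<noteq> 0}"
    using pos less_imp_le by blast
  show "\<And>x. x \<in> A \<Longrightarrow> 1 - cnj (f x) * z = 0 \<Longrightarrow> 0 < Re (complex_of_real \<alpha>)"
    using nz by blast
  show "\<forall>x\<in>A. (1 - cnj (f x) * z) powr complex_of_real \<alpha> \<noteq> 0"
    using nz by (simp add: powr_def)
qed

lemma kernel_measurable_cis:
  assumes "norm z < 1"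
  shows "(\<lambda>\<theta>. kernel \<alpha> (cis \<theta>) z) \<in> borel_measurable borel"
  by (intro borel_measurable_continuous_onI continuous_on_kernel assms continuous_intros) auto

lemma kernel_measurable_circle:
  assumes "norm z < 1"
  shows "(\<lambda>\<zeta>. kernel \<alpha> \<zeta> z) \<in> borel_measurable circle_borel"
  unfolding circle_borel_def
  by (intro borel_measurable_continuous_on_restrict continuous_on_kernel assms continuous_intros) auto

lemma kernel_bounded:
  assumes "norm z < 1"
  shows "\<exists>B. \<forall>\<zeta>. norm \<zeta> \<le> 1 \<longrightarrow> norm (kernel \<alpha> \<zeta> z) \<le> B"
proof -
  have "compact ((\<lambda>\<zeta>. kernel \<alpha> \<zeta> z) ` cball 0 1)"
    by (intro compact_continuous_image continuous_on_kernel assms continuous_intros) auto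
  then have "bounded ((\<lambda>\<zeta>. kernel \<alpha> \<zeta> z) ` cball 0 1)" by (rule compact_imp_bounded)
  then show ?thesis unfolding bounded_iff by (metis image_eqI mem_cball_0)
qed

text \<open>
  \<open>rep \<alpha> g V\<close> says that the norm of \<open>g\<close> in \<open>F\<^sub>\<alpha>\<close> is at most \<open>V\<close>. A complex measure on the circle is
  represented by a positive measure on pairs of a phase and an angle, both real numbers, so that
  only positive measures have to be added and pushed forward.
\<close>

definition rep_measure :: "real \<Rightarrow> (complex \<Rightarrow> complex) \<Rightarrow> real \<Rightarrow> (real \<times> real) measure \<Rightarrow> bool" where
  "rep_measure \<alpha> g V N \<longleftrightarrow> 0 \<le> V \<and> sets N = sets borel \<and> emeasure N UNIV \<le> ennreal V \<and>
     (\<forall>z\<in>unit_disk. g z = (LINT x|N. cis (fst x) * kernel \<alpha> (cis (snd x)) z))"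

definition rep :: "real \<Rightarrow> (complex \<Rightarrow> complex) \<Rightarrow> real \<Rightarrow> bool" where
  "rep \<alpha> g V \<longleftrightarrow> (\<exists>N. rep_measure \<alpha> g V N)"

lemma rep_measureD:
  assumes "rep_measure \<alpha> g V N"
  shows "sets N = sets borel" "finite_measure N" "0 \<le> V" "emeasure N (space N) \<le> ennreal V"
    "norm z < 1 \<Longrightarrow> g z = (LINT x|N. cis (fst x) * kernel \<alpha> (cis (snd x)) z)"
proof -
  show N: "sets N = sets borel" "0 \<le> V"
    "norm z < 1 \<Longrightarrow> g z = (LINT x|N. cis (fst x) * kernel \<alpha> (cis (snd x)) z)"
    using assms by (simp_all add: rep_measure_def)
  show V: "emeasure N (space N) \<le> ennreal V"
    using assms sets_eq_imp_space_eq[OF N(1)] by (simp add: rep_measure_def)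
  then show "finite_measure N" by (intro finite_measureI) (auto simp: top_unique)
qed

lemma repE:
  assumes "rep \<alpha> g V" obtains N where "rep_measure \<alpha> g V N"
  using assms unfolding rep_def by blast

lemma rep_nonneg: "rep \<alpha> g V \<Longrightarrow> 0 \<le> V"
  by (auto simp: rep_def rep_measure_def)

lemma repI:
  fixes N :: "(real \<times> real) measure"
  assumes "0 \<le> V" "sets N = sets borel" "emeasure N UNIV \<le> ennreal V"
    "\<And>z. norm z < 1 \<Longrightarrow> g z = (LINT x|N. cis (fst x) * kernel \<alpha> (cis (snd x)) z)"
  shows "rep \<alpha> g V"
  unfolding rep_def rep_measure_def using assms(1-3) by (intro conjI exI[of _ N] ballI assms(4)) simp_all

lemma rep_mono:
  assumes "rep \<alpha> g V" "V \<le> W" shows "rep \<alpha> g W"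
proof -
  obtain N where "rep_measure \<alpha> g V N"
    by (rule repE[OF assms(1)])
  note N = rep_measureD[OF this]
  have "emeasure N UNIV \<le> ennreal W"
    using N(4) ennreal_leI[OF assms(2)] sets_eq_imp_space_eq[OF N(1)] by (simp add: order_trans)
  then show ?thesis using N assms(2) by (intro repI[of W N]) auto
qed

lemma rep_cong:
  assumes "rep \<alpha> g V" "\<And>z. norm z < 1 \<Longrightarrow> g z = g' z" shows "rep \<alpha> g' V"
proof -
  obtain N where "rep_measure \<alpha> g V N"
    by (rule repE[OF assms(1)])
  note N = rep_measureD[OF this]
  then show ?thesis using assms(2) sets_eq_imp_space_eq[OF N(1)] by (intro repI[of V N]) auto
qed

lemma rep_superposition:
  fixes h :: "'a \<Rightarrow> complex"
  assumes h: "integrable M h" and \<eta>[measurable]: "\<eta> \<in> borel_measurable M"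
    and V: "(\<integral>\<^sup>+x. ennreal (norm (h x)) \<partial>M) \<le> ennreal V" "0 \<le> V"
    and g: "\<And>z. norm z < 1 \<Longrightarrow> g z = (LINT x|M. h x * kernel \<alpha> (cis (\<eta> x)) z)"
  shows "rep \<alpha> g V"
proof -
  have [measurable]: "h \<in> borel_measurable M" using h by auto
  define T where "T x = (Arg (h x), \<eta> x)" for x
  have [measurable]: "T \<in> M \<rightarrow>\<^sub>M borel" unfolding T_def borel_prod[symmetric] by measurable
  define N where "N = distr (density M (\<lambda>x. ennreal (norm (h x)))) borel T"
  have "emeasure N UNIV = (\<integral>\<^sup>+x. ennreal (norm (h x)) \<partial>M)"
    unfolding N_def by (simp add: emeasure_distr emeasure_density)
  moreover have "g z = (LINT x|N. cis (fst x) * kernel \<alpha> (cis (snd x)) z)" if "norm z < 1" for z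
  proof -
    note [measurable] = measurable_compose[OF _ kernel_measurable_cis[OF that]]
    have [measurable]: "(\<lambda>x::real\<times>real. cis (fst x) * kernel \<alpha> (cis (snd x)) z) \<in> borel_measurable borel"
      unfolding borel_prod[symmetric] by measurable
    have "(LINT x|N. cis (fst x) * kernel \<alpha> (cis (snd x)) z)
        = (LINT x|density M (\<lambda>x. ennreal (norm (h x))). cis (Arg (h x)) * kernel \<alpha> (cis (\<eta> x)) z)"
      unfolding N_def by (subst integral_distr) (simp_all add: T_def)
    also have "\<dots> = (LINT x|M. norm (h x) *\<^sub>R (cis (Arg (h x)) * kernel \<alpha> (cis (\<eta> x)) z))"
      by (subst integral_density) auto
    also have "\<dots> = g z" unfolding g[OF that]
      by (intro Bochner_Integration.integral_cong refl)
        (simp add: scaleR_conv_of_real mult.assoc[symmetric] cis_Arg_norm)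
    finally show ?thesis by simp
  qed
  ultimately show ?thesis using V by (intro repI[of V N]) (simp_all add: N_def)
qed

lemma sum_measure_exists:
  fixes N :: "nat \<Rightarrow> 'a measure"
  assumes sets: "\<And>i. sets (N i) = sets K"
    and mass: "\<And>i. emeasure (N i) (space K) \<le> ennreal (V i)" and V: "\<And>i. 0 \<le> V i" "summable V"
  obtains \<tau> where "sets \<tau> = sets K" "emeasure \<tau> (space \<tau>) \<le> ennreal (\<Sum>i. V i)"
    "\<And>(f :: 'a \<Rightarrow> complex) B. f \<in> borel_measurable K \<Longrightarrow> (\<And>x. x \<in> space K \<Longrightarrow> norm (f x) \<le> B) \<Longrightarrow>
       (\<lambda>i. LINT x|N i. f x) sums (LINT x|\<tau>. f x)"
proof -
  define c where "c i = V i + (1/2)^i" for i :: nat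
  have c: "0 < c i" for i using V(1)[of i] by (simp add: c_def add_nonneg_pos)
  have sc: "summable c" unfolding c_def by (intro summable_add V) (simp add: summable_geometric)
  define W where "W = density (count_space UNIV) (\<lambda>i. ennreal (c i))"
  define P where "P i = density (N i) (\<lambda>_. ennreal (1 / c i))" for i
  have space: "space (N i) = space K" for i using sets_eq_imp_space_eq[OF sets] .
  have [simp]: "emeasure (P i) A = ennreal (1 / c i) * emeasure (N i) A" if "A \<in> sets K" for i A
    using that sets by (simp add: P_def emeasure_density nn_integral_cmult_indicator)
  have P1: "emeasure (P i) (space (P i)) \<le> 1" for i
  proof -
    have "space (P i) = space K" using space by (simp add: P_def)
    then have "emeasure (P i) (space (P i)) = ennreal (1 / c i) * emeasure (N i) (space K)"
      by simp
    also have "\<dots> \<le> ennreal (1 / c i) * ennreal (V i)" by (intro mult_left_mono mass) simp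
    also have "\<dots> = ennreal (V i / c i)" using V c[of i] by (simp flip: ennreal_mult)
    also have "\<dots> \<le> 1" using c[of i] by (simp add: c_def)
    finally show ?thesis .
  qed
  show ?thesis
  proof (cases "space K = {}")
    case True
    show ?thesis
    proof (rule that[of K])
      show "emeasure K (space K) \<le> ennreal (suminf V)" using True by simp
      show "(\<lambda>i. LINT x|N i. f x) sums (LINT x|K. f x)" for f :: "'a \<Rightarrow> complex"
        using True space by (simp add: Bochner_Integration.integral_empty)
    qed simp
  next
    case False
    have PK: "P i \<in> space (subprob_algebra K)" for i
      using False P1 sets space by (auto simp: space_subprob_algebra P_def intro!: subprob_spaceI)
    then have Pm: "P \<in> measurable W (subprob_algebra K)"
      by (simp add: W_def measurable_def)
    define \<tau> where "\<tau> = W \<bind> P"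
    have spW: "space W \<noteq> {}" by (simp add: W_def)
    have set_tau: "sets \<tau> = sets K"
      unfolding \<tau>_def using sets by (intro sets_bind spW) (simp add: P_def)
    have finW: "finite_measure W"
    proof
      have "emeasure W (space W) = (\<Sum>i. ennreal (c i))"
        by (simp add: W_def emeasure_density nn_integral_count_space_nat)
      also have "\<dots> = ennreal (suminf c)" by (intro suminf_ennreal2 sc less_imp_le c)
      finally show "emeasure W (space W) \<noteq> \<infinity>" by simp
    qed
    show ?thesis
    proof (rule that[OF set_tau])
      have "space \<tau> = space K" using sets_eq_imp_space_eq[OF set_tau] .
      then have "emeasure \<tau> (space \<tau>) = (\<integral>\<^sup>+i. emeasure (P i) (space K) \<partial>W)"
        unfolding \<tau>_def using emeasure_bind[OF spW Pm, of "space K"] by simp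
      also have "\<dots> = (\<Sum>i. ennreal (c i) * (ennreal (1 / c i) * emeasure (N i) (space K)))"
        by (simp add: W_def nn_integral_density nn_integral_count_space_nat)
      also have "\<dots> = (\<Sum>i. emeasure (N i) (space K))"
      proof (intro suminf_cong)
        fix i
        have "ennreal (c i) * ennreal (1 / c i) = 1" using c[of i]
          by (subst ennreal_mult[symmetric]) (auto intro: less_imp_le)
        then show "ennreal (c i) * (ennreal (1 / c i) * emeasure (N i) (space K)) = emeasure (N i) (space K)"
          by (simp flip: mult.assoc)
      qed
      also have "\<dots> \<le> (\<Sum>i. ennreal (V i))" by (intro suminf_le mass) auto
      also have "\<dots> = ennreal (suminf V)" by (intro suminf_ennreal2 V)
      finally show "emeasure \<tau> (space \<tau>) \<le> ennreal (suminf V)" .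
    next
      fix f :: "'a \<Rightarrow> complex" and B
      assume f: "f \<in> borel_measurable K" and B: "\<And>x. x \<in> space K \<Longrightarrow> norm (f x) \<le> B"
      have fN: "f \<in> borel_measurable (N i)" for i using f measurable_cong_sets[OF sets refl] by blast
      have finN: "finite_measure (N i)" for i
        using mass[of i] space by (intro finite_measureI) (auto simp: top_unique)
      have intN: "integrable (N i) f" for i
        using B by (intro finite_measure.integrable_const_bound[OF finN, of f B] fN AE_I2) (simp add: space)
      have real: "integrable \<tau> g \<and> (\<lambda>i. LINT x|N i. g x) sums (LINT x|\<tau>. g x)"
        if g: "g \<in> borel_measurable K" "\<And>x. x \<in> space K \<Longrightarrow> \<bar>g x\<bar> \<le> B" for g :: "'a \<Rightarrow> real"
      proof
        show "integrable \<tau> g" unfolding \<tau>_def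
          by (rule integrable_bind[where K = K and B' = 1 and B = B]) (use g Pm finW P1 in \<open>auto intro!: AE_I2\<close>)
        have gN: "g \<in> borel_measurable (N i)" for i using g measurable_cong_sets[OF sets refl] by blast
        have "(LINT x|\<tau>. g x) = (LINT i|W. LINT x|P i. g x)" unfolding \<tau>_def
          by (rule integral_bind[where K = K and B' = 1 and B = B]) (use g Pm finW P1 in \<open>auto intro!: AE_I2\<close>)
        also have "(\<lambda>i. LINT x|P i. g x) = (\<lambda>i. (LINT x|N i. g x) / c i)"
          unfolding P_def using c gN by (subst integral_density) (auto intro: less_imp_le)
        also have "(LINT i|W. (LINT x|N i. g x) / c i) = (LINT i|count_space UNIV. LINT x|N i. g x)"
          unfolding W_def using c
          by (subst integral_density) (auto intro!: AE_I2 less_imp_le Bochner_Integration.integral_cong simp: less_imp_neq[OF c, symmetric])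
        finally have eq: "(LINT x|\<tau>. g x) = (LINT i|count_space UNIV. LINT x|N i. g x)" .
        have "norm (LINT x|N i. g x) \<le> V i * \<bar>B\<bar>" for i
        proof -
          have "norm (LINT x|N i. g x) \<le> (LINT x|N i. \<bar>B\<bar>)"
          proof (rule norm_integral_le)
            show "integrable (N i) g" using g(2)
              by (intro finite_measure.integrable_const_bound[OF finN, of g B] gN AE_I2) (simp add: space)
            show "integrable (N i) (\<lambda>_. \<bar>B\<bar>)" by (rule finite_measure.integrable_const[OF finN])
            show "norm (g x) \<le> \<bar>B\<bar>" if "x \<in> space (N i)" for x using g(2)[of x] that by (simp add: space)
          qed
          also have "\<dots> = measure (N i) (space K) * \<bar>B\<bar>" by (simp add: space)
          also have "\<dots> \<le> V i * \<bar>B\<bar>"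
            using mass[of i] V(1)[of i] by (intro mult_right_mono) (auto simp: measure_def enn2real_leI)
          finally show ?thesis .
        qed
        then have "integrable (count_space UNIV) (\<lambda>i. LINT x|N i. g x)"
          unfolding integrable_count_space_nat_iff
          by (intro summable_comparison_test'[OF summable_mult2[OF V(2), of "\<bar>B\<bar>"]]) auto
        then show "(\<lambda>i. LINT x|N i. g x) sums (LINT x|\<tau>. g x)"
          unfolding eq by (rule sums_integral_count_space_nat)
      qed
      have b: "\<bar>Re (f x)\<bar> \<le> B" "\<bar>Im (f x)\<bar> \<le> B" if "x \<in> space K" for x
        using B[OF that] abs_Re_le_cmod[of "f x"] abs_Im_le_cmod[of "f x"] by linarith+
      have re: "integrable \<tau> (\<lambda>x. Re (f x))" "(\<lambda>i. LINT x|N i. Re (f x)) sums (LINT x|\<tau>. Re (f x))"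
        using real[of "\<lambda>x. Re (f x)"] f b by auto
      have im: "integrable \<tau> (\<lambda>x. Im (f x))" "(\<lambda>i. LINT x|N i. Im (f x)) sums (LINT x|\<tau>. Im (f x))"
        using real[of "\<lambda>x. Im (f x)"] f b by auto
      have "integrable \<tau> (\<lambda>x. of_real (Re (f x)) + \<i> * of_real (Im (f x)))"
        using re(1) im(1) by (intro Bochner_Integration.integrable_add integrable_mult_right integrable_of_real)
      then have "integrable \<tau> f" by (simp flip: complex_eq)
      then show "(\<lambda>i. LINT x|N i. f x) sums (LINT x|\<tau>. f x)"
        using re(2) im(2) intN by (simp add: sums_complex_iff)
    qed
  qed
qed

lemma rep_0: "rep \<alpha> (\<lambda>z. 0) 0"
  by (rule repI[of _ "null_measure borel"]) simp_all

lemma rep_sums: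
  assumes rep: "\<And>i. rep \<alpha> (g i) (V i)" and "summable V"
    and sums: "\<And>z. norm z < 1 \<Longrightarrow> (\<lambda>i. g i z) sums G z"
  shows "rep \<alpha> G (\<Sum>i. V i)"
proof -
  obtain N where "\<And>i. rep_measure \<alpha> (g i) (V i) (N i)" using rep unfolding rep_def by metis
  note N = rep_measureD[OF this]
  note V = rep_nonneg[OF rep]
  have sp: "space (N i) = UNIV" for i using sets_eq_imp_space_eq[OF N(1)] by simp
  have mass: "emeasure (N i) (space borel) \<le> ennreal (V i)" for i using N(4)[of i] sp by simp
  obtain \<tau> :: "(real \<times> real) measure" where \<tau>: "sets \<tau> = sets borel" "emeasure \<tau> (space \<tau>) \<le> ennreal (\<Sum>i. V i)"
    "\<And>(f :: real \<times> real \<Rightarrow> complex) B. f \<in> borel_measurable borel \<Longrightarrow> (\<And>x. x \<in> space borel \<Longrightarrow> norm (f x) \<le> B) \<Longrightarrow>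
       (\<lambda>i. LINT x|N i. f x) sums (LINT x|\<tau>. f x)"
    by (rule sum_measure_exists[of N borel V, OF N(1) mass V assms(2)]) (rule that, assumption, assumption, blast)
  show ?thesis
  proof (rule repI[of _ \<tau>])
    show "0 \<le> suminf V" by (intro suminf_nonneg assms V)
    show "sets \<tau> = sets borel" by fact
    show "emeasure \<tau> UNIV \<le> ennreal (suminf V)" using \<tau>(2) sets_eq_imp_space_eq[OF \<tau>(1)] by simp
    fix z :: complex assume z: "norm z < 1"
    note [measurable] = measurable_compose[OF _ kernel_measurable_cis[OF z]]
    obtain B where B: "\<And>\<zeta>. norm \<zeta> \<le> 1 \<Longrightarrow> norm (kernel \<alpha> \<zeta> z) \<le> B"
      using kernel_bounded[OF z] by blast
    have "(\<lambda>x::real\<times>real. cis (fst x) * kernel \<alpha> (cis (snd x)) z) \<in> borel_measurable borel"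
      unfolding borel_prod[symmetric] by measurable
    from \<tau>(3)[OF this, of B] have "(\<lambda>i. g i z) sums (LINT x|\<tau>. cis (fst x) * kernel \<alpha> (cis (snd x)) z)"
      using B N(5)[OF z] by (simp add: norm_mult)
    with sums[OF z] show "G z = (LINT x|\<tau>. cis (fst x) * kernel \<alpha> (cis (snd x)) z)"
      by (rule sums_unique2)
  qed
qed

lemma rep_add:
  assumes "rep \<alpha> f V" "rep \<alpha> g W" shows "rep \<alpha> (\<lambda>z. f z + g z) (V + W)"
proof -
  define F where "F i = (if i = 0 then f else if i = 1 then g else (\<lambda>z. 0))" for i :: nat
  define X where "X i = (if i = 0 then V else if i = 1 then W else 0)" for i :: nat
  have s: "(\<lambda>i. if i = 0 then a else if i = 1 then b else 0) sums (a + b)"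
    for a b :: "'a::real_normed_vector"
  proof -
    have "(\<lambda>i. if i = 0 then a else if i = 1 then b else 0) sums (\<Sum>i\<in>{0,1::nat}. if i = 0 then a else if i = 1 then b else 0)"
      by (rule sums_finite) auto
    then show ?thesis by simp
  qed
  have "rep \<alpha> (\<lambda>z. f z + g z) (\<Sum>i. X i)"
  proof (rule rep_sums[of \<alpha> F])
    show "rep \<alpha> (F i) (X i)" for i using assms rep_0 by (simp add: F_def X_def)
    show "summable X" using sums_summable[OF s[of V W]] unfolding X_def .
    have "(\<lambda>i. F i z) = (\<lambda>i. if i = 0 then f z else if i = 1 then g z else 0)" for z
      by (rule ext) (simp add: F_def)
    then show "(\<lambda>i. F i z) sums (f z + g z)" for z using s[of "f z" "g z"] by (simp only:)
  qed
  moreover have "(\<Sum>i. X i) = V + W" using sums_unique[OF s[of V W]] unfolding X_def by (rule sym)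
  ultimately show ?thesis by simp
qed

lemma rep_cmult:
  assumes "rep \<alpha> g V" shows "rep \<alpha> (\<lambda>z. c * g z) (norm c * V)"
proof -
  obtain N where "rep_measure \<alpha> g V N"
    by (rule repE[OF assms(1)])
  note N = rep_measureD[OF this]
  have [measurable_cong]: "sets N = sets (borel \<Otimes>\<^sub>M borel)" using N(1) by (simp only: borel_prod)
  show ?thesis
  proof (rule rep_superposition[where M = N and h = "\<lambda>x. c * cis (fst x)" and \<eta> = snd])
    show "integrable N (\<lambda>x. c * cis (fst x))"
      by (rule finite_measure.integrable_const_bound[OF N(2), of _ "norm c"]) (auto simp: norm_mult)
    have "(\<integral>\<^sup>+x. ennreal (norm (c * cis (fst x))) \<partial>N) = ennreal (norm c) * emeasure N (space N)"
      by (simp add: norm_mult)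
    also have "\<dots> \<le> ennreal (norm c) * ennreal V" by (intro mult_left_mono N) simp
    finally show "(\<integral>\<^sup>+x. ennreal (norm (c * cis (fst x))) \<partial>N) \<le> ennreal (norm c * V)"
      using N(3) by (simp add: ennreal_mult)
    show "0 \<le> norm c * V" using N(3) by simp
    show "snd \<in> borel_measurable N" by measurable
    show "c * g z = (LINT x|N. c * cis (fst x) * kernel \<alpha> (cis (snd x)) z)" if "norm z < 1" for z
      unfolding N(5)[OF that] by (simp add: mult.assoc)
  qed
qed

section \<open>Complex measures and their Jordan decompositions\<close>

lemma complex_measure_empty:
  assumes "complex_measure S \<mu>" shows "\<mu> {} = 0"
proof -
  have "(\<lambda>n::nat. \<mu> {}) sums \<mu> (\<Union>n::nat. {})"
    using assms unfolding complex_measure_def by (elim allE[of _ "\<lambda>_. {}"]) (auto simp: disjoint_family_on_def)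
  then show ?thesis using sums_summable summable_const_iff by blast
qed

lemma complex_measure_Un:
  assumes \<mu>: "complex_measure S \<mu>" and "A \<in> sets S" "B \<in> sets S" "A \<inter> B = {}"
  shows "\<mu> (A \<union> B) = \<mu> A + \<mu> B"
proof -
  define F where "F n = (if n = 0 then A else if n = 1 then B else {})" for n :: nat
  have "range F \<subseteq> sets S" "disjoint_family F"
    using assms by (auto simp: F_def disjoint_family_on_def)
  then have "(\<lambda>n. \<mu> (F n)) sums \<mu> (\<Union>n. F n)" using \<mu> unfolding complex_measure_def by blast
  moreover have "(\<Union>n. F n) = A \<union> B" by (auto simp: F_def split: if_splits)
  moreover have "(\<lambda>n. \<mu> (F n)) sums (\<Sum>n\<in>{0,1}. \<mu> (F n))"
    by (rule sums_finite) (auto simp: F_def complex_measure_empty[OF \<mu>])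
  ultimately have "\<mu> (A \<union> B) = (\<Sum>n\<in>{0,1}. \<mu> (F n))" using sums_unique2 by metis
  then show ?thesis by (simp add: F_def)
qed

text \<open>
  If \<open>\<mu>\<close> is unbounded on the subsets of \<open>E\<close>, then \<open>E\<close> splits into a part on which it is still
  unbounded and a part of measure at least \<open>1\<close> in modulus; iterating contradicts countable additivity.
\<close>

lemma complex_measure_bounded:
  assumes \<mu>: "complex_measure S \<mu>"
  shows "\<exists>B. \<forall>A\<in>sets S. norm (\<mu> A) \<le> B"
proof (rule ccontr)
  assume nb: "\<not> ?thesis"
  define unb where "unb E \<longleftrightarrow> E \<in> sets S \<and> (\<forall>B. \<exists>A\<in>sets S. A \<subseteq> E \<and> B < norm (\<mu> A))" for E
  have step: "\<exists>F. unb F \<and> F \<subseteq> E \<and> 1 \<le> norm (\<mu> (E - F))" if E: "unb E" for E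
  proof -
    have ES: "E \<in> sets S" using E by (simp add: unb_def)
    obtain A where A: "A \<in> sets S" "A \<subseteq> E" "norm (\<mu> E) + 1 < norm (\<mu> A)" using E unfolding unb_def by blast
    have "\<mu> E = \<mu> A + \<mu> (E - A)"
      using complex_measure_Un[OF \<mu> A(1), of "E - A"] A ES by (simp add: Un_absorb1 Un_Diff_cancel)
    then have EA: "1 \<le> norm (\<mu> (E - A))" using A(3) norm_triangle_ineq4[of "\<mu> E" "\<mu> (E - A)"] by simp
    have "unb A \<or> unb (E - A)"
    proof (rule ccontr)
      assume "\<not> (unb A \<or> unb (E - A))"
      then obtain B1 B2 where B: "\<And>C. C \<in> sets S \<Longrightarrow> C \<subseteq> A \<Longrightarrow> norm (\<mu> C) \<le> B1"
        "\<And>C. C \<in> sets S \<Longrightarrow> C \<subseteq> E - A \<Longrightarrow> norm (\<mu> C) \<le> B2"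
        using A(1) ES unfolding unb_def by (metis not_le sets.Diff)
      obtain C where C: "C \<in> sets S" "C \<subseteq> E" "B1 + B2 < norm (\<mu> C)" using E unfolding unb_def by blast
      have "\<mu> C = \<mu> (C \<inter> A) + \<mu> (C - A)"
        using complex_measure_Un[OF \<mu>, of "C \<inter> A" "C - A"] A(1) C(1) by (simp add: Int_Diff_Un Int_Diff_disjoint)
      then have "norm (\<mu> C) \<le> norm (\<mu> (C \<inter> A)) + norm (\<mu> (C - A))" using norm_triangle_ineq by simp
      also have "\<dots> \<le> B1 + B2" using A(1) C by (intro add_mono B) auto
      finally show False using C(3) by simp
    qed
    then show ?thesis
    proof
      assume "unb A" then show ?thesis using A(2) EA by blast
    next
      assume "unb (E - A)"
      moreover have "1 \<le> norm (\<mu> (E - (E - A)))"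
      proof -
        have "E - (E - A) = A" using A(2) by blast
        show ?thesis using A(3) norm_ge_zero[of "\<mu> E"] unfolding \<open>E - (E - A) = A\<close> by linarith
      qed
      ultimately show ?thesis by blast
    qed
  qed
  have "unb (space S)"
    using nb sets.sets_into_space unfolding unb_def by (metis not_le sets.top)
  then have "\<exists>f. \<forall>n. unb (f n) \<and> (f (Suc n) \<subseteq> f n \<and> 1 \<le> norm (\<mu> (f n - f (Suc n))))"
    by (intro dependent_nat_choice) (use step in blast)+
  then obtain f where f: "\<And>n. unb (f n)" "\<And>n. f (Suc n) \<subseteq> f n" "\<And>n. 1 \<le> norm (\<mu> (f n - f (Suc n)))" by blast
  define D where "D n = f n - f (Suc n)" for n
  have dec: "f m \<subseteq> f n" if "n \<le> m" for m n using lift_Suc_antimono_le[of f, OF f(2) that] .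
  have "disjoint_family D"
    unfolding disjoint_family_on_def D_def
  proof (intro ballI impI)
    fix m n :: nat assume "m \<noteq> n"
    then consider "Suc m \<le> n" | "Suc n \<le> m" by linarith
    then show "(f m - f (Suc m)) \<inter> (f n - f (Suc n)) = {}"
      using dec by cases blast+
  qed
  moreover have "range D \<subseteq> sets S" using f(1) by (auto simp: D_def unb_def)
  ultimately have "(\<lambda>n. \<mu> (D n)) sums \<mu> (\<Union>n. D n)" using \<mu> unfolding complex_measure_def by blast
  then have "(\<lambda>n. \<mu> (D n)) \<longlonglongrightarrow> 0" using sums_summable summable_LIMSEQ_zero by blast
  then have "\<forall>\<^sub>F n in sequentially. norm (\<mu> (D n)) < 1"
    using order_tendstoD(2)[OF tendsto_norm_zero, of _ sequentially 1] by simp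
  then obtain n where "norm (\<mu> (D n)) < 1" by (auto simp: eventually_sequentially)
  then show False using f(3)[of n] by (simp add: D_def)
qed

lemma sets_positive_variation [simp]: "sets (positive_variation S \<nu>) = sets S"
  unfolding positive_variation_def by (simp add: sets.space_closed)

lemma finite_positive_variation:
  assumes B: "\<And>A. A \<in> sets S \<Longrightarrow> \<nu> A \<le> B"
  shows "finite_measure (positive_variation S \<nu>)"
proof -
  let ?F = "\<lambda>A. SUP B \<in> {B \<in> sets S. B \<subseteq> A}. ennreal (\<nu> B)"
  have "emeasure (positive_variation S \<nu>) X \<le> ennreal B" for X
  proof -
    have "emeasure (positive_variation S \<nu>) X = 0 \<or> emeasure (positive_variation S \<nu>) X = ?F X"
      unfolding positive_variation_def emeasure_measure_of_conv by auto
    moreover have "?F X \<le> ennreal B" by (intro SUP_least ennreal_leI B) auto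
    ultimately show ?thesis by auto
  qed
  then show ?thesis by (intro finite_measureI) (metis ennreal_less_top infinity_ennreal_def leD)
qed

lemma positive_variation_density:
  assumes sets: "sets \<tau> = sets S" and h: "integrable \<tau> h"
    and \<nu>: "\<And>A. A \<in> sets S \<Longrightarrow> \<nu> A = (LINT x|\<tau>. h x * indicator A x)"
  shows "positive_variation S \<nu> = density \<tau> (\<lambda>x. ennreal (h x))"
proof -
  have [measurable]: "h \<in> borel_measurable \<tau>" using h by auto
  have sp: "space \<tau> = space S" by (rule sets_eq_imp_space_eq[OF sets])
  have "(SUP B \<in> {B \<in> sets S. B \<subseteq> A}. ennreal (\<nu> B)) = emeasure (density \<tau> (\<lambda>x. ennreal (h x))) A"
    if A: "A \<in> sets S" for A
  proof (rule antisym)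
    have em: "emeasure (density \<tau> (\<lambda>x. ennreal (h x))) B = (\<integral>\<^sup>+x. ennreal (h x) * indicator B x \<partial>\<tau>)"
      if "B \<in> sets S" for B using that sets by (simp add: emeasure_density)
    show "(SUP B \<in> {B \<in> sets S. B \<subseteq> A}. ennreal (\<nu> B)) \<le> emeasure (density \<tau> (\<lambda>x. ennreal (h x))) A"
    proof (rule SUP_least)
      fix B assume "B \<in> {B \<in> sets S. B \<subseteq> A}"
      then have B: "B \<in> sets S" "B \<subseteq> A" by auto
      have iB: "integrable \<tau> (\<lambda>x. h x * indicator B x)"
        using integrable_mult_indicator[of B \<tau> h] B(1) sets h by (simp add: mult.commute)
      have "\<nu> B \<le> (LINT x|\<tau>. max 0 (h x) * indicator B x)"
        unfolding \<nu>[OF B(1)] using iB h integrable_mult_indicator[of B \<tau> "\<lambda>x. max 0 (h x)"] B(1) sets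
        by (intro integral_mono) (auto simp: mult.commute indicator_def)
      also have "ennreal \<dots> = (\<integral>\<^sup>+x. ennreal (max 0 (h x) * indicator B x) \<partial>\<tau>)"
        using h integrable_mult_indicator[of B \<tau> "\<lambda>x. max 0 (h x)"] B(1) sets
        by (intro nn_integral_eq_integral[symmetric]) (auto simp: mult.commute)
      also have "\<dots> = (\<integral>\<^sup>+x. ennreal (h x) * indicator B x \<partial>\<tau>)"
        by (intro nn_integral_cong) (auto simp: indicator_def max_def ennreal_neg)
      also have "\<dots> \<le> (\<integral>\<^sup>+x. ennreal (h x) * indicator A x \<partial>\<tau>)"
        using B(2) by (intro nn_integral_mono mult_left_mono) (auto simp: indicator_def)
      finally show "ennreal (\<nu> B) \<le> emeasure (density \<tau> (\<lambda>x. ennreal (h x))) A"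
        unfolding em[OF A] by (simp add: ennreal_leI)
    qed
    define B where "B = {x \<in> space \<tau>. 0 \<le> h x} \<inter> A"
    have B: "B \<in> sets S" using A unfolding B_def sets[symmetric] by auto
    have iB: "integrable \<tau> (\<lambda>x. h x * indicator B x)"
      using integrable_mult_indicator[of B \<tau> h] B sets h by (simp add: mult.commute)
    have "emeasure (density \<tau> (\<lambda>x. ennreal (h x))) A = (\<integral>\<^sup>+x. ennreal (h x * indicator B x) \<partial>\<tau>)"
      unfolding em[OF A] by (intro nn_integral_cong) (auto simp: indicator_def B_def ennreal_neg)
    also have "\<dots> = ennreal (\<nu> B)"
      unfolding \<nu>[OF B] by (intro nn_integral_eq_integral iB AE_I2) (auto simp: indicator_def B_def)
    also have "\<dots> \<le> (SUP B \<in> {B \<in> sets S. B \<subseteq> A}. ennreal (\<nu> B))"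
      using B by (intro SUP_upper) (auto simp: B_def)
    finally show "emeasure (density \<tau> (\<lambda>x. ennreal (h x))) A \<le> (SUP B \<in> {B \<in> sets S. B \<subseteq> A}. ennreal (\<nu> B))" .
  qed
  then have "positive_variation S \<nu> = measure_of (space S) (sets S) (emeasure (density \<tau> (\<lambda>x. ennreal (h x))))"
    unfolding positive_variation_def by (intro measure_of_eq sets.space_closed) (simp add: sets.sigma_sets_eq)
  also have "\<dots> = density \<tau> (\<lambda>x. ennreal (h x))"
    using measure_of_of_measure[of "density \<tau> (\<lambda>x. ennreal (h x))"] sets sp by simp
  finally show ?thesis .
qed

lemma signed_integral_density:
  assumes sets: "sets \<tau> = sets S" and h: "integrable \<tau> h"
    and \<nu>: "\<And>A. A \<in> sets S \<Longrightarrow> \<nu> A = (LINT x|\<tau>. h x * indicator A x)"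
    and \<phi>: "\<phi> \<in> borel_measurable S" "\<And>x. x \<in> space S \<Longrightarrow> norm (\<phi> x) \<le> B"
  shows "signed_integral S \<nu> \<phi> = (LINT x|\<tau>. of_real (h x) * \<phi> x)"
    "integrable \<tau> (\<lambda>x. of_real (h x) * \<phi> x)"
proof -
  have \<phi>\<tau> [measurable]: "\<phi> \<in> borel_measurable \<tau>" using \<phi>(1) measurable_cong_sets[OF sets refl] by blast
  have sp: "space \<tau> = space S" by (rule sets_eq_imp_space_eq[OF sets])
  have pos: "(LINT x|density \<tau> (\<lambda>x. ennreal (k x)). \<phi> x) = (LINT x|\<tau>. max 0 (k x) *\<^sub>R \<phi> x) \<and>
      integrable \<tau> (\<lambda>x. max 0 (k x) *\<^sub>R \<phi> x)"
    if k: "integrable \<tau> k" for k :: "'a \<Rightarrow> real"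
  proof
    have dens: "density \<tau> (\<lambda>x. ennreal (k x)) = density \<tau> (\<lambda>x. ennreal (max 0 (k x)))"
      by (intro arg_cong[of _ _ "density \<tau>"] ext) (simp add: max_def ennreal_neg)
    have km: "k \<in> borel_measurable \<tau>" using k by auto
    show "(LINT x|density \<tau> (\<lambda>x. ennreal (k x)). \<phi> x) = (LINT x|\<tau>. max 0 (k x) *\<^sub>R \<phi> x)"
      unfolding dens by (rule integral_density) (use km in auto)
    have kk: "integrable \<tau> (\<lambda>x. max 0 (k x))" using k by simp
    show "integrable \<tau> (\<lambda>x. max 0 (k x) *\<^sub>R \<phi> x)"
      unfolding scaleR_conv_of_real
    proof (rule integrable_mult_bounded[OF _ \<phi>\<tau>])
      show "integrable \<tau> (\<lambda>x. complex_of_real (max 0 (k x)))" using kk by simp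
      show "norm (\<phi> x) \<le> B" if "x \<in> space \<tau>" for x using \<phi>(2) that sp by simp
    qed
  qed
  have m: "\<And>A. A \<in> sets S \<Longrightarrow> - \<nu> A = (LINT x|\<tau>. - h x * indicator A x)" using \<nu> by simp
  have p1: "(LINT x|density \<tau> (\<lambda>x. ennreal (h x)). \<phi> x) = (LINT x|\<tau>. max 0 (h x) *\<^sub>R \<phi> x)"
    "integrable \<tau> (\<lambda>x. max 0 (h x) *\<^sub>R \<phi> x)" using pos[OF h] by auto
  have mh: "integrable \<tau> (\<lambda>x. - h x)" using h by simp
  have p2: "(LINT x|density \<tau> (\<lambda>x. ennreal (- h x)). \<phi> x) = (LINT x|\<tau>. max 0 (- h x) *\<^sub>R \<phi> x)"
    "integrable \<tau> (\<lambda>x. max 0 (- h x) *\<^sub>R \<phi> x)" using pos[OF mh] by auto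
  have eq: "(\<lambda>x. max 0 (h x) *\<^sub>R \<phi> x - max 0 (- h x) *\<^sub>R \<phi> x) = (\<lambda>x. of_real (h x) * \<phi> x)"
    by (auto simp: max_def scaleR_conv_of_real)
  show "signed_integral S \<nu> \<phi> = (LINT x|\<tau>. of_real (h x) * \<phi> x)"
  proof -
    have pv: "positive_variation S \<nu> = density \<tau> (\<lambda>x. ennreal (h x))"
      "positive_variation S (\<lambda>A. - \<nu> A) = density \<tau> (\<lambda>x. ennreal (- h x))"
      using positive_variation_density[OF sets h \<nu>] positive_variation_density[OF sets mh m] by simp_all
    have "signed_integral S \<nu> \<phi> = (LINT x|\<tau>. max 0 (h x) *\<^sub>R \<phi> x - max 0 (- h x) *\<^sub>R \<phi> x)"
      unfolding signed_integral_def pv p1(1) p2(1) by (rule Bochner_Integration.integral_diff[OF p1(2) p2(2), symmetric])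
    then show ?thesis by (simp only: eq)
  qed
  show "integrable \<tau> (\<lambda>x. of_real (h x) * \<phi> x)"
    using Bochner_Integration.integrable_diff[OF p1(2) p2(2)] by (simp only: eq)
qed

lemma density_pushforward:
  assumes N: "finite_measure N" and T: "T \<in> measurable N S"
    and c: "c \<in> borel_measurable N" "\<And>x. 0 \<le> c x" "\<And>x. c x \<le> (1::real)"
  obtains D where "integrable (distr N S T) D"
    "\<And>\<phi> :: 'b \<Rightarrow> complex. \<phi> \<in> borel_measurable S \<Longrightarrow>
       (LINT x|N. of_real (c x) * \<phi> (T x)) = (LINT x|distr N S T. of_real (D x) * \<phi> x)"
proof -
  interpret N: finite_measure N by (rule N)
  note [measurable] = T c(1)
  define \<tau> where "\<tau> = distr N S T"
  define Q where "Q = distr (density N (\<lambda>x. ennreal (c x))) S T"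
  interpret \<tau>: finite_measure \<tau> unfolding \<tau>_def by (rule N.finite_measure_distr[OF T])
  have Qle: "emeasure Q A \<le> emeasure \<tau> A" if [measurable]: "A \<in> sets S" for A
  proof -
    have "emeasure Q A = (\<integral>\<^sup>+x. ennreal (c x) * indicator (T -` A \<inter> space N) x \<partial>N)"
      unfolding Q_def by (simp add: emeasure_distr emeasure_density)
    also have "\<dots> \<le> (\<integral>\<^sup>+x. indicator (T -` A \<inter> space N) x \<partial>N)"
      using c(3) by (intro nn_integral_mono) (auto simp: indicator_def)
    also have "\<dots> = emeasure \<tau> A" unfolding \<tau>_def by (simp add: emeasure_distr)
    finally show ?thesis .
  qed
  have setsQ: "sets Q = sets \<tau>" by (simp add: Q_def \<tau>_def)
  have finQ: "finite_measure Q"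
  proof (rule finite_measureI)
    have "emeasure Q (space Q) \<le> emeasure \<tau> (space \<tau>)"
      using Qle[of "space S"] by (simp add: Q_def \<tau>_def)
    then show "emeasure Q (space Q) \<noteq> \<infinity>" using \<tau>.emeasure_finite[of "space \<tau>"] by (auto simp: top_unique)
  qed
  have ac: "absolutely_continuous \<tau> Q"
    unfolding absolutely_continuous_def
  proof
    fix A assume "A \<in> null_sets \<tau>"
    then have A: "A \<in> sets S" "emeasure \<tau> A = 0" by (auto simp: \<tau>_def null_sets_def)
    then have "emeasure Q A = 0" using Qle[OF A(1)] by simp
    then show "A \<in> null_sets Q" using A(1) by (auto simp: Q_def null_sets_def)
  qed
  obtain D where D: "D \<in> borel_measurable \<tau>" "AE x in \<tau>. RN_deriv \<tau> Q x = ennreal (D x)" "\<And>x. 0 \<le> D x"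
    using \<tau>.real_RN_deriv[OF finQ ac setsQ] by metis
  have "density \<tau> (RN_deriv \<tau> Q) = Q" by (rule \<tau>.density_RN_deriv[OF ac setsQ])
  moreover have "density \<tau> (RN_deriv \<tau> Q) = density \<tau> (\<lambda>x. ennreal (D x))"
    using D by (intro density_cong) auto
  ultimately have Q: "Q = density \<tau> (\<lambda>x. ennreal (D x))" by simp
  show ?thesis
  proof (rule that[of D])
    have "(\<integral>\<^sup>+x. ennreal (D x) \<partial>\<tau>) = emeasure Q (space Q)"
      unfolding Q using D(1) by (simp add: emeasure_density)
    also have "\<dots> < \<infinity>" using finite_measure.emeasure_finite[OF finQ, of "space Q"] by (simp add: top.not_eq_extremum)
    finally show "integrable (distr N S T) D"
      using D unfolding \<tau>_def[symmetric] by (intro integrableI_nonneg) auto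
    fix \<phi> :: "'b \<Rightarrow> complex" assume [measurable]: "\<phi> \<in> borel_measurable S"
    have "(LINT x|Q. \<phi> x) = (LINT x|density N (\<lambda>x. ennreal (c x)). \<phi> (T x))"
      unfolding Q_def by (rule integral_distr) measurable
    also have "\<dots> = (LINT x|N. c x *\<^sub>R \<phi> (T x))"
      by (rule integral_density) (use c in auto)
    finally have "(LINT x|N. c x *\<^sub>R \<phi> (T x)) = (LINT x|Q. \<phi> x)" by simp
    also have "\<dots> = (LINT x|\<tau>. D x *\<^sub>R \<phi> x)"
      unfolding Q by (rule integral_density) (use D in \<open>auto simp: \<tau>_def\<close>)
    finally show "(LINT x|N. of_real (c x) * \<phi> (T x)) = (LINT x|distr N S T. of_real (D x) * \<phi> x)"
      by (simp add: \<tau>_def scaleR_conv_of_real)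
  qed
qed

lemma density_pushforward_real:
  assumes N: "finite_measure N" and T: "T \<in> measurable N S"
    and c: "c \<in> borel_measurable N" "\<And>x. \<bar>c x\<bar> \<le> (1::real)"
  obtains D where "integrable (distr N S T) D"
    "\<And>(\<phi> :: 'b \<Rightarrow> complex) B. \<phi> \<in> borel_measurable S \<Longrightarrow> (\<And>x. x \<in> space S \<Longrightarrow> norm (\<phi> x) \<le> B) \<Longrightarrow>
       (LINT x|N. of_real (c x) * \<phi> (T x)) = (LINT x|distr N S T. of_real (D x) * \<phi> x)"
proof -
  interpret N: finite_measure N by (rule N)
  note [measurable] = T c(1)
  let ?p = "\<lambda>x. max 0 (c x)" and ?n = "\<lambda>x. max 0 (- c x)"
  have b: "?p x \<le> 1" "?n x \<le> 1" "0 \<le> ?p x" "0 \<le> ?n x" for x using c(2)[of x] by auto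
  have pm: "?p \<in> borel_measurable N" "?n \<in> borel_measurable N" by measurable
  obtain P where P: "integrable (distr N S T) P" "\<And>\<phi> :: 'b \<Rightarrow> complex. \<phi> \<in> borel_measurable S \<Longrightarrow>
       (LINT x|N. of_real (?p x) * \<phi> (T x)) = (LINT x|distr N S T. of_real (P x) * \<phi> x)"
    using density_pushforward[OF N T pm(1) b(3) b(1)] by metis
  obtain M where M: "integrable (distr N S T) M" "\<And>\<phi> :: 'b \<Rightarrow> complex. \<phi> \<in> borel_measurable S \<Longrightarrow>
       (LINT x|N. of_real (?n x) * \<phi> (T x)) = (LINT x|distr N S T. of_real (M x) * \<phi> x)"
    using density_pushforward[OF N T pm(2) b(4) b(2)] by metis
  show ?thesis
  proof (rule that[of "\<lambda>x. P x - M x"])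
    show "integrable (distr N S T) (\<lambda>x. P x - M x)" using P(1) M(1) by simp
    fix \<phi> :: "'b \<Rightarrow> complex" and B
    assume \<phi> [measurable]: "\<phi> \<in> borel_measurable S" and B: "\<And>x. x \<in> space S \<Longrightarrow> norm (\<phi> x) \<le> B"
    have BT: "norm (\<phi> (T x)) \<le> B" if "x \<in> space N" for x using B measurable_space[OF T that] by blast
    have \<phi>T: "(\<lambda>x. \<phi> (T x)) \<in> borel_measurable N" by measurable
    have ip0: "integrable N ?p" "integrable N ?n"
      using b pm by (auto intro!: N.integrable_const_bound[of _ 1] AE_I2 simp: abs_le_iff)
    have ip: "integrable N (\<lambda>x. of_real (?p x) * \<phi> (T x))" "integrable N (\<lambda>x. of_real (?n x) * \<phi> (T x))"
      by (rule integrable_mult_bounded[OF _ \<phi>T BT]; use ip0 in simp)+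
    have iP: "integrable (distr N S T) (\<lambda>x. of_real (P x) * \<phi> x)" "integrable (distr N S T) (\<lambda>x. of_real (M x) * \<phi> x)"
      by (rule integrable_mult_bounded[where B = B]; use P(1) M(1) \<phi> B in simp)+
    have "(LINT x|N. of_real (c x) * \<phi> (T x)) = (LINT x|N. of_real (?p x) * \<phi> (T x) - of_real (?n x) * \<phi> (T x))"
      by (intro Bochner_Integration.integral_cong refl) (auto simp: max_def)
    also have "\<dots> = (LINT x|distr N S T. of_real (P x) * \<phi> x - of_real (M x) * \<phi> x)"
      using ip iP P(2)[OF \<phi>] M(2)[OF \<phi>] by simp
    also have "\<dots> = (LINT x|distr N S T. of_real (P x - M x) * \<phi> x)"
      by (simp add: left_diff_distrib)
    finally show "(LINT x|N. of_real (c x) * \<phi> (T x)) = (LINT x|distr N S T. of_real (P x - M x) * \<phi> x)" .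
  qed
qed

lemma complex_measure_density:
  assumes sets: "sets \<tau> = sets S" and H: "integrable \<tau> (H :: 'a \<Rightarrow> complex)"
  shows "complex_measure S (\<lambda>A. LINT x|\<tau>. H x * indicator A x)"
  unfolding complex_measure_def
proof (intro allI impI)
  fix A :: "nat \<Rightarrow> 'a set" assume A: "range A \<subseteq> sets S" and disj: "disjoint_family A"
  have Am: "A i \<in> sets \<tau>" for i using A sets by auto
  have iA: "integrable \<tau> (\<lambda>x. H x * indicator (A i) x)" for i
  proof -
    have "(\<lambda>x. indicator (A i) x *\<^sub>R H x) = (\<lambda>x. H x * indicator (A i) x)" by (auto simp: indicator_def)
    then show ?thesis using integrable_mult_indicator[OF Am H, of i] by simp
  qed
  have Hm [measurable]: "H \<in> borel_measurable \<tau>" using H by auto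
  note [measurable] = Am
  have ind: "(\<lambda>i. H x * indicator (A i) x) sums (H x * indicator (\<Union>i. A i) x)" for x
  proof (cases "\<exists>j. x \<in> A j")
    case True
    then obtain j where j: "x \<in> A j" by blast
    then have "x \<notin> A i" if "i \<noteq> j" for i using disj that unfolding disjoint_family_on_def by blast
    then have "(\<lambda>i. H x * indicator (A i) x) = (\<lambda>i. if i = j then H x else 0)"
      using j by (auto simp: indicator_def)
    moreover have "H x * indicator (\<Union>i. A i) x = H x" using j by (auto simp: indicator_def)
    ultimately show ?thesis using sums_single[of j "\<lambda>_. H x"] by (simp only:)
  qed (auto simp: indicator_def)
  have "(\<lambda>n. LINT x|\<tau>. (\<Sum>i<n. H x * indicator (A i) x)) \<longlonglongrightarrow> (LINT x|\<tau>. H x * indicator (\<Union>i. A i) x)"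
  proof (rule integral_dominated_convergence[where w = "\<lambda>x. norm (H x)"])
    show "AE x in \<tau>. (\<lambda>n. \<Sum>i<n. H x * indicator (A i) x) \<longlonglongrightarrow> H x * indicator (\<Union>i. A i) x"
      using ind by (simp add: sums_def)
    show "AE x in \<tau>. norm (\<Sum>i<n. H x * indicator (A i) x) \<le> norm (H x)" for n
    proof (rule AE_I2)
      fix x
      have "(\<Sum>i<n. indicator (A i) x) = (indicator (\<Union>i<n. A i) x :: complex)"
        using disj by (intro indicator_UN_disjoint[symmetric]) (auto simp: disjoint_family_on_def)
      then have e: "(\<Sum>i<n. H x * indicator (A i) x) = H x * indicator (\<Union>i<n. A i) x"
        by (simp only: sum_distrib_left[symmetric])
      show "norm (\<Sum>i<n. H x * indicator (A i) x) \<le> norm (H x)"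
        unfolding e by (cases "x \<in> (\<Union>i<n. A i)") simp_all
    qed
    show "integrable \<tau> (\<lambda>x. norm (H x))" using H by simp
  qed measurable
  then show "(\<lambda>n. LINT x|\<tau>. H x * indicator (A n) x) sums (LINT x|\<tau>. H x * indicator (\<Union>n. A n) x)"
    unfolding sums_def Bochner_Integration.integral_sum[OF iA] .
qed

lemma space_circle_borel: "space circle_borel = sphere 0 1"
  by (simp add: circle_borel_def space_restrict_space)

lemma rep_imp_F_space:
  assumes "rep \<alpha> g V" shows "g \<in> F_space \<alpha>"
proof -
  obtain N where "rep_measure \<alpha> g V N"
    by (rule repE[OF assms])
  note N = rep_measureD[OF this]
  interpret N: finite_measure N by (rule N)
  have setsN [measurable_cong]: "sets N = sets (borel \<Otimes>\<^sub>M borel)" using N(1) by (simp only: borel_prod)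
  define T where "T x = cis (snd x)" for x :: "real \<times> real"
  have T: "T \<in> measurable N circle_borel"
    unfolding circle_borel_def T_def by (intro measurable_restrict_space2) (auto simp: sets_eq_imp_space_eq[OF N(1)])
  define \<tau> where "\<tau> = distr N circle_borel T"
  have sets: "sets \<tau> = sets circle_borel" by (simp add: \<tau>_def)
  have cm: "(\<lambda>x. cos (fst x)) \<in> borel_measurable N" "(\<lambda>x. sin (fst x)) \<in> borel_measurable N"
    by measurable
  obtain C1 where C1: "integrable \<tau> C1" "\<And>(\<phi> :: complex \<Rightarrow> complex) B. \<phi> \<in> borel_measurable circle_borel \<Longrightarrow>
      (\<And>x. x \<in> space circle_borel \<Longrightarrow> norm (\<phi> x) \<le> B) \<Longrightarrow>
       (LINT x|N. of_real (cos (fst x)) * \<phi> (T x)) = (LINT x|\<tau>. of_real (C1 x) * \<phi> x)"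
    unfolding \<tau>_def by (rule density_pushforward_real[OF N(2) T cm(1) abs_cos_le_one]) blast
  obtain C2 where C2: "integrable \<tau> C2" "\<And>(\<phi> :: complex \<Rightarrow> complex) B. \<phi> \<in> borel_measurable circle_borel \<Longrightarrow>
      (\<And>x. x \<in> space circle_borel \<Longrightarrow> norm (\<phi> x) \<le> B) \<Longrightarrow>
       (LINT x|N. of_real (sin (fst x)) * \<phi> (T x)) = (LINT x|\<tau>. of_real (C2 x) * \<phi> x)"
    unfolding \<tau>_def by (rule density_pushforward_real[OF N(2) T cm(2) abs_sin_le_one]) blast
  define H where "H x = of_real (C1 x) + \<i> * of_real (C2 x)" for x
  have H: "integrable \<tau> H" unfolding H_def using C1(1) C2(1) by simp
  define \<mu> where "\<mu> A = (LINT x|\<tau>. H x * indicator A x)" for A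
  have iH: "integrable \<tau> (\<lambda>x. H x * indicator A x)" if "A \<in> sets circle_borel" for A
  proof -
    have "(\<lambda>x. indicator A x *\<^sub>R H x) = (\<lambda>x. H x * indicator A x)" by (auto simp: indicator_def)
    then show ?thesis using integrable_mult_indicator[OF _ H, of A] that sets by simp
  qed
  have Re\<mu>: "Re (\<mu> A) = (LINT x|\<tau>. C1 x * indicator A x)" if "A \<in> sets circle_borel" for A
    unfolding \<mu>_def integral_Re[OF iH[OF that], symmetric] by (intro Bochner_Integration.integral_cong refl) (simp add: H_def indicator_def)
  have Im\<mu>: "Im (\<mu> A) = (LINT x|\<tau>. C2 x * indicator A x)" if "A \<in> sets circle_borel" for A
    unfolding \<mu>_def integral_Im[OF iH[OF that], symmetric] by (intro Bochner_Integration.integral_cong refl) (simp add: H_def indicator_def)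
  have "complex_measure circle_borel \<mu>"
    unfolding \<mu>_def by (rule complex_measure_density[OF sets H])
  moreover have "g z = complex_integral circle_borel \<mu> (\<lambda>\<zeta>. 1 / (1 - cnj \<zeta> * z) powr of_real \<alpha>)" if "z \<in> unit_disk" for z
  proof -
    have z: "norm z < 1" using that by simp
    let ?\<phi> = "\<lambda>\<zeta>. kernel \<alpha> \<zeta> z"
    have \<phi>: "?\<phi> \<in> borel_measurable circle_borel" by (rule kernel_measurable_circle[OF z])
    obtain B where "\<And>\<zeta>. norm \<zeta> \<le> 1 \<Longrightarrow> norm (?\<phi> \<zeta>) \<le> B"
      using kernel_bounded[OF z] by blast
    then have B: "norm (?\<phi> \<zeta>) \<le> B" if "\<zeta> \<in> space circle_borel" for \<zeta>
      using that by (simp add: space_circle_borel)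
    have BT: "norm (?\<phi> (T x)) \<le> B" if "x \<in> space N" for x
      using B measurable_space[OF T that] by blast
    have \<phi>T: "(\<lambda>x. ?\<phi> (T x)) \<in> borel_measurable N" by (rule measurable_compose[OF T \<phi>])
    have ic: "integrable N (\<lambda>x. of_real (c x) * ?\<phi> (T x))" if "c \<in> borel_measurable N" "\<And>x. \<bar>c x\<bar> \<le> 1" for c
    proof (rule integrable_mult_bounded[OF _ \<phi>T BT])
      show "integrable N (\<lambda>x. complex_of_real (c x))"
        using that by (intro N.integrable_const_bound[of _ 1]) auto
    qed
    have "complex_integral circle_borel \<mu> ?\<phi> =
      (LINT x|\<tau>. of_real (C1 x) * ?\<phi> x) + \<i> * (LINT x|\<tau>. of_real (C2 x) * ?\<phi> x)"
      unfolding complex_integral_def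
      using signed_integral_density(1)[OF sets C1(1) Re\<mu> \<phi> B] signed_integral_density(1)[OF sets C2(1) Im\<mu> \<phi> B] by simp
    also have "\<dots> = (LINT x|N. of_real (cos (fst x)) * ?\<phi> (T x)) + \<i> * (LINT x|N. of_real (sin (fst x)) * ?\<phi> (T x))"
      using C1(2)[OF \<phi> B] C2(2)[OF \<phi> B] by simp
    also have "\<dots> = (LINT x|N. of_real (cos (fst x)) * ?\<phi> (T x) + \<i> * (of_real (sin (fst x)) * ?\<phi> (T x)))"
      using ic[OF cm(1) abs_cos_le_one] ic[OF cm(2) abs_sin_le_one] by simp
    also have "\<dots> = (LINT x|N. cis (fst x) * kernel \<alpha> (cis (snd x)) z)"
      by (intro Bochner_Integration.integral_cong refl) (simp add: T_def cis.ctr complex_eq_iff algebra_simps)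
    finally show ?thesis unfolding N(5)[OF z] kernel_def by simp
  qed
  ultimately show ?thesis unfolding F_space_def by blast
qed

lemma rep_diff: "rep \<alpha> f V \<Longrightarrow> rep \<alpha> g W \<Longrightarrow> rep \<alpha> (\<lambda>z. f z - g z) (V + W)"
  using rep_add[OF _ rep_cmult[of \<alpha> g W "-1"], of f V] by simp

lemma F_space_imp_rep:
  assumes "g \<in> F_space \<alpha>" obtains V where "rep \<alpha> g V"
proof -
  obtain \<mu> where \<mu>: "complex_measure circle_borel \<mu>" and g: "\<And>z. norm z < 1 \<Longrightarrow> g z =
      complex_integral circle_borel \<mu> (\<lambda>\<zeta>. kernel \<alpha> \<zeta> z)"
    using assms by (auto simp: F_space_def kernel_def)
  obtain B where B: "\<And>A. A \<in> sets circle_borel \<Longrightarrow> norm (\<mu> A) \<le> B"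
    using complex_measure_bounded[OF \<mu>] by blast
  have ex: "\<exists>V. rep \<alpha> (\<lambda>z. LINT \<zeta>|P. kernel \<alpha> \<zeta> z) V"
    if "finite_measure P" and P: "sets P = sets circle_borel" for P
  proof -
    interpret P: finite_measure P by fact
    have sp: "space P = sphere 0 1" using sets_eq_imp_space_eq[OF P] by (simp add: space_circle_borel)
    have "rep \<alpha> (\<lambda>z. LINT \<zeta>|P. kernel \<alpha> \<zeta> z) (measure P (space P))"
    proof (rule rep_superposition[where M = P and h = "\<lambda>_. 1" and \<eta> = Arg])
      show "Arg \<in> borel_measurable P"
        unfolding measurable_cong_sets[OF P refl] circle_borel_def
        by (rule measurable_restrict_space1) measurable
      show "(\<integral>\<^sup>+x. ennreal (norm (1::complex)) \<partial>P) \<le> ennreal (measure P (space P))"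
        by (simp add: P.emeasure_eq_measure)
      show "(LINT \<zeta>|P. kernel \<alpha> \<zeta> z) = (LINT x|P. 1 * kernel \<alpha> (cis (Arg x)) z)" for z
      proof (intro Bochner_Integration.integral_cong refl)
        fix x assume "x \<in> space P"
        then show "kernel \<alpha> x z = 1 * kernel \<alpha> (cis (Arg x)) z"
          using cis_Arg_norm[of x] sp by simp
      qed
    qed simp_all
    then show ?thesis by blast
  qed
  have fin: "finite_measure (positive_variation circle_borel \<nu>)" if "\<And>A. \<bar>\<nu> A\<bar> \<le> norm (\<mu> A)" for \<nu>
    by (rule finite_positive_variation[of _ _ B]) (meson B abs_le_D1 order_trans that)
  obtain V1 where V1: "rep \<alpha> (\<lambda>z. LINT \<zeta>|positive_variation circle_borel (\<lambda>A. Re (\<mu> A)). kernel \<alpha> \<zeta> z) V1"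
    using ex[OF fin[of "\<lambda>A. Re (\<mu> A)"]] abs_Re_le_cmod by auto
  obtain V2 where V2: "rep \<alpha> (\<lambda>z. LINT \<zeta>|positive_variation circle_borel (\<lambda>A. - Re (\<mu> A)). kernel \<alpha> \<zeta> z) V2"
    using ex[OF fin[of "\<lambda>A. - Re (\<mu> A)"]] abs_Re_le_cmod by auto
  obtain V3 where V3: "rep \<alpha> (\<lambda>z. LINT \<zeta>|positive_variation circle_borel (\<lambda>A. Im (\<mu> A)). kernel \<alpha> \<zeta> z) V3"
    using ex[OF fin[of "\<lambda>A. Im (\<mu> A)"]] abs_Im_le_cmod by auto
  obtain V4 where V4: "rep \<alpha> (\<lambda>z. LINT \<zeta>|positive_variation circle_borel (\<lambda>A. - Im (\<mu> A)). kernel \<alpha> \<zeta> z) V4"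
    using ex[OF fin[of "\<lambda>A. - Im (\<mu> A)"]] abs_Im_le_cmod by auto
  note r = rep_add[OF rep_diff[OF V1 V2] rep_cmult[OF rep_diff[OF V3 V4], of "\<i>"]]
  show ?thesis
    by (rule that, rule rep_cong[OF r]) (simp add: g complex_integral_def signed_integral_def)
qed

section \<open>The Poisson kernel\<close>

definition unit_interval :: "real measure" where
  "unit_interval = restrict_space lborel {0<..<1}"

lemma space_unit_interval [simp]: "space unit_interval = {0<..<1}"
  by (simp add: unit_interval_def space_restrict_space)

lemma sets_unit_interval [measurable_cong]: "sets unit_interval = sets (restrict_space borel {0<..<1})"
  by (simp add: unit_interval_def sets_restrict_space)

lemma finite_measure_unit_interval: "finite_measure unit_interval"
  by (intro finite_measureI) (simp add: unit_interval_def emeasure_restrict_space space_restrict_space)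

lemma emeasure_unit_interval [simp]: "emeasure unit_interval {0<..<1} = 1"
  by (simp add: unit_interval_def emeasure_restrict_space)

lemma borel_measurable_unit_interval: "f \<in> borel_measurable borel \<Longrightarrow> f \<in> borel_measurable unit_interval"
  unfolding measurable_cong_sets[OF sets_unit_interval refl] by (rule measurable_restrict_space1)

lemma integral_unit_interval_eq:
  fixes f :: "real \<Rightarrow> 'a::euclidean_space"
  assumes "integrable unit_interval f" "(f has_integral I) {0..1}"
  shows "(LINT x|unit_interval. f x) = I"
proof -
  have "set_integrable lborel {0<..<1} f"
    using assms(1) by (simp add: unit_interval_def integrable_restrict_space set_integrable_def)
  moreover have "(f has_integral I) {0<..<1}" using assms(2) by (simp add: has_integral_Icc_iff_Ioo)
  ultimately show ?thesis
    by (simp add: unit_interval_def integral_restrict_space set_lebesgue_integral_def[symmetric]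
        set_borel_integral_eq_integral integral_unique)
qed

lemma nn_integral_powr_unit_interval:
  assumes "0 < s"
  shows "(\<integral>\<^sup>+t. ennreal (t powr (s - 1)) \<partial>unit_interval) = ennreal (1 / s)"
proof -
  have "((\<lambda>t. t powr (s - 1)) has_integral (1 powr (s - 1 + 1) / (s - 1 + 1))) {0..1}"
    using has_integral_powr_from_0[of "s - 1" 1] assms by simp
  then have "((\<lambda>t. t powr (s - 1)) has_integral (1 / s)) {0<..<1}"
    using assms by (simp add: has_integral_Icc_iff_Ioo)
  then have "(\<integral>\<^sup>+t. ennreal (indicator {0<..<1} t * t powr (s - 1)) \<partial>lborel) = ennreal (1 / s)"
    by (intro nn_integral_has_integral_lebesgue) auto
  also have "(\<lambda>t. ennreal (indicator {0<..<1} t * t powr (s - 1))) = (\<lambda>t. ennreal (t powr (s - 1)) * indicator {0<..<1} t)"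
    by (auto simp: indicator_def)
  finally show ?thesis
    by (simp add: unit_interval_def nn_integral_restrict_space)
qed

definition poisson :: "complex \<Rightarrow> complex \<Rightarrow> real" where
  "poisson w \<eta> = (1 - (norm w)\<^sup>2) / (norm (\<eta> - w))\<^sup>2"

lemma poisson_nonneg: "norm w < 1 \<Longrightarrow> 0 \<le> poisson w \<eta>"
  by (simp add: poisson_def power_le_one)

lemma continuous_on_poisson:
  assumes "norm w < 1" and that: "continuous_on A f"
  shows "continuous_on A (\<lambda>x. poisson w (cis (f x)))"
proof -
  have "cis (f x) \<noteq> w" for x using assms(1) by (metis norm_cis less_irrefl)
  then show ?thesis unfolding poisson_def by (intro continuous_intros that) auto
qed

lemma poisson_integral_holomorphic:
  fixes \<Phi> :: "complex \<Rightarrow> complex"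
  assumes w: "norm w < 1" and cont: "continuous_on (cball 0 1) \<Phi>" and hol: "\<Phi> holomorphic_on ball 0 1"
  shows "((\<lambda>x. of_real (poisson w (cis (2 * pi * x))) * \<Phi> (cis (2 * pi * x))) has_integral \<Phi> w) {0..1}"
proof -
  note nz = one_minus_cnj_mult_nonzero[OF w]
  define \<Psi> where "\<Psi> u = \<Phi> u * (of_real (1 - (norm w)\<^sup>2) / (1 - cnj w * u))" for u
  have "continuous_on (cball 0 1) \<Psi>"
    unfolding \<Psi>_def using nz by (intro continuous_intros cont) auto
  moreover have "\<Psi> holomorphic_on ball 0 1"
    unfolding \<Psi>_def using nz by (intro holomorphic_intros hol) auto
  ultimately have "((\<lambda>u. \<Psi> u / (u - w)) has_contour_integral (2 * of_real pi * \<i> * \<Psi> w)) (circlepath 0 1)"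
    using w by (intro Cauchy_integral_circlepath) auto
  moreover have "\<Psi> w = \<Phi> w"
  proof -
    have "of_real (1 - (norm w)\<^sup>2) = 1 - cnj w * w"
      by (simp add: complex_norm_square[symmetric] mult.commute)
    then show ?thesis using nz[of w] w by (simp add: \<Psi>_def)
  qed
  ultimately have "((\<lambda>x. \<Psi> (circlepath 0 1 x) / (circlepath 0 1 x - w) *
      vector_derivative (circlepath 0 1) (at x within {0..1})) has_integral (2 * of_real pi * \<i> * \<Phi> w)) {0..1}"
    by (simp add: has_contour_integral_def)
  then have "((\<lambda>x. \<Psi> (circlepath 0 1 x) / (circlepath 0 1 x - w) *
      vector_derivative (circlepath 0 1) (at x within {0..1}) / (2 * of_real pi * \<i>))
      has_integral (2 * of_real pi * \<i> * \<Phi> w / (2 * of_real pi * \<i>))) {0..1}"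
    by (rule has_integral_divide)
  then have *: "((\<lambda>x. \<Psi> (circlepath 0 1 x) / (circlepath 0 1 x - w) *
      vector_derivative (circlepath 0 1) (at x within {0..1}) / (2 * of_real pi * \<i>)) has_integral \<Phi> w) {0..1}"
    by simp
  show ?thesis
  proof (rule has_integral_eq[rotated, OF *])
    fix x :: real assume x: "x \<in> {0..1}"
    define u where "u = cis (2 * pi * x)"
    have cp: "circlepath 0 1 x = u" unfolding circlepath u_def cis_conv_exp by (simp add: mult_ac)
    have vd: "vector_derivative (circlepath 0 1) (at x within {0..1}) = 2 * of_real pi * \<i> * u"
      using x unfolding u_def cis_conv_exp by (subst vector_derivative_circlepath01) (simp_all add: mult_ac)
    have u1: "norm u = 1" by (simp add: u_def)
    have uw: "u \<noteq> w" using u1 w by auto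
    have u0: "u \<noteq> 0" using u1 by auto
    have uu: "u * cnj u = 1" using u1 by (simp add: complex_norm_square[symmetric])
    have "\<Phi> u * (c / (u * e)) / d * u = c / (d * e) * \<Phi> u" if "d \<noteq> 0" "e \<noteq> 0" for c d e
      using that u0 by (simp add: field_simps)
    moreover have "u - w \<noteq> 0" "cnj (u - w) \<noteq> 0" using uw by (simp_all del: complex_cnj_diff)
    moreover have "1 - cnj w * u = u * cnj (u - w)" using uu by (simp add: algebra_simps)
    moreover have "of_real ((norm (u - w))\<^sup>2) = (u - w) * cnj (u - w)" by (rule complex_norm_square)
    ultimately have "\<Psi> u / (u - w) * u = of_real (poisson w u) * \<Phi> u"
      unfolding \<Psi>_def poisson_def of_real_divide by (simp only:)
    then show "\<Psi> (circlepath 0 1 x) / (circlepath 0 1 x - w) *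
      vector_derivative (circlepath 0 1) (at x within {0..1}) / (2 * of_real pi * \<i>) =
      of_real (poisson w (cis (2 * pi * x))) * \<Phi> (cis (2 * pi * x))"
      unfolding cp vd u_def[symmetric] by simp
  qed
qed

lemma poisson_cnj: "poisson (cnj w) (cnj \<eta>) = poisson w \<eta>"
  unfolding poisson_def by (metis complex_cnj_diff complex_mod_cnj)

abbreviation turn :: "real \<Rightarrow> complex" where "turn x \<equiv> cis (- (2 * pi * x))"

lemma poisson_integral_kernel:
  assumes w: "norm w < 1" and z: "norm z < 1"
  shows "integrable unit_interval (\<lambda>x. of_real (poisson w (turn x)) * kernel \<alpha> (turn x) z)"
    and "(LINT x|unit_interval. of_real (poisson w (turn x)) * kernel \<alpha> (turn x) z) = kernel \<alpha> w z"
proof -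
  define f where "f x = of_real (poisson w (turn x)) * kernel \<alpha> (turn x) z" for x
  have cont: "continuous_on A f" for A
    unfolding f_def by (intro continuous_intros continuous_on_poisson continuous_on_kernel w z) auto
  have "bounded (f ` {0..1})"
    by (intro compact_imp_bounded compact_continuous_image cont) auto
  then obtain B where "\<And>x. x \<in> {0..1} \<Longrightarrow> norm (f x) \<le> B" unfolding bounded_iff by blast
  then show int: "integrable unit_interval f"
    by (intro finite_measure.integrable_const_bound[OF finite_measure_unit_interval, of _ B] AE_I2
        borel_measurable_unit_interval borel_measurable_continuous_onI cont) auto
  define \<Phi> where "\<Phi> u = 1 / (1 - u * z) powr of_real \<alpha>" for u
  have nz: "1 - u * z \<notin> \<real>\<^sub>\<le>\<^sub>0" if "norm u \<le> 1" for u
    using one_minus_not_nonpos[of "cnj u" z] that z by simp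
  have \<Phi>: "\<Phi> u = kernel \<alpha> (cnj u) z" for u by (simp add: \<Phi>_def kernel_def)
  have "continuous_on (cball 0 1) \<Phi>"
    unfolding \<Phi> by (intro continuous_on_kernel z continuous_intros) auto
  moreover have "\<Phi> holomorphic_on ball 0 1"
  proof -
    have "(1 - u * z) powr of_real \<alpha> \<noteq> 0" if "norm u \<le> 1" for u using nz[OF that] by auto
    then show ?thesis unfolding \<Phi>_def using nz by (intro holomorphic_intros) auto
  qed
  ultimately have "((\<lambda>x. of_real (poisson (cnj w) (cis (2 * pi * x))) * \<Phi> (cis (2 * pi * x))) has_integral \<Phi> (cnj w)) {0..1}"
    using w by (intro poisson_integral_holomorphic) auto
  moreover have "poisson (cnj w) (cis (2 * pi * x)) = poisson w (turn x)" for x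
    using poisson_cnj[of w "turn x"] by (simp add: cis_cnj)
  ultimately have "(f has_integral kernel \<alpha> w z) {0..1}"
    unfolding f_def \<Phi> by (simp add: cis_cnj)
  from integral_unit_interval_eq[OF int this] show "(LINT x|unit_interval. f x) = kernel \<alpha> w z" .
qed

lemma poisson_mass:
  assumes w: "norm w < 1"
  shows "integrable unit_interval (\<lambda>x. poisson w (turn x))" "(LINT x|unit_interval. poisson w (turn x)) = 1"
proof -
  have "kernel 0 \<zeta> 0 = 1" for \<zeta> by (simp add: kernel_def)
  then have "integrable unit_interval (\<lambda>x. complex_of_real (poisson w (turn x)))"
    "(LINT x|unit_interval. complex_of_real (poisson w (turn x))) = 1"
    using poisson_integral_kernel[OF w, of 0 0] by simp_all
  then show "integrable unit_interval (\<lambda>x. poisson w (turn x))" "(LINT x|unit_interval. poisson w (turn x)) = 1"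
    by (simp_all only: complex_of_real_integrable_eq integral_complex_of_real of_real_eq_1_iff)
qed

lemma poisson_diff_pointwise:
  assumes "norm w < 1" "norm v < 1" "norm \<eta> = 1"
  shows "\<bar>poisson w \<eta> - poisson v \<eta>\<bar> \<le>
    norm (w - v) * (poisson w \<eta> / (1 - (norm w)\<^sup>2) + poisson v \<eta> / (1 - (norm v)\<^sup>2))"
proof -
  have eq: "poisson w \<eta> = Re ((\<eta> + w) / (\<eta> - w))" if "norm w < 1" for w
  proof -
    have "Re ((\<eta> + w) / (\<eta> - w)) = Re ((\<eta> + w) * cnj (\<eta> - w)) / (norm (\<eta> - w))\<^sup>2"
      by (subst complex_div_cnj) (simp flip: of_real_power)
    also have "Re ((\<eta> + w) * cnj (\<eta> - w)) = (norm \<eta>)\<^sup>2 - (norm w)\<^sup>2"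
      unfolding cmod_power2 by (simp add: algebra_simps power2_eq_square)
    finally show ?thesis using assms(3) by (simp add: poisson_def)
  qed
  have ne: "\<eta> \<noteq> w" "\<eta> \<noteq> v" using assms by auto
  have p: "0 < 1 - (norm w)\<^sup>2" "0 < 1 - (norm v)\<^sup>2" using assms by (simp_all add: power_less_one_iff)
  define a where "a = 1 / norm (\<eta> - w)"
  define b where "b = 1 / norm (\<eta> - v)"
  have "\<bar>poisson w \<eta> - poisson v \<eta>\<bar> \<le> norm ((\<eta> + w) / (\<eta> - w) - (\<eta> + v) / (\<eta> - v))"
    unfolding eq[OF assms(1)] eq[OF assms(2)] using abs_Re_le_cmod[of "(\<eta> + w) / (\<eta> - w) - (\<eta> + v) / (\<eta> - v)"] by simp
  also have "(\<eta> + w) / (\<eta> - w) - (\<eta> + v) / (\<eta> - v) = 2 * \<eta> * (w - v) / ((\<eta> - w) * (\<eta> - v))"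
    using ne by (simp add: field_simps)
  also have "norm \<dots> = norm (w - v) * (2 * a * b)"
    using assms(3) by (simp add: norm_mult norm_divide a_def b_def)
  also have "\<dots> \<le> norm (w - v) * (a\<^sup>2 + b\<^sup>2)"
    by (intro mult_left_mono sum_squares_bound) simp
  also have "a\<^sup>2 + b\<^sup>2 = poisson w \<eta> / (1 - (norm w)\<^sup>2) + poisson v \<eta> / (1 - (norm v)\<^sup>2)"
    using p by (simp add: poisson_def a_def b_def power_divide)
  finally show ?thesis .
qed

lemma poisson_diff_L1:
  assumes w: "norm w < 1" and v: "norm v < 1"
  shows "(LINT x|unit_interval. \<bar>poisson w (turn x) - poisson v (turn x)\<bar>) \<le>
    norm (w - v) * (1 / (1 - (norm w)\<^sup>2) + 1 / (1 - (norm v)\<^sup>2))"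
proof -
  have "(LINT x|unit_interval. \<bar>poisson w (turn x) - poisson v (turn x)\<bar>) \<le>
    (LINT x|unit_interval. norm (w - v) *
      (poisson w (turn x) / (1 - (norm w)\<^sup>2) + poisson v (turn x) / (1 - (norm v)\<^sup>2)))"
    using poisson_mass[OF w] poisson_mass[OF v]
    by (intro integral_mono poisson_diff_pointwise w v) auto
  also have "\<dots> = norm (w - v) * (1 / (1 - (norm w)\<^sup>2) + 1 / (1 - (norm v)\<^sup>2))"
    using poisson_mass[OF w] poisson_mass[OF v] by simp
  finally show ?thesis .
qed

lemma poisson_diff_L1_le_2:
  assumes w: "norm w < 1" and v: "norm v < 1"
  shows "(LINT x|unit_interval. \<bar>poisson w (turn x) - poisson v (turn x)\<bar>) \<le> 2"
proof -
  have "(LINT x|unit_interval. \<bar>poisson w (turn x) - poisson v (turn x)\<bar>) \<le>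
    (LINT x|unit_interval. poisson w (turn x) + poisson v (turn x))"
    using poisson_mass[OF w] poisson_mass[OF v] poisson_nonneg[OF w] poisson_nonneg[OF v]
    by (intro integral_mono) (auto simp: abs_le_iff add_increasing add_increasing2)
  also have "\<dots> = 2" using poisson_mass[OF w] poisson_mass[OF v] by simp
  finally show ?thesis .
qed

section \<open>A simple pole times a Cauchy kernel\<close>

lemma norm_powr_of_real: "(z::complex) \<noteq> 0 \<Longrightarrow> norm (z powr of_real s) = norm z powr s"
  by (simp add: powr_def)

lemma powr_le_endpoints:
  fixes x :: real
  assumes "0 < r" "r \<le> x" "x \<le> R"
  shows "x powr s \<le> r powr s + R powr s"
proof (cases "0 \<le> s")
  case True
  then have "x powr s \<le> R powr s" using assms by (intro powr_mono2) auto
  then show ?thesis by (simp add: add_increasing)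
next
  case False
  then have "x powr s \<le> r powr s" using assms by (intro powr_mono2') auto
  then show ?thesis by (simp add: add_increasing2)
qed

lemma complex_powr_diff_bound:
  fixes u v :: complex
  assumes r: "0 < r" and u: "r \<le> Re u" "norm u \<le> R" and v: "r \<le> Re v" "norm v \<le> R"
  shows "norm (u powr of_real s - v powr of_real s) \<le> \<bar>s\<bar> * (r powr (s - 1) + R powr (s - 1)) * norm (u - v)"
proof -
  define S where "S = {x. r \<le> Re x} \<inter> cball (0::complex) R"
  have "convex {x. r \<le> Re x}"
    using convex_halfspace_ge[of r "1::complex"] by (simp add: inner_complex_def)
  then have cS: "convex S" unfolding S_def by (intro convex_Int convex_cball)
  show ?thesis
  proof (rule field_differentiable_bound[OF cS])
    show "u \<in> S" "v \<in> S" using u v by (auto simp: S_def)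
    fix x assume x: "x \<in> S"
    then have "0 < Re x" using r by (auto simp: S_def)
    then have x': "x \<notin> \<real>\<^sub>\<le>\<^sub>0" and x0: "x \<noteq> 0" by (auto simp: complex_nonpos_Reals_iff)
    show "((\<lambda>x. x powr of_real s) has_field_derivative of_real s * x powr (of_real s - 1)) (at x within S)"
      using has_field_derivative_powr[OF x'] by (rule has_field_derivative_at_within)
    have "norm (x powr (of_real s - 1)) = norm x powr (s - 1)"
      using norm_powr_of_real[OF x0, of "s - 1"] by simp
    also have "\<dots> \<le> r powr (s - 1) + R powr (s - 1)"
      using x r complex_Re_le_cmod[of x] by (intro powr_le_endpoints) (auto simp: S_def)
    finally show "norm (of_real s * x powr (of_real s - 1)) \<le> \<bar>s\<bar> * (r powr (s - 1) + R powr (s - 1))"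
      by (simp add: norm_mult mult_left_mono)
  qed
qed

lemma kernel_powr_minus: "kernel \<alpha> w z = (1 - cnj w * z) powr of_real (- \<alpha>)"
  by (simp add: kernel_def powr_minus_divide)

text \<open>
  Integrating \<open>t\<^sup>\<alpha>\<^sup>-\<^sup>1 dG\<close> by parts, where \<open>G(t)\<close> is the kernel at the point \<open>(1-t)v + t\<zeta>\<close>,
  uses that \<open>t\<^sup>\<alpha> G(t)\<close> has derivative \<open>\<alpha> (1 - cnj v z) t\<^sup>\<alpha>\<^sup>-\<^sup>1 (1 - cnj w\<^sub>t z)\<^sup>-\<^sup>\<alpha>\<^sup>-\<^sup>1\<close>.
\<close>

lemma segment_kernel_integral:
  assumes \<alpha>: "0 < \<alpha>" and \<zeta>: "norm \<zeta> \<le> 1" and v: "norm v \<le> 1" and z: "norm z < 1"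
  defines "G \<equiv> \<lambda>t. kernel \<alpha> ((1 - of_real t) * v + of_real t * \<zeta>) z"
  shows "(LINT t|unit_interval. of_real ((\<alpha> - 1) * t powr (\<alpha> - 2)) * (G t - G 0)) =
    G 1 - G 0 - cnj (\<zeta> - v) * z / (1 - cnj v * z) * G 1"
    and "integrable unit_interval (\<lambda>t. of_real ((\<alpha> - 1) * t powr (\<alpha> - 2)) * (G t - G 0))"
proof -
  define X where "X t = 1 - cnj ((1 - of_real t) * v + of_real t * \<zeta>) * z" for t :: real
  define A where "A = 1 - cnj v * z"
  define D where "D = cnj (\<zeta> - v) * z"
  have XA: "X t = A - of_real t * D" for t by (simp add: X_def A_def D_def algebra_simps)
  have wt: "norm ((1 - of_real t) * v + of_real t * \<zeta>) \<le> 1" if "t \<in> {0..1}" for t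
  proof -
    have "(1 - of_real t) * v + of_real t * \<zeta> = (1 - t) *\<^sub>R v + t *\<^sub>R \<zeta>" by (simp add: scaleR_conv_of_real)
    also have "\<dots> \<in> cball 0 1" using that v \<zeta> by (intro convexD convex_cball) auto
    finally show ?thesis by simp
  qed
  define r where "r = 1 - norm z"
  have r: "0 < r" using z by (simp add: r_def)
  have Xr: "r \<le> Re (X t)" "norm (X t) \<le> 2" if "t \<in> {0..1}" for t
  proof -
    have n: "norm (cnj ((1 - of_real t) * v + of_real t * \<zeta>) * z) \<le> norm z"
      using mult_right_mono[OF wt[OF that], of "norm z"] by (simp only: norm_mult complex_mod_cnj mult_1 norm_ge_zero)
    then show "r \<le> Re (X t)" using complex_Re_le_cmod[of "cnj ((1 - of_real t) * v + of_real t * \<zeta>) * z"]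
      by (simp add: X_def r_def)
    show "norm (X t) \<le> 2" unfolding X_def using n z norm_triangle_ineq4[of 1 "cnj ((1 - of_real t) * v + of_real t * \<zeta>) * z"] by simp
  qed
  have Xnp: "X t \<notin> \<real>\<^sub>\<le>\<^sub>0" "X t \<noteq> 0" if "t \<in> {0..1}" for t
    using Xr(1)[OF that] r by (auto simp: complex_nonpos_Reals_iff)
  have G: "G t = X t powr of_real (- \<alpha>)" for t by (simp only: G_def X_def kernel_powr_minus)
  define K where "K = \<alpha> * (r powr (- \<alpha> - 1) + 2 powr (- \<alpha> - 1)) * norm D"
  have lip: "norm (G t - G 0) \<le> K * t" if "t \<in> {0..1}" for t
  proof -
    have "norm (G t - G 0) \<le> \<bar>- \<alpha>\<bar> * (r powr (- \<alpha> - 1) + 2 powr (- \<alpha> - 1)) * norm (X t - X 0)"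
      unfolding G using that by (intro complex_powr_diff_bound r Xr) auto
    also have "norm (X t - X 0) = norm D * t" using that by (simp add: XA norm_mult)
    finally show ?thesis using \<alpha> by (simp add: K_def mult_ac)
  qed
  have contG: "continuous_on {0..1} G"
    unfolding G_def by (intro continuous_on_kernel z wt continuous_intros) auto
  have derG: "(G has_vector_derivative (of_real \<alpha> * D * X t powr (of_real (- \<alpha>) - 1))) (at t)" if "t \<in> {0<..<1}" for t
  proof -
    have t: "t \<in> {0..1}" using that by auto
    have dX: "(X has_vector_derivative - D) (at t)"
      unfolding XA[abs_def] by (auto intro!: derivative_eq_intros simp: has_vector_derivative_def scaleR_conv_of_real)
    have "((\<lambda>x. x powr of_real (- \<alpha>)) has_field_derivative of_real (- \<alpha>) * X t powr (of_real (- \<alpha>) - 1)) (at (X t))"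
      by (rule has_field_derivative_powr[OF Xnp(1)[OF t]])
    from field_vector_diff_chain_at[OF dX this] show ?thesis
      unfolding G[abs_def] comp_def by (simp add: mult_ac)
  qed
  define F where "F t = of_real (t powr (\<alpha> - 1)) * (G t - G 0) - of_real (t powr \<alpha>) * G t * (D / A)" for t
  let ?f = "\<lambda>t. of_real ((\<alpha> - 1) * t powr (\<alpha> - 2)) * (G t - G 0)"
  have A0: "A \<noteq> 0" using Xnp(2)[of 0] by (simp add: XA)
  have derF: "(F has_vector_derivative ?f t) (at t)" if t: "t \<in> {0<..<1}" for t
  proof -
    have p: "((\<lambda>t. complex_of_real (t powr s)) has_vector_derivative of_real (s * t powr (s - 1))) (at t)" for s
      using t by (intro has_vector_derivative_of_real) (auto intro!: derivative_eq_intros)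
    define Y where "Y = X t powr (of_real (- \<alpha>) - 1)"
    have GY: "G t = X t * Y"
      using Xnp(2)[of t] t by (simp add: G Y_def powr_diff)
    have tt: "t powr (\<alpha> - 1) * t = t powr \<alpha>" using t powr_add[of t "\<alpha> - 1" 1] by simp
    have "(F has_vector_derivative
      (of_real (t powr (\<alpha> - 1)) * (of_real \<alpha> * D * Y) + of_real ((\<alpha> - 1) * t powr (\<alpha> - 1 - 1)) * (G t - G 0))
       - (of_real (t powr \<alpha>) * (of_real \<alpha> * D * Y) + of_real (\<alpha> * t powr (\<alpha> - 1)) * G t) * (D / A)) (at t)"
      unfolding F_def Y_def
      by (intro has_vector_derivative_diff has_vector_derivative_mult has_vector_derivative_mult_left p derG[OF t]
          has_vector_derivative_diff_const[THEN iffD2])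
    moreover have "(of_real (t powr (\<alpha> - 1)) * (of_real \<alpha> * D * Y) + of_real ((\<alpha> - 1) * t powr (\<alpha> - 1 - 1)) * (G t - G 0))
       - (of_real (t powr \<alpha>) * (of_real \<alpha> * D * Y) + of_real (\<alpha> * t powr (\<alpha> - 1)) * G t) * (D / A) = ?f t"
      unfolding GY XA tt[symmetric] using A0 by (simp add: field_simps)
    ultimately show ?thesis by simp
  qed
  have contF: "continuous_on {0..1} F"
  proof -
    have c1: "continuous_on {0..1} (\<lambda>t. of_real (t powr (\<alpha> - 1)) * (G t - G 0))"
    proof (rule continuous_on_eq_continuous_within[THEN iffD2], rule ballI)
      fix t :: real assume t: "t \<in> {0..1}"
      show "continuous (at t within {0..1}) (\<lambda>t. of_real (t powr (\<alpha> - 1)) * (G t - G 0))"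
      proof (cases "t = 0")
        case False
        then have "isCont (\<lambda>t. t powr (\<alpha> - 1)) t" using t by (intro DERIV_isCont[OF has_real_derivative_powr]) auto
        moreover have "continuous (at t within {0..1}) G"
          using contG t by (simp add: continuous_on_eq_continuous_within)
        ultimately show ?thesis
          by (intro continuous_mult continuous_diff continuous_of_real continuous_const)
            (auto intro: continuous_at_imp_continuous_at_within)
      next
        case True
        have "((\<lambda>t. complex_of_real (t powr (\<alpha> - 1)) * (G t - G 0)) \<longlongrightarrow> 0) (at 0 within {0..1})"
        proof (rule Lim_null_comparison)
          show "\<forall>\<^sub>F t in at 0 within {0..1}. norm (complex_of_real (t powr (\<alpha> - 1)) * (G t - G 0)) \<le> K * t powr \<alpha>"
            unfolding eventually_at_filter
          proof (intro always_eventually allI impI)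
            fix t :: real assume t: "t \<noteq> 0" "t \<in> {0..1}"
            have "norm (complex_of_real (t powr (\<alpha> - 1)) * (G t - G 0)) \<le> t powr (\<alpha> - 1) * (K * t)"
              using lip[OF t(2)] by (simp add: norm_mult mult_left_mono)
            also have "\<dots> = K * t powr \<alpha>" using t powr_add[of t "\<alpha> - 1" 1] by simp
            finally show "norm (complex_of_real (t powr (\<alpha> - 1)) * (G t - G 0)) \<le> K * t powr \<alpha>" .
          qed
          have "((\<lambda>t. K * t powr \<alpha>) \<longlongrightarrow> K * 0 powr \<alpha>) (at 0 within {0..1})"
            using \<alpha> by (intro tendsto_intros tendsto_powr') (auto simp: eventually_at_filter)
          then show "((\<lambda>t. K * t powr \<alpha>) \<longlongrightarrow> 0) (at 0 within {0..1})" by simp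
        qed
        then show ?thesis using True by (simp add: continuous_within)
      qed
    qed
    moreover have "continuous_on {0..1} (\<lambda>t::real. t powr \<alpha>)"
      using \<alpha> by (intro continuous_on_powr' continuous_intros) auto
    ultimately show ?thesis unfolding F_def
      by (intro continuous_on_diff[OF c1] continuous_on_mult continuous_on_const contG continuous_on_of_real)
  qed
  have "(?f has_integral F 1 - F 0) {0..1}"
    by (intro fundamental_theorem_of_calculus_interior contF derF) auto
  moreover have "F 1 - F 0 = G 1 - G 0 - D / A * G 1" by (simp add: F_def)
  ultimately have hi: "(?f has_integral (G 1 - G 0 - D / A * G 1)) {0..1}" by simp
  show int: "integrable unit_interval ?f"
  proof (rule integrableI_bounded)
    have "continuous_on {0<..<1} ?f"
      by (intro continuous_intros continuous_on_subset[OF contG]) auto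
    then show "?f \<in> borel_measurable unit_interval"
      unfolding measurable_cong_sets[OF sets_unit_interval refl]
      by (rule borel_measurable_continuous_on_restrict)
    have "(\<integral>\<^sup>+t. ennreal (norm (?f t)) \<partial>unit_interval) \<le>
      (\<integral>\<^sup>+t. ennreal (\<bar>\<alpha> - 1\<bar> * K) * ennreal (t powr (\<alpha> - 1)) \<partial>unit_interval)"
    proof (intro nn_integral_mono)
      fix t assume "t \<in> space unit_interval"
      then have t: "t \<in> {0..1}" "0 < t" by auto
      have "norm (?f t) \<le> \<bar>\<alpha> - 1\<bar> * t powr (\<alpha> - 2) * (K * t)"
        using lip[OF t(1)] unfolding norm_mult norm_of_real by (simp add: mult_left_mono abs_mult)
      also have "\<dots> = (\<bar>\<alpha> - 1\<bar> * K) * t powr (\<alpha> - 1)"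
        using t powr_add[of t "\<alpha> - 2" 1] by simp
      finally show "ennreal (norm (?f t)) \<le> ennreal (\<bar>\<alpha> - 1\<bar> * K) * ennreal (t powr (\<alpha> - 1))"
        by (simp add: ennreal_leI flip: ennreal_mult'')
    qed
    also have "\<dots> = ennreal (\<bar>\<alpha> - 1\<bar> * K) * ennreal (1 / \<alpha>)"
      using nn_integral_powr_unit_interval[OF \<alpha>]
      by (subst nn_integral_cmult) (auto intro!: borel_measurable_unit_interval)
    also have "\<dots> < \<infinity>" by (simp add: ennreal_mult_less_top)
    finally show "(\<integral>\<^sup>+t. ennreal (norm (?f t)) \<partial>unit_interval) < \<infinity>" .
  qed
  show "(LINT t|unit_interval. ?f t) = G 1 - G 0 - cnj (\<zeta> - v) * z / (1 - cnj v * z) * G 1"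
    using integral_unit_interval_eq[OF int hi] by (simp add: D_def A_def)
qed

lemma measurable_pair_ident:
  assumes "(\<lambda>x. x) \<in> measurable A A'" "(\<lambda>x. x) \<in> measurable B B'"
  shows "(\<lambda>x. x) \<in> measurable (A \<Otimes>\<^sub>M B) (A' \<Otimes>\<^sub>M B')"
proof -
  have "(\<lambda>x. (fst x, snd x)) \<in> measurable (A \<Otimes>\<^sub>M B) (A' \<Otimes>\<^sub>M B')"
    by (intro measurable_Pair measurable_compose[OF measurable_fst assms(1)] measurable_compose[OF measurable_snd assms(2)])
  then show ?thesis by simp
qed

lemma unit_interval_ident: "(\<lambda>x. x) \<in> measurable unit_interval borel"
  by (rule borel_measurable_unit_interval) simp

definition outer_pole :: "complex \<Rightarrow> complex \<Rightarrow> complex" where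
  "outer_pole v z = of_real (1 - norm v) * z / (1 - cnj v * z)"

definition segm :: "complex \<Rightarrow> complex \<Rightarrow> real \<Rightarrow> complex" where
  "segm v \<zeta> t = (1 - of_real t) * v + of_real t * \<zeta>"

lemma norm_segm:
  assumes "norm v < 1" "norm \<zeta> = 1" "t \<in> {0<..<1}"
  shows "norm (segm v \<zeta> t) < 1" "(1 - t) * (1 - norm v) \<le> 1 - (norm (segm v \<zeta> t))\<^sup>2"
proof -
  have "norm (segm v \<zeta> t) \<le> norm ((1 - of_real t) * v) + norm (of_real t * \<zeta>)"
    unfolding segm_def by (rule norm_triangle_ineq)
  also have "norm ((1 - of_real t) * v) = (1 - t) * norm v"
    using assms(3) norm_of_real[of "1 - t", where 'a = complex] by (simp add: norm_mult)
  also have "norm (of_real t * \<zeta>) = t" using assms by (simp add: norm_mult)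
  finally have *: "norm (segm v \<zeta> t) \<le> (1 - t) * norm v + t" .
  have "(1 - t) * norm v < (1 - t) * 1" using assms by (intro mult_strict_left_mono) auto
  then show 1: "norm (segm v \<zeta> t) < 1" using * by simp
  have "(norm (segm v \<zeta> t))\<^sup>2 \<le> norm (segm v \<zeta> t)" using 1 by (simp add: power2_eq_square mult_left_le)
  then show "(1 - t) * (1 - norm v) \<le> 1 - (norm (segm v \<zeta> t))\<^sup>2" using * by (simp add: algebra_simps)
qed

definition pole_coeff :: "complex \<Rightarrow> complex \<Rightarrow> complex" where
  "pole_coeff v \<zeta> = of_real (1 - norm v) / cnj (\<zeta> - v)"

lemma norm_pole_coeff_le:
  assumes "norm v < 1" "norm \<zeta> = 1"
  shows "norm (pole_coeff v \<zeta>) \<le> 1" "norm (pole_coeff v \<zeta>) * norm (\<zeta> - v) = 1 - norm v"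
proof -
  have n: "norm (pole_coeff v \<zeta>) = (1 - norm v) / norm (\<zeta> - v)"
    using assms unfolding pole_coeff_def norm_divide norm_of_real complex_mod_cnj by simp
  have ge: "1 - norm v \<le> norm (\<zeta> - v)" using norm_triangle_ineq2[of \<zeta> v] assms by simp
  then show "norm (pole_coeff v \<zeta>) \<le> 1" unfolding n using assms by (simp add: divide_le_eq)
  show "norm (pole_coeff v \<zeta>) * norm (\<zeta> - v) = 1 - norm v" proof -
    have "\<zeta> \<noteq> v" using assms by auto
    then show ?thesis unfolding n by simp
  qed
qed

lemma pole_coeff_poisson_diff:
  assumes v: "norm v < 1" and \<zeta>: "norm \<zeta> = 1" and t: "t \<in> {0<..<1}"
  shows "norm (pole_coeff v \<zeta>) *
    (LINT y|unit_interval. \<bar>poisson (segm v \<zeta> t) (turn y) - poisson v (turn y)\<bar>) \<le> 4 * t"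
proof (cases "t \<le> 1/2")
  case True
  let ?w = "segm v \<zeta> t"
  note w = norm_segm[OF v \<zeta> t]
  have "(norm v)\<^sup>2 \<le> norm v" using v by (simp add: power2_eq_square mult_left_le)
  then have "1 / (1 - (norm v)\<^sup>2) \<le> 1 / (1 - norm v)" using v by (intro divide_left_mono) (auto simp: power_less_one_iff)
  moreover have "(1 - norm v) / 2 \<le> 1 - (norm ?w)\<^sup>2"
  proof -
    have "1/2 * (1 - norm v) \<le> (1 - t) * (1 - norm v)" using True v by (intro mult_right_mono) auto
    then show ?thesis using w(2) by linarith
  qed
  then have "1 / (1 - (norm ?w)\<^sup>2) \<le> 1 / ((1 - norm v) / 2)"
    using v w(1) by (intro divide_left_mono) (auto simp: power_less_one_iff)
  ultimately have "1 / (1 - (norm ?w)\<^sup>2) + 1 / (1 - (norm v)\<^sup>2) \<le> 3 / (1 - norm v)" using v by (simp add: field_simps)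
  then have "(LINT y|unit_interval. \<bar>poisson ?w (turn y) - poisson v (turn y)\<bar>) \<le> norm (?w - v) * (3 / (1 - norm v))"
    by (intro order_trans[OF poisson_diff_L1[OF w(1) v]] mult_left_mono) auto
  also have "?w - v = of_real t * (\<zeta> - v)" by (simp add: segm_def algebra_simps)
  finally have "norm (pole_coeff v \<zeta>) * (LINT y|unit_interval. \<bar>poisson ?w (turn y) - poisson v (turn y)\<bar>)
    \<le> norm (pole_coeff v \<zeta>) * (norm (of_real t * (\<zeta> - v)) * (3 / (1 - norm v)))"
    by (rule mult_left_mono) simp
  also have "\<dots> = 3 * t * (norm (pole_coeff v \<zeta>) * norm (\<zeta> - v)) / (1 - norm v)"
    using t by (simp add: norm_mult)
  also have "\<dots> \<le> 4 * t" unfolding norm_pole_coeff_le(2)[OF v \<zeta>] using t v by simp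
  finally show ?thesis .
next
  case False
  have "norm (pole_coeff v \<zeta>) *
    (LINT y|unit_interval. \<bar>poisson (segm v \<zeta> t) (turn y) - poisson v (turn y)\<bar>) \<le> 1 * 2"
    by (intro mult_mono norm_pole_coeff_le v \<zeta> poisson_diff_L1_le_2 norm_segm t) auto
  then show ?thesis using False by simp
qed

definition seg_density :: "real \<Rightarrow> complex \<Rightarrow> complex \<Rightarrow> real \<times> real \<Rightarrow> complex" where
  "seg_density \<alpha> v \<zeta> p = pole_coeff v \<zeta> * of_real ((\<alpha> - 1) * fst p powr (\<alpha> - 2) *
     (poisson (segm v \<zeta> (fst p)) (turn (snd p)) - poisson v (turn (snd p))))"

interpretation unit_interval: finite_measure unit_interval
  by (rule finite_measure_unit_interval)

interpretation unit_square: pair_sigma_finite unit_interval unit_interval ..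

abbreviation unit_square :: "(real \<times> real) measure" where
  "unit_square \<equiv> unit_interval \<Otimes>\<^sub>M unit_interval"

lemma seg_density_measurable: "seg_density \<alpha> v \<zeta> \<in> borel_measurable unit_square"
proof -
  have "seg_density \<alpha> v \<zeta> \<in> borel_measurable (borel \<Otimes>\<^sub>M borel)"
    unfolding seg_density_def poisson_def segm_def by measurable
  then show ?thesis
    using measurable_compose[OF measurable_pair_ident[OF unit_interval_ident unit_interval_ident]] by blast
qed

lemma poisson_diff_integrable:
  assumes "norm w < 1" "norm v < 1"
  shows "integrable unit_interval (\<lambda>y. \<bar>poisson w (turn y) - poisson v (turn y)\<bar>)"
  using poisson_mass[OF assms(1)] poisson_mass[OF assms(2)] by auto

lemma seg_density_L1:
  assumes \<alpha>: "0 < \<alpha>" and v: "norm v < 1" and \<zeta>: "norm \<zeta> = 1"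
  shows "(\<integral>\<^sup>+p. ennreal (norm (seg_density \<alpha> v \<zeta> p)) \<partial>unit_square) \<le> ennreal (4 * \<bar>\<alpha> - 1\<bar> / \<alpha>)"
proof -
  note [measurable] = seg_density_measurable
  have "(\<integral>\<^sup>+p. ennreal (norm (seg_density \<alpha> v \<zeta> p)) \<partial>unit_square) =
    (\<integral>\<^sup>+t. \<integral>\<^sup>+y. ennreal (norm (seg_density \<alpha> v \<zeta> (t, y))) \<partial>unit_interval \<partial>unit_interval)"
    by (rule unit_interval.nn_integral_fst[symmetric]) measurable
  also have "\<dots> \<le> (\<integral>\<^sup>+t. ennreal (4 * \<bar>\<alpha> - 1\<bar>) * ennreal (t powr (\<alpha> - 1)) \<partial>unit_interval)"
  proof (rule nn_integral_mono)
    fix t assume "t \<in> space unit_interval"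
    then have t: "t \<in> {0<..<1}" by simp
    let ?D = "\<lambda>y. \<bar>poisson (segm v \<zeta> t) (turn y) - poisson v (turn y)\<bar>"
    let ?c = "norm (pole_coeff v \<zeta>) * (\<bar>\<alpha> - 1\<bar> * t powr (\<alpha> - 2))"
    have int: "integrable unit_interval ?D"
      by (intro poisson_diff_integrable norm_segm v \<zeta> t)
    have "(\<integral>\<^sup>+y. ennreal (norm (seg_density \<alpha> v \<zeta> (t, y))) \<partial>unit_interval) = (\<integral>\<^sup>+y. ennreal (?c * ?D y) \<partial>unit_interval)"
      by (intro nn_integral_cong arg_cong[of _ _ ennreal])
        (simp only: seg_density_def norm_mult norm_of_real abs_mult fst_conv snd_conv, simp add: mult_ac)
    also have "\<dots> = ennreal (LINT y|unit_interval. ?c * ?D y)"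
      by (intro nn_integral_eq_integral integrable_mult_right int AE_I2) simp
    also have "(LINT y|unit_interval. ?c * ?D y) = \<bar>\<alpha> - 1\<bar> * t powr (\<alpha> - 2) * (norm (pole_coeff v \<zeta>) * (LINT y|unit_interval. ?D y))"
      by (simp add: mult_ac)
    also have "\<dots> \<le> \<bar>\<alpha> - 1\<bar> * t powr (\<alpha> - 2) * (4 * t)"
      by (intro mult_left_mono pole_coeff_poisson_diff v \<zeta> t) simp
    also have "\<dots> = 4 * \<bar>\<alpha> - 1\<bar> * t powr (\<alpha> - 1)"
      using t powr_add[of t "\<alpha> - 2" 1] by simp
    finally show "(\<integral>\<^sup>+y. ennreal (norm (seg_density \<alpha> v \<zeta> (t, y))) \<partial>unit_interval) \<le> ennreal (4 * \<bar>\<alpha> - 1\<bar>) * ennreal (t powr (\<alpha> - 1))"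
      by (simp add: ennreal_leI flip: ennreal_mult'')
  qed
  also have "\<dots> = ennreal (4 * \<bar>\<alpha> - 1\<bar>) * ennreal (1 / \<alpha>)"
    using nn_integral_powr_unit_interval[OF \<alpha>]
    by (subst nn_integral_cmult) (auto intro!: borel_measurable_unit_interval)
  also have "\<dots> = ennreal (4 * \<bar>\<alpha> - 1\<bar> / \<alpha>)" using \<alpha> by (simp flip: ennreal_mult)
  finally show ?thesis .
qed

lemma seg_density_kernel:
  assumes \<alpha>: "0 < \<alpha>" and v: "norm v < 1" and \<zeta>: "norm \<zeta> = 1" and z: "norm z < 1"
  shows "(LINT p|unit_square. seg_density \<alpha> v \<zeta> p * kernel \<alpha> (turn (snd p)) z) =
    pole_coeff v \<zeta> * (kernel \<alpha> \<zeta> z - kernel \<alpha> v z) - outer_pole v z * kernel \<alpha> \<zeta> z"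
proof -
  note [measurable] = measurable_compose[OF _ kernel_measurable_cis[OF z]] seg_density_measurable
  obtain B where B: "\<And>\<zeta>. norm \<zeta> \<le> 1 \<Longrightarrow> norm (kernel \<alpha> \<zeta> z) \<le> B"
    using kernel_bounded[OF z] by blast
  have i1: "integrable unit_square (seg_density \<alpha> v \<zeta>)"
    using seg_density_L1[OF \<alpha> v \<zeta>] by (intro integrableI_bounded) (auto simp: less_top[symmetric] top_unique)
  have km: "(\<lambda>p. kernel \<alpha> (turn (snd p)) z) \<in> borel_measurable unit_square"
  proof -
    have "(\<lambda>p::real\<times>real. kernel \<alpha> (turn (snd p)) z) \<in> borel_measurable (borel \<Otimes>\<^sub>M borel)" by measurable
    then show ?thesis
      using measurable_compose[OF measurable_pair_ident[OF unit_interval_ident unit_interval_ident]] by blast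
  qed
  have int: "integrable unit_square (\<lambda>p. seg_density \<alpha> v \<zeta> p * kernel \<alpha> (turn (snd p)) z)"
    by (rule integrable_mult_bounded[OF i1 km, of B]) (simp add: B)
  have "(LINT p|unit_square. seg_density \<alpha> v \<zeta> p * kernel \<alpha> (turn (snd p)) z) =
    (LINT t|unit_interval. LINT y|unit_interval. seg_density \<alpha> v \<zeta> (t, y) * kernel \<alpha> (turn y) z)"
    using unit_square.integral_fst'[OF int] by simp
  also have "\<dots> = (LINT t|unit_interval. pole_coeff v \<zeta> * (of_real ((\<alpha> - 1) * t powr (\<alpha> - 2)) *
      (kernel \<alpha> (segm v \<zeta> t) z - kernel \<alpha> v z)))"
  proof (rule Bochner_Integration.integral_cong[OF refl])
    fix t assume "t \<in> space unit_interval"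
    then have t: "t \<in> {0<..<1}" by simp
    note P1 = poisson_integral_kernel[OF norm_segm(1)[OF v \<zeta> t] z, of \<alpha>]
    note P2 = poisson_integral_kernel[OF v z, of \<alpha>]
    have "(LINT y|unit_interval. seg_density \<alpha> v \<zeta> (t, y) * kernel \<alpha> (turn y) z) =
      (LINT y|unit_interval. (pole_coeff v \<zeta> * of_real ((\<alpha> - 1) * t powr (\<alpha> - 2))) *
        (of_real (poisson (segm v \<zeta> t) (turn y)) * kernel \<alpha> (turn y) z
         - of_real (poisson v (turn y)) * kernel \<alpha> (turn y) z))"
      by (intro Bochner_Integration.integral_cong refl) (simp add: seg_density_def algebra_simps)
    also have "\<dots> = (pole_coeff v \<zeta> * of_real ((\<alpha> - 1) * t powr (\<alpha> - 2))) *
      (kernel \<alpha> (segm v \<zeta> t) z - kernel \<alpha> v z)"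
      by (subst integral_mult_right_zero, subst Bochner_Integration.integral_diff[OF P1(1) P2(1)]) (simp only: P1(2) P2(2))
    finally show "(LINT y|unit_interval. seg_density \<alpha> v \<zeta> (t, y) * kernel \<alpha> (turn y) z) =
      pole_coeff v \<zeta> * (of_real ((\<alpha> - 1) * t powr (\<alpha> - 2)) * (kernel \<alpha> (segm v \<zeta> t) z - kernel \<alpha> v z))"
      by (simp only: mult.assoc)
  qed
  also have "\<dots> = pole_coeff v \<zeta> * (LINT t|unit_interval. of_real ((\<alpha> - 1) * t powr (\<alpha> - 2)) *
      (kernel \<alpha> (segm v \<zeta> t) z - kernel \<alpha> v z))"
    by (rule integral_mult_right_zero)
  also have "(LINT t|unit_interval. of_real ((\<alpha> - 1) * t powr (\<alpha> - 2)) *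
      (kernel \<alpha> (segm v \<zeta> t) z - kernel \<alpha> v z)) =
      kernel \<alpha> \<zeta> z - kernel \<alpha> v z - cnj (\<zeta> - v) * z / (1 - cnj v * z) * kernel \<alpha> \<zeta> z"
    using segment_kernel_integral(1)[OF \<alpha> _ less_imp_le[OF v] z, of \<zeta>] \<zeta> by (simp add: segm_def)
  also have "pole_coeff v \<zeta> * \<dots> = pole_coeff v \<zeta> * (kernel \<alpha> \<zeta> z - kernel \<alpha> v z)
      - outer_pole v z * kernel \<alpha> \<zeta> z"
  proof -
    have cancel: "a / e * (e * z / b) = a * z / b" if "e \<noteq> 0" for a b e :: complex using that by simp
    have "cnj (\<zeta> - v) \<noteq> 0" using v \<zeta> by (metis complex_cnj_zero_iff eq_iff_diff_eq_0 less_irrefl)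
    then have "pole_coeff v \<zeta> * (cnj (\<zeta> - v) * z / (1 - cnj v * z)) = outer_pole v z"
      unfolding pole_coeff_def outer_pole_def by (rule cancel)
    then show ?thesis by (simp only: right_diff_distrib mult.assoc[symmetric])
  qed
  finally show ?thesis .
qed

lemma borel_measurable_cnj [measurable]: "cnj \<in> borel_measurable borel"
  by (intro borel_measurable_continuous_onI continuous_intros)

lemma rep_product:
  fixes N :: "(real \<times> real) measure" and H :: "real \<times> real \<Rightarrow> 'b \<Rightarrow> complex"
  assumes N: "finite_measure N" "emeasure N (space N) \<le> ennreal V" "0 \<le> V" and M: "finite_measure M"
    and H: "(\<lambda>(x, y). H x y) \<in> borel_measurable (N \<Otimes>\<^sub>M M)" and \<eta>: "\<eta> \<in> borel_measurable M"
    and c: "\<And>x. (\<integral>\<^sup>+y. ennreal (norm (H x y)) \<partial>M) \<le> ennreal c" "0 \<le> c"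
  shows "rep \<alpha> (\<lambda>z. LINT x|N. LINT y|M. H x y * kernel \<alpha> (cis (\<eta> y)) z) (c * V)"
proof -
  interpret N: finite_measure N by (rule N)
  interpret M: finite_measure M by (rule M)
  interpret pair_sigma_finite N M ..
  note [measurable] = H \<eta>
  let ?h = "\<lambda>(x, y). H x y"
  have "(\<integral>\<^sup>+p. ennreal (norm (?h p)) \<partial>(N \<Otimes>\<^sub>M M)) = (\<integral>\<^sup>+x. \<integral>\<^sup>+y. ennreal (norm (?h (x, y))) \<partial>M \<partial>N)"
    by (rule M.nn_integral_fst[symmetric]) measurable
  also have "\<dots> \<le> (\<integral>\<^sup>+x. ennreal c \<partial>N)" using c by (intro nn_integral_mono) simp
  also have "\<dots> \<le> ennreal c * ennreal V" using N(2) by (simp add: mult_left_mono)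
  also have "\<dots> = ennreal (c * V)" using c N(3) by (simp add: ennreal_mult)
  finally have nn: "(\<integral>\<^sup>+p. ennreal (norm (?h p)) \<partial>(N \<Otimes>\<^sub>M M)) \<le> ennreal (c * V)" .
  then have int: "integrable (N \<Otimes>\<^sub>M M) ?h"
    by (intro integrableI_bounded) (auto simp: less_top[symmetric] top_unique)
  show ?thesis
  proof (rule rep_superposition[where M = "N \<Otimes>\<^sub>M M" and h = ?h and \<eta> = "\<lambda>p. \<eta> (snd p)"])
    show "integrable (N \<Otimes>\<^sub>M M) ?h" by (rule int)
    show "(\<lambda>p. \<eta> (snd p)) \<in> borel_measurable (N \<Otimes>\<^sub>M M)" by measurable
    show "(\<integral>\<^sup>+p. ennreal (norm (?h p)) \<partial>(N \<Otimes>\<^sub>M M)) \<le> ennreal (c * V)" by (rule nn)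
    show "0 \<le> c * V" using c N by simp
    fix z :: complex assume z: "norm z < 1"
    note [measurable] = measurable_compose[OF _ kernel_measurable_cis[OF z]]
    obtain B where B: "\<And>\<zeta>. norm \<zeta> \<le> 1 \<Longrightarrow> norm (kernel \<alpha> \<zeta> z) \<le> B"
      using kernel_bounded[OF z] by blast
    have "integrable (N \<Otimes>\<^sub>M M) (\<lambda>p. ?h p * kernel \<alpha> (cis (\<eta> (snd p))) z)"
      by (rule integrable_mult_bounded[OF int, of _ B]) (simp_all add: B)
    from integral_fst'[OF this]
    show "(LINT x|N. LINT y|M. H x y * kernel \<alpha> (cis (\<eta> y)) z) =
      (LINT p|(N \<Otimes>\<^sub>M M). ?h p * kernel \<alpha> (cis (\<eta> (snd p))) z)" by simp
  qed
qed

lemma rep_outer_pole: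
  assumes \<alpha>: "0 < \<alpha>" and v: "norm v < 1" and g: "rep \<alpha> g V"
  shows "rep \<alpha> (\<lambda>z. outer_pole v z * g z) ((2 + 4 * \<bar>\<alpha> - 1\<bar> / \<alpha>) * V)"
proof -
  obtain N where "rep_measure \<alpha> g V N"
    by (rule repE[OF g])
  note N = rep_measureD[OF this]
  interpret N: finite_measure N by (rule N)
  have setsN [measurable_cong]: "sets N = sets (borel \<Otimes>\<^sub>M borel)" using N(1) by (simp only: borel_prod)
  have idN: "(\<lambda>x. x) \<in> measurable N (borel \<Otimes>\<^sub>M borel)" by measurable
  let ?\<kappa> = "\<lambda>x::real\<times>real. cis (fst x) * pole_coeff v (cis (snd x))"
  have km [measurable]: "?\<kappa> \<in> borel_measurable N" unfolding pole_coeff_def by measurable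
  have kb: "norm (?\<kappa> x) \<le> 1" for x using norm_pole_coeff_le[OF v, of "cis (snd x)"] by (simp add: norm_mult)
  have ki: "integrable N ?\<kappa>" by (rule N.integrable_const_bound[of _ 1]) (simp_all add: kb km)
  define P1 where "P1 z = (LINT x|N. ?\<kappa> x * kernel \<alpha> (cis (snd x)) z)" for z
  define P2 where "P2 z = (LINT x|N. LINT y|unit_interval. (?\<kappa> x * of_real (poisson v (turn y))) * kernel \<alpha> (turn y) z)" for z
  define P3 where "P3 z = (LINT x|N. LINT p|unit_square.
    (cis (fst x) * seg_density \<alpha> v (cis (snd x)) p) * kernel \<alpha> (turn (snd p)) z)" for z
  have "rep \<alpha> P1 (1 * V)"
  proof (rule rep_superposition[where M = N and h = ?\<kappa> and \<eta> = snd])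
    have "(\<integral>\<^sup>+x. ennreal (norm (?\<kappa> x)) \<partial>N) \<le> (\<integral>\<^sup>+x. 1 \<partial>N)"
      by (intro nn_integral_mono) (use kb in \<open>simp add: ennreal_leI[of _ 1, simplified]\<close>)
    then show "(\<integral>\<^sup>+x. ennreal (norm (?\<kappa> x)) \<partial>N) \<le> ennreal (1 * V)" using N(4) by (simp add: order_trans)
  qed (use ki N(3) P1_def in auto)
  moreover have "rep \<alpha> P2 (1 * V)"
    unfolding P2_def
  proof (rule rep_product[OF N(2,4,3) finite_measure_unit_interval])
    have "(\<lambda>(x, y). ?\<kappa> x * of_real (poisson v (turn y))) \<in> borel_measurable ((borel \<Otimes>\<^sub>M borel) \<Otimes>\<^sub>M borel)"
      unfolding pole_coeff_def poisson_def by measurable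
    then show "(\<lambda>(x, y). ?\<kappa> x * of_real (poisson v (turn y))) \<in> borel_measurable (N \<Otimes>\<^sub>M unit_interval)"
      using measurable_compose[OF measurable_pair_ident[OF idN unit_interval_ident]] by blast
    show "(\<lambda>y. - (2 * pi * y)) \<in> borel_measurable unit_interval"
      by (rule borel_measurable_unit_interval) measurable
    fix x
    have "(\<integral>\<^sup>+y. ennreal (norm (?\<kappa> x * of_real (poisson v (turn y)))) \<partial>unit_interval) \<le>
      (\<integral>\<^sup>+y. ennreal (poisson v (turn y)) \<partial>unit_interval)"
    proof (intro nn_integral_mono ennreal_leI)
      fix y
      show "norm (?\<kappa> x * of_real (poisson v (turn y))) \<le> poisson v (turn y)"
        using mult_right_mono[OF kb[of x], of "poisson v (turn y)"] poisson_nonneg[OF v, of "turn y"]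
        by (simp only: norm_mult[of "?\<kappa> x"] norm_of_real abs_of_nonneg mult_1)
    qed
    also have "\<dots> = ennreal 1"
      using nn_integral_eq_integral[OF poisson_mass(1)[OF v]] poisson_mass(2)[OF v] poisson_nonneg[OF v] by simp
    finally show "(\<integral>\<^sup>+y. ennreal (norm (?\<kappa> x * of_real (poisson v (turn y)))) \<partial>unit_interval) \<le> ennreal 1" .
  qed simp
  moreover have "rep \<alpha> P3 ((4 * \<bar>\<alpha> - 1\<bar> / \<alpha>) * V)"
    unfolding P3_def
  proof (rule rep_product[OF N(2,4,3), where \<eta> = "\<lambda>p. - (2 * pi * snd p)"])
    show "finite_measure unit_square"
    proof (rule finite_measureI)
      have "emeasure unit_square (space unit_interval \<times> space unit_interval) =
        emeasure unit_interval (space unit_interval) * emeasure unit_interval (space unit_interval)"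
        by (rule unit_interval.emeasure_pair_measure_Times[OF sets.top sets.top])
      then show "emeasure unit_square (space unit_square) \<noteq> \<infinity>"
        unfolding space_pair_measure by simp
    qed
    have "(\<lambda>(x, p). cis (fst x) * seg_density \<alpha> v (cis (snd x)) p) \<in> borel_measurable ((borel \<Otimes>\<^sub>M borel) \<Otimes>\<^sub>M (borel \<Otimes>\<^sub>M borel))"
      unfolding seg_density_def poisson_def segm_def pole_coeff_def by measurable
    then show "(\<lambda>(x, p). cis (fst x) * seg_density \<alpha> v (cis (snd x)) p) \<in> borel_measurable (N \<Otimes>\<^sub>M unit_square)"
      using measurable_compose[OF measurable_pair_ident[OF idN measurable_pair_ident[OF unit_interval_ident unit_interval_ident]]] by blast
    show "(\<lambda>p. - (2 * pi * snd p)) \<in> borel_measurable unit_square"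
      by (intro borel_measurable_uminus borel_measurable_times borel_measurable_const
          measurable_compose[OF measurable_snd unit_interval_ident])
    show "(\<integral>\<^sup>+p. ennreal (norm (cis (fst x) * seg_density \<alpha> v (cis (snd x)) p)) \<partial>unit_square) \<le> ennreal (4 * \<bar>\<alpha> - 1\<bar> / \<alpha>)" for x :: "real \<times> real"
      using seg_density_L1[OF \<alpha> v, of "cis (snd x)"] by (simp add: norm_mult)
    show "0 \<le> 4 * \<bar>\<alpha> - 1\<bar> / \<alpha>" using \<alpha> by simp
  qed
  ultimately have "rep \<alpha> (\<lambda>z. P1 z + ((-1) * P2 z + (-1) * P3 z)) (1 * V + (norm (-1::complex) * (1 * V) + norm (-1::complex) * ((4 * \<bar>\<alpha> - 1\<bar> / \<alpha>) * V)))"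
    by (intro rep_add rep_cmult)
  also have "1 * V + (norm (-1::complex) * (1 * V) + norm (-1::complex) * ((4 * \<bar>\<alpha> - 1\<bar> / \<alpha>) * V)) = (2 + 4 * \<bar>\<alpha> - 1\<bar> / \<alpha>) * V"
    by (simp add: distrib_right)
  finally show ?thesis
  proof (rule rep_cong)
    fix z :: complex assume z: "norm z < 1"
    note [measurable] = measurable_compose[OF _ kernel_measurable_cis[OF z]]
    obtain B where B: "\<And>\<zeta>. norm \<zeta> \<le> 1 \<Longrightarrow> norm (kernel \<alpha> \<zeta> z) \<le> B"
      using kernel_bounded[OF z] by blast
    have i1: "integrable N (\<lambda>x. ?\<kappa> x * kernel \<alpha> (cis (snd x)) z)"
      by (rule integrable_mult_bounded[OF ki, of _ B]) (simp_all add: B)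
    have i2: "integrable N (\<lambda>x. ?\<kappa> x * kernel \<alpha> v z)"
      using ki by simp
    have i3: "integrable N (\<lambda>x. cis (fst x) * kernel \<alpha> (cis (snd x)) z)"
      by (rule integrable_mult_bounded[OF _ _, of _ _ _ B], rule N.integrable_const_bound[of _ 1]) (simp_all add: B)
    have pull: "(LINT y|M. (a * f y) * h y) = a * (LINT y|M. f y * h y)" for M :: "'m measure" and a :: complex and f h
      by (simp only: mult.assoc integral_mult_right_zero)
    have "P2 z = (LINT x|N. ?\<kappa> x * kernel \<alpha> v z)"
      unfolding P2_def pull poisson_integral_kernel(2)[OF v z] ..
    moreover have "P3 z = (LINT x|N. (?\<kappa> x * kernel \<alpha> (cis (snd x)) z - ?\<kappa> x * kernel \<alpha> v z)
        - outer_pole v z * (cis (fst x) * kernel \<alpha> (cis (snd x)) z))"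
      unfolding P3_def pull seg_density_kernel[OF \<alpha> v norm_cis z] by (simp add: algebra_simps)
    then have "P3 z = (P1 z - (LINT x|N. ?\<kappa> x * kernel \<alpha> v z)) - outer_pole v z * g z"
      unfolding P1_def N(5)[OF z] using i1 i2 i3 by simp
    ultimately show "P1 z + ((-1) * P2 z + (-1) * P3 z) = outer_pole v z * g z" by simp
  qed
qed

section \<open>Multipliers with norm bounds\<close>

definition mult_bound :: "real \<Rightarrow> real \<Rightarrow> (complex \<Rightarrow> complex) \<Rightarrow> bool" where
  "mult_bound \<alpha> C f \<longleftrightarrow> f holomorphic_on unit_disk \<and> (\<forall>z\<in>unit_disk. norm (f z) \<le> C) \<and>
     (\<forall>g V. rep \<alpha> g V \<longrightarrow> rep \<alpha> (\<lambda>z. f z * g z) (C * V))"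

lemma mult_boundD:
  assumes "mult_bound \<alpha> C f"
  shows "f holomorphic_on unit_disk" "norm z < 1 \<Longrightarrow> norm (f z) \<le> C" "0 \<le> C"
    "rep \<alpha> g V \<Longrightarrow> rep \<alpha> (\<lambda>z. f z * g z) (C * V)"
proof -
  show "f holomorphic_on unit_disk" "norm z < 1 \<Longrightarrow> norm (f z) \<le> C"
    "rep \<alpha> g V \<Longrightarrow> rep \<alpha> (\<lambda>z. f z * g z) (C * V)" using assms by (auto simp: mult_bound_def)
  have "norm (f 0) \<le> C" using assms by (auto simp: mult_bound_def)
  then show "0 \<le> C" using norm_ge_zero order_trans by blast
qed

lemma mult_bound_mono:
  assumes f: "mult_bound \<alpha> C f" and "C \<le> D" shows "mult_bound \<alpha> D f"
  unfolding mult_bound_def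
proof (intro conjI ballI allI impI)
  show "f holomorphic_on unit_disk" by (rule mult_boundD(1)[OF f])
  show "norm (f z) \<le> D" if "z \<in> unit_disk" for z
    using mult_boundD(2)[OF f, of z] that assms(2) by simp
  show "rep \<alpha> (\<lambda>z. f z * g z) (D * V)" if "rep \<alpha> g V" for g V
    using that assms(2) by (intro rep_mono[OF mult_boundD(4)[OF f that]] mult_right_mono) (auto intro: rep_nonneg)
qed

lemma mult_bound_const: "mult_bound \<alpha> (norm c) (\<lambda>z. c)"
  by (simp add: mult_bound_def rep_cmult)

lemma mult_bound_mult:
  assumes f: "mult_bound \<alpha> C f" and g: "mult_bound \<alpha> D g"
  shows "mult_bound \<alpha> (C * D) (\<lambda>z. f z * g z)"
  unfolding mult_bound_def
proof (intro conjI ballI allI impI)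
  show "(\<lambda>z. f z * g z) holomorphic_on unit_disk"
    by (intro holomorphic_on_mult mult_boundD(1)[OF f] mult_boundD(1)[OF g])
  show "norm (f z * g z) \<le> C * D" if "z \<in> unit_disk" for z
    using mult_boundD(2)[OF f, of z] mult_boundD(2)[OF g, of z] mult_boundD(3)[OF f] that
    by (simp add: norm_mult mult_mono)
  show "rep \<alpha> (\<lambda>z. f z * g z * h z) (C * D * V)" if "rep \<alpha> h V" for h V
    using mult_boundD(4)[OF f mult_boundD(4)[OF g that]] by (simp add: mult.assoc)
qed

lemma mult_bound_add:
  assumes f: "mult_bound \<alpha> C f" and g: "mult_bound \<alpha> D g"
  shows "mult_bound \<alpha> (C + D) (\<lambda>z. f z + g z)"
  unfolding mult_bound_def
proof (intro conjI ballI allI impI)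
  show "(\<lambda>z. f z + g z) holomorphic_on unit_disk"
    by (intro holomorphic_on_add mult_boundD(1)[OF f] mult_boundD(1)[OF g])
  show "norm (f z + g z) \<le> C + D" if "z \<in> unit_disk" for z
    using mult_boundD(2)[OF f, of z] mult_boundD(2)[OF g, of z] that norm_triangle_ineq[of "f z" "g z"] by simp
  show "rep \<alpha> (\<lambda>z. (f z + g z) * h z) ((C + D) * V)" if "rep \<alpha> h V" for h V
    using rep_add[OF mult_boundD(4)[OF f that] mult_boundD(4)[OF g that]] by (simp add: distrib_right)
qed

lemma mult_bound_cmult:
  assumes "mult_bound \<alpha> C f" shows "mult_bound \<alpha> (norm c * C) (\<lambda>z. c * f z)"
  by (rule mult_bound_mult[OF mult_bound_const assms])

lemma mult_bound_prod:
  assumes "finite I" "\<And>i. i \<in> I \<Longrightarrow> mult_bound \<alpha> C (f i)"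
  shows "mult_bound \<alpha> (C ^ card I) (\<lambda>z. \<Prod>i\<in>I. f i z)"
  using assms
proof (induction I rule: finite_induct)
  case empty
  show ?case using mult_bound_const[of \<alpha> 1] by simp
next
  case (insert i I)
  then show ?case using mult_bound_mult[of \<alpha> C "f i" "C ^ card I"] by simp
qed

lemma mult_bound_sum:
  assumes "finite I" "\<And>i. i \<in> I \<Longrightarrow> mult_bound \<alpha> (C i) (f i)"
  shows "mult_bound \<alpha> (\<Sum>i\<in>I. C i) (\<lambda>z. \<Sum>i\<in>I. f i z)"
  using assms
proof (induction I rule: finite_induct)
  case empty
  show ?case using mult_bound_const[of \<alpha> 0] by simp
next
  case (insert i I)
  then show ?case using mult_bound_add[of \<alpha> "C i" "f i"] by simp
qed

lemma mult_bound_suminf: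
  assumes f: "\<And>i. mult_bound \<alpha> (C i) (f i)" and C: "summable C"
  shows "mult_bound \<alpha> (\<Sum>i. C i) (\<lambda>z. \<Sum>i. f i z)" "norm z < 1 \<Longrightarrow> summable (\<lambda>i. f i z)"
proof -
  have sn: "summable (\<lambda>i. norm (f i z))" if "norm z < 1" for z
    by (rule summable_comparison_test'[OF C, of 0]) (simp add: mult_boundD(2)[OF f that])
  show "summable (\<lambda>i. f i z)" if "norm z < 1" by (rule summable_norm_cancel[OF sn[OF that]])
  have s: "(\<lambda>i. f i z) sums (\<Sum>i. f i z)" if "norm z < 1" for z
    by (rule summable_sums[OF summable_norm_cancel[OF sn[OF that]]])
  show "mult_bound \<alpha> (\<Sum>i. C i) (\<lambda>z. \<Sum>i. f i z)"
    unfolding mult_bound_def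
  proof (intro conjI ballI allI impI)
    have ul: "uniform_limit unit_disk (\<lambda>n z. \<Sum>i<n. f i z) (\<lambda>z. \<Sum>i. f i z) sequentially"
      by (rule Weierstrass_m_test[OF _ C]) (simp add: mult_boundD(2)[OF f])
    have hn: "(\<lambda>z. \<Sum>i<n. f i z) holomorphic_on unit_disk" for n
      by (intro holomorphic_on_sum mult_boundD(1)[OF f])
    show "(\<lambda>z. \<Sum>i. f i z) holomorphic_on unit_disk"
    proof (rule holomorphic_uniform_sequence[OF open_ball hn])
      fix x :: complex assume "x \<in> unit_disk"
      then obtain d where "0 < d" "cball x d \<subseteq> unit_disk"
        by (meson open_ball open_contains_cball)
      then show "\<exists>d>0. cball x d \<subseteq> unit_disk \<and> uniform_limit (cball x d) (\<lambda>n z. \<Sum>i<n. f i z) (\<lambda>z. \<Sum>i. f i z) sequentially"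
        using uniform_limit_on_subset[OF ul] by blast
    qed
    show "norm (\<Sum>i. f i z) \<le> (\<Sum>i. C i)" if "z \<in> unit_disk" for z
    proof -
      have z: "norm z < 1" using that by simp
      have "norm (\<Sum>i. f i z) \<le> (\<Sum>i. norm (f i z))" by (rule summable_norm[OF sn[OF z]])
      also have "\<dots> \<le> (\<Sum>i. C i)" by (intro suminf_le sn[OF z] C mult_boundD(2)[OF f z])
      finally show ?thesis .
    qed
    show "rep \<alpha> (\<lambda>z. (\<Sum>i. f i z) * g z) ((\<Sum>i. C i) * V)" if g: "rep \<alpha> g V" for g V
    proof -
      have "rep \<alpha> (\<lambda>z. (\<Sum>i. f i z) * g z) (\<Sum>i. C i * V)"
        by (rule rep_sums[OF mult_boundD(4)[OF f g] summable_mult2[OF C] sums_mult2[OF s]])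
      then show ?thesis using suminf_mult2[OF C, of V] by simp
    qed
  qed
qed

section \<open>Newman--Carleson sequences in a Stoltz angle\<close>

lemma pseudo_hyperbolic_identity:
  fixes u v :: complex
  shows "(norm (1 - cnj u * v))\<^sup>2 - (norm (u - v))\<^sup>2 = (1 - (norm u)\<^sup>2) * (1 - (norm v)\<^sup>2)"
  unfolding cmod_power2 by (simp add: algebra_simps power2_eq_square)

definition blaschke :: "complex \<Rightarrow> complex \<Rightarrow> complex" where
  "blaschke u z = (u - z) / (1 - cnj u * z)"

lemma one_minus_blaschke_square:
  assumes "norm u < 1" "norm z < 1"
  shows "1 - (norm (blaschke u z))\<^sup>2 = (1 - (norm u)\<^sup>2) * (1 - (norm z)\<^sup>2) / (norm (1 - cnj u * z))\<^sup>2"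
proof -
  have "norm (1 - cnj u * z) \<noteq> 0" using one_minus_cnj_mult_nonzero[of u z] assms by simp
  then show ?thesis
    unfolding pseudo_hyperbolic_identity[symmetric] blaschke_def norm_divide power_divide by (simp add: field_simps)
qed

lemma norm_blaschke_le_1:
  assumes "norm u < 1" "norm z < 1" shows "norm (blaschke u z) \<le> 1"
proof -
  have "0 \<le> 1 - (norm (blaschke u z))\<^sup>2"
    unfolding one_minus_blaschke_square[OF assms] using assms by (simp add: power_le_one)
  then show ?thesis by (simp add: abs_square_le_1)
qed

lemma newman_carleson_partial:
  assumes a: "\<And>k. norm (a k) < 1" and nc: "newman_carleson a"
  shows "newman_carleson_delta a \<le> (\<Prod>k\<in>{..<N} - {n}. norm (blaschke (a k) (a n)))"
proof -
  define P where "P n N = (\<Prod>k\<in>{..<N} - {n}. norm (blaschke (a k) (a n)))" for n N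
  have P0: "0 \<le> P n N" for n N unfolding P_def by (intro prod_nonneg) simp
  have dec: "decseq (P n)" for n
  proof (rule decseq_SucI)
    fix N
    show "P n (Suc N) \<le> P n N"
    proof (cases "N = n")
      case True
      then have "{..<Suc N} - {n} = {..<N} - {n}" by auto
      then show ?thesis by (simp add: P_def)
    next
      case False
      then have "{..<Suc N} - {n} = insert N ({..<N} - {n})" by auto
      then have "P n (Suc N) = norm (blaschke (a N) (a n)) * P n N" by (simp add: P_def)
      also have "\<dots> \<le> 1 * P n N" by (intro mult_right_mono norm_blaschke_le_1 a P0)
      finally show ?thesis by simp
    qed
  qed
  have lim: "P n \<longlonglongrightarrow> lim (P n)" for n
  proof -
    have "\<forall>i. 0 \<le> P n i" by (intro allI P0)
    then obtain L where "P n \<longlonglongrightarrow> L" by (rule decseq_convergent[OF dec])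
    then show ?thesis by (simp add: limI)
  qed
  have le: "lim (P n) \<le> P n N" for n N by (rule decseq_ge[OF dec lim])
  have "0 \<le> lim (P n)" for n by (rule LIMSEQ_le_const[OF lim]) (use P0 in blast)
  then have "(INF n. lim (P n)) \<le> lim (P n)" by (intro cINF_lower bdd_belowI2[of _ 0]) auto
  then have "(INF n. lim (P n)) \<le> P n N" using le[of n N] by (rule order_trans)
  also have "(INF n. lim (P n)) = newman_carleson_delta a"
    by (simp add: newman_carleson_delta_def P_def[abs_def] blaschke_def)
  finally show ?thesis by (simp only: P_def)
qed

lemma sum_one_minus_le_ln_prod:
  fixes c :: "'a \<Rightarrow> real"
  assumes "finite I" "\<And>i. i \<in> I \<Longrightarrow> 0 \<le> c i" "0 < \<delta>" "\<delta> \<le> (\<Prod>i\<in>I. c i)"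
  shows "(\<Sum>i\<in>I. 1 - c i) \<le> - ln \<delta>"
proof -
  have "(\<Prod>i\<in>I. c i) \<le> (\<Prod>i\<in>I. exp (- (1 - c i)))"
    using assms(2) exp_ge_add_one_self by (intro prod_mono) (smt (verit))
  also have "\<dots> = exp (- (\<Sum>i\<in>I. 1 - c i))" using assms(1) by (simp add: exp_sum sum_negf[symmetric])
  finally have "\<delta> \<le> exp (- (\<Sum>i\<in>I. 1 - c i))" using assms(4) by simp
  then have "ln \<delta> \<le> - (\<Sum>i\<in>I. 1 - c i)" using assms(3) by (metis exp_gt_zero ln_exp ln_le_cancel_iff)
  then show ?thesis by simp
qed

lemma geometric_decay:
  fixes r :: "nat \<Rightarrow> real"
  assumes r: "\<And>k. 0 \<le> r k" and L: "1 < L" and tail: "\<And>n N. (\<Sum>j\<in>{n..<N}. r j) \<le> L * r n"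
  shows "r (k + m) \<le> L * (1 - 1 / L) ^ m * r k"
proof -
  have sr: "summable r"
  proof (rule bounded_imp_summable[OF r])
    fix n
    show "(\<Sum>j\<le>n. r j) \<le> L * r 0"
      using tail[of 0 "Suc n"] by (simp only: atLeast0LessThan lessThan_Suc_atMost)
  qed
  define T where "T k = (\<Sum>j. r (j + k))" for k
  have sk: "summable (\<lambda>j. r (j + k))" for k using sr by (simp add: summable_iff_shift)
  have T_le: "T k \<le> L * r k" for k
    unfolding T_def
  proof (rule suminf_le_const[OF sk])
    fix n
    have "(\<Sum>j<n. r (j + k)) = (\<Sum>j\<in>{k..<k + n}. r j)"
      by (rule sum.reindex_bij_witness[of _ "\<lambda>j. j - k" "\<lambda>j. j + k"]) auto
    then show "(\<Sum>j<n. r (j + k)) \<le> L * r k" using tail[of k "k + n"] by simp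
  qed
  have T0: "0 \<le> T k" for k unfolding T_def by (intro suminf_nonneg sk r)
  have r_le: "r k \<le> T k" for k
    unfolding T_def using sum_le_suminf[OF sk, of "{0}" k] r by simp
  have T_Suc: "T (Suc k) \<le> (1 - 1 / L) * T k" for k
  proof -
    have "T k = r k + T (Suc k)" unfolding T_def using suminf_split_head[OF sk[of k]] by simp
    moreover have "T k / L \<le> r k" using T_le[of k] L by (simp add: divide_le_eq mult.commute)
    moreover have "(1 - 1 / L) * T k = T k - T k / L" by (simp add: left_diff_distrib)
    ultimately show ?thesis by linarith
  qed
  have "T (k + m) \<le> (1 - 1 / L) ^ m * T k" for k m
  proof (induction m)
    case (Suc m)
    have "T (k + Suc m) \<le> (1 - 1 / L) * T (k + m)" using T_Suc[of "k + m"] by simp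
    also have "\<dots> \<le> (1 - 1 / L) * ((1 - 1 / L) ^ m * T k)"
      using L by (intro mult_left_mono Suc) simp
    finally show ?case by simp
  qed simp
  then have "r (k + m) \<le> (1 - 1 / L) ^ m * T k" using r_le order_trans by blast
  also have "\<dots> \<le> (1 - 1 / L) ^ m * (L * r k)" using L by (intro mult_left_mono T_le) simp
  finally show ?thesis by (simp add: mult_ac)
qed

locale lacunary =
  fixes a :: "nat \<Rightarrow> complex" and S A \<rho> \<delta> :: real
  assumes in_disk: "norm (a k) < 1"
    and mono: "k \<le> j \<Longrightarrow> norm (a k) \<le> norm (a j)"
    and S: "1 \<le> S" "norm (1 - a k) \<le> S * (1 - norm (a k))"
    and A: "1 \<le> A" and \<rho>: "0 < \<rho>" "\<rho> < 1"
    and decay: "k \<le> j \<Longrightarrow> 1 - norm (a j) \<le> A * \<rho> ^ (j - k) * (1 - norm (a k))"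
    and \<delta>: "0 < \<delta>" "finite I \<Longrightarrow> n \<notin> I \<Longrightarrow> \<delta> \<le> (\<Prod>k\<in>I. norm (blaschke (a k) (a n)))"

lemma newman_carleson_stoltz_lacunary:
  assumes in_disk: "\<And>k. norm (a k) < 1" and mono: "\<And>k. norm (a k) \<le> norm (a (Suc k))"
    and nc: "newman_carleson a" and st: "stoltz a"
  obtains S A \<rho> \<delta> where "lacunary a S A \<rho> \<delta>"
proof -
  define r where "r k = 1 - norm (a k)" for k
  have r: "0 < r k" for k using in_disk by (simp add: r_def)
  define \<delta> where "\<delta> = newman_carleson_delta a"
  have \<delta>: "0 < \<delta>" using nc by (simp add: newman_carleson_def \<delta>_def)
  have part: "\<delta> \<le> (\<Prod>k\<in>{..<N} - {n}. norm (blaschke (a k) (a n)))" for n N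
    unfolding \<delta>_def by (rule newman_carleson_partial[OF in_disk nc])
  have \<delta>1: "\<delta> \<le> 1" using part[of 0 0] by simp
  obtain S0 where S0: "\<And>k. norm (1 - a k) / (1 - norm (a k)) \<le> S0"
    using st unfolding stoltz_def bdd_above_def by auto
  define S where "S = max 1 S0"
  have S: "1 \<le> S" "norm (1 - a k) \<le> S * r k" for k
  proof -
    show "1 \<le> S" by (simp add: S_def)
    have "norm (1 - a k) \<le> S0 * r k" using S0[of k] r[of k] by (simp add: r_def divide_le_eq)
    also have "\<dots> \<le> S * r k" using r[of k] by (intro mult_right_mono) (auto simp: S_def)
    finally show "norm (1 - a k) \<le> S * r k" .
  qed
  have mono': "norm (a k) \<le> norm (a j)" if "k \<le> j" for k j
    using lift_Suc_mono_le[of "\<lambda>k. norm (a k)", OF mono that] .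
  have fin: "\<delta> \<le> (\<Prod>k\<in>I. norm (blaschke (a k) (a n)))" if fin: "finite I" and n: "n \<notin> I" for I n
  proof -
    obtain N where "I \<subseteq> {..<N}" using fin unfolding finite_nat_iff_bounded by blast
    then have sub: "I \<subseteq> {..<N} - {n}" using n by auto
    have "(\<Prod>k\<in>{..<N} - {n}. norm (blaschke (a k) (a n))) \<le> (\<Prod>k\<in>I. norm (blaschke (a k) (a n)))"
    proof -
      have "(\<Prod>k\<in>{..<N} - {n}. norm (blaschke (a k) (a n))) =
        (\<Prod>k\<in>{..<N} - {n} - I. norm (blaschke (a k) (a n))) * (\<Prod>k\<in>I. norm (blaschke (a k) (a n)))"
        by (rule prod.subset_diff[OF sub]) simp
      also have "\<dots> \<le> 1 * (\<Prod>k\<in>I. norm (blaschke (a k) (a n)))"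
        by (intro mult_right_mono prod_le_1 prod_nonneg conjI norm_blaschke_le_1 in_disk) auto
      finally show ?thesis by simp
    qed
    then show ?thesis using part[of n N] by simp
  qed
  define L where "L = 2 + 4 * S\<^sup>2 * (- ln (\<delta>\<^sup>2))"
  have lnd: "0 \<le> - ln (\<delta>\<^sup>2)" using \<delta> \<delta>1 by (simp add: power_le_one ln_le_zero_iff)
  have L: "1 < L" proof -
    have "0 \<le> 4 * S\<^sup>2 * (- ln (\<delta>\<^sup>2))" using lnd by (intro mult_nonneg_nonneg) auto
    then show ?thesis unfolding L_def by linarith
  qed
  have tail: "(\<Sum>j\<in>{n..<N}. r j) \<le> L * r n" for n N
  proof (cases "n < N")
    case False
    then show ?thesis using L r[of n] by (simp add: less_imp_le)
  next
    case True
    let ?I = "{Suc n..<N}"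
    have "\<delta>\<^sup>2 \<le> (\<Prod>k\<in>?I. norm (blaschke (a k) (a n)))\<^sup>2"
      using \<delta> by (intro power_mono fin) auto
    then have "(\<Sum>k\<in>?I. 1 - (norm (blaschke (a k) (a n)))\<^sup>2) \<le> - ln (\<delta>\<^sup>2)"
      using \<delta> by (intro sum_one_minus_le_ln_prod) (simp_all add: prod_power_distrib)
    moreover have "r k / (4 * S\<^sup>2 * r n) \<le> 1 - (norm (blaschke (a k) (a n)))\<^sup>2" if k: "k \<in> ?I" for k
    proof -
      have rk: "r k \<le> r n" using mono'[of n k] k by (simp add: r_def)
      have "1 - cnj (a k) * a n = cnj (1 - a k) + cnj (a k) * (1 - a n)" by (simp add: algebra_simps)
      then have "norm (1 - cnj (a k) * a n) \<le> norm (cnj (1 - a k)) + norm (cnj (a k) * (1 - a n))"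
        by (metis norm_triangle_ineq)
      also have "\<dots> \<le> norm (1 - a k) + 1 * norm (1 - a n)"
        unfolding norm_mult complex_mod_cnj using in_disk[of k] by (intro add_mono mult_right_mono) auto
      also have "\<dots> \<le> S * r n + S * r n" 
      proof -
        have "S * r k \<le> S * r n" using S(1) by (intro mult_left_mono rk) simp
        then show ?thesis using S(2)[of k] S(2)[of n] by linarith
      qed
      finally have n2: "(norm (1 - cnj (a k) * a n))\<^sup>2 \<le> (2 * S * r n)\<^sup>2" by (intro power_mono) auto
      have pos: "0 < (norm (1 - cnj (a k) * a n))\<^sup>2"
        using one_minus_cnj_mult_nonzero[of "a k" "a n"] in_disk[of k] in_disk[of n] by simp
      have sq: "r k \<le> 1 - (norm (a k))\<^sup>2" for k
        using in_disk[of k] by (simp add: r_def power2_eq_square mult_left_le)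
      have "r k / (4 * S\<^sup>2 * r n) = (r k * r n) / (2 * S * r n)\<^sup>2"
        using r[of n] by (simp add: power2_eq_square)
      also have "\<dots> \<le> (r k * r n) / (norm (1 - cnj (a k) * a n))\<^sup>2"
        using r[of n] r[of k] S(1) by (intro divide_left_mono n2 mult_pos_pos pos) auto
      also have "\<dots> \<le> (1 - (norm (a k))\<^sup>2) * (1 - (norm (a n))\<^sup>2) / (norm (1 - cnj (a k) * a n))\<^sup>2"
        using r[of n] r[of k] sq[of k] sq[of n] by (intro divide_right_mono mult_mono) auto
      finally show ?thesis using one_minus_blaschke_square[OF in_disk in_disk] by simp
    qed
    ultimately have "(\<Sum>k\<in>?I. r k / (4 * S\<^sup>2 * r n)) \<le> - ln (\<delta>\<^sup>2)"
      using sum_mono[of ?I "\<lambda>k. r k / (4 * S\<^sup>2 * r n)" "\<lambda>k. 1 - (norm (blaschke (a k) (a n)))\<^sup>2"] by force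
    then have "(\<Sum>k\<in>?I. r k) \<le> (- ln (\<delta>\<^sup>2)) * (4 * S\<^sup>2 * r n)"
      using r[of n] S(1) by (simp add: sum_divide_distrib[symmetric] divide_le_eq)
    moreover have "(\<Sum>j\<in>{n..<N}. r j) = r n + (\<Sum>k\<in>?I. r k)" using True by (simp add: sum.atLeast_Suc_lessThan)
    ultimately have "(\<Sum>j\<in>{n..<N}. r j) \<le> r n + (- ln (\<delta>\<^sup>2)) * (4 * S\<^sup>2 * r n)" by simp
    also have "\<dots> \<le> L * r n" using r[of n] by (simp add: L_def algebra_simps)
    finally show ?thesis .
  qed
  have "lacunary a S L (1 - 1 / L) \<delta>"
  proof
    fix k j :: nat assume "k \<le> j"
    show "1 - norm (a j) \<le> L * (1 - 1 / L) ^ (j - k) * (1 - norm (a k))"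
      using geometric_decay[of r L k "j - k", OF less_imp_le[OF r] L tail] \<open>k \<le> j\<close> by (simp add: r_def)
  qed (use L in_disk mono' S \<delta> fin in \<open>auto simp: r_def\<close>)
  then show ?thesis by (rule that)
qed

context lacunary
begin

definition r :: "nat \<Rightarrow> real" where "r k = 1 - norm (a k)"

lemma r_pos: "0 < r k" and r_le_1: "r k \<le> 1" and r_mono: "k \<le> j \<Longrightarrow> r j \<le> r k"
  using in_disk[of k] mono[of k j] by (simp_all add: r_def)

lemma r_decay: "k \<le> j \<Longrightarrow> r j \<le> A * \<rho> ^ (j - k) * r k"
  using decay by (simp add: r_def)

lemma stoltz_r: "norm (1 - a k) \<le> S * r k"
  using S(2) by (simp add: r_def)

definition ratio_sum_bound :: "real \<Rightarrow> real" where
  "ratio_sum_bound s = A / (1 - \<rho>) + A powr s / (1 - \<rho> powr s)"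

lemma ratio_sum:
  assumes s: "0 < s" and t: "0 \<le> t"
  shows "(\<Sum>k<N. if t \<le> r k then t / r k else (r k / t) powr s) \<le> ratio_sum_bound s"
proof -
  have geo: "(\<Sum>i<n. q ^ i) \<le> 1 / (1 - q)" if "0 < q" "q < 1" for q :: real and n
    using sum_le_suminf[of "\<lambda>i. q ^ i" "{..<n}"] that by (simp add: suminf_geometric summable_geometric)
  define E where "E k = (if t \<le> r k then t / r k else (r k / t) powr s)" for k
  let ?L = "{k\<in>{..<N}. t \<le> r k}" and ?H = "{k\<in>{..<N}. \<not> t \<le> r k}"
  have "(\<Sum>k\<in>?L. E k) \<le> A / (1 - \<rho>)"
  proof (cases "?L = {}")
    case True
    then show ?thesis using A \<rho> by (simp only: sum.empty) simp
  next
    case False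
    define K where "K = Max ?L"
    have K: "K \<in> ?L" "\<And>k. k \<in> ?L \<Longrightarrow> k \<le> K" unfolding K_def using False Max_in[of ?L] by auto
    have "(\<Sum>k\<in>?L. E k) \<le> (\<Sum>k\<in>?L. A * \<rho> ^ (K - k))"
    proof (rule sum_mono)
      fix k assume k: "k \<in> ?L"
      have "E k \<le> r K / r k" using k K(1) r_pos[of k] by (simp add: E_def divide_right_mono)
      also have "\<dots> \<le> A * \<rho> ^ (K - k)" using r_decay[OF K(2)[OF k]] r_pos[of k] by (simp add: divide_le_eq)
      finally show "E k \<le> A * \<rho> ^ (K - k)" .
    qed
    also have "\<dots> \<le> (\<Sum>k\<in>{..<Suc K}. A * \<rho> ^ (K - k))"
      using K(2) A \<rho> by (intro sum_mono2) (auto simp: less_Suc_eq_le)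
    also have "\<dots> = A * (\<Sum>k<Suc K. \<rho> ^ k)"
      unfolding sum_distrib_left by (rule sum.reindex_bij_witness[of _ "\<lambda>i. K - i" "\<lambda>i. K - i"]) auto
    also have "\<dots> \<le> A * (1 / (1 - \<rho>))" using A \<rho> by (intro mult_left_mono geo) auto
    finally show ?thesis by simp
  qed
  moreover have "(\<Sum>k\<in>?H. E k) \<le> A powr s / (1 - \<rho> powr s)"
  proof -
    have q: "0 < \<rho> powr s" "\<rho> powr s < 1" using \<rho> s by (simp_all add: powr01_less_one)
    show ?thesis
    proof (cases "?H = {}")
      case True
      then show ?thesis using q by (simp only: sum.empty) simp
    next
      case False
      define K where "K = Min ?H"
      have K: "K \<in> ?H" "\<And>k. k \<in> ?H \<Longrightarrow> K \<le> k" unfolding K_def using False Min_in[of ?H] by auto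
      have "(\<Sum>k\<in>?H. E k) \<le> (\<Sum>k\<in>?H. A powr s * (\<rho> powr s) ^ (k - K))"
      proof (rule sum_mono)
        fix k assume k: "k \<in> ?H"
        have "r k / t \<le> r k / r K" using k K(1) r_pos[of k] r_pos[of K] by (intro divide_left_mono) auto
        also have "\<dots> \<le> A * \<rho> ^ (k - K)" using r_decay[OF K(2)[OF k]] r_pos[of K] by (simp add: divide_le_eq)
        finally have "(r k / t) powr s \<le> (A * \<rho> ^ (k - K)) powr s"
          using s t r_pos[of k] by (intro powr_mono2) auto
        also have "\<dots> = A powr s * (\<rho> powr s) ^ (k - K)"
          using A \<rho> by (simp add: powr_mult powr_powr mult.commute flip: powr_realpow)
        finally show "E k \<le> A powr s * (\<rho> powr s) ^ (k - K)" using k by (simp add: E_def)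
      qed
      also have "\<dots> \<le> (\<Sum>k\<in>{K..<K + N}. A powr s * (\<rho> powr s) ^ (k - K))"
        using K(2) by (intro sum_mono2) auto
      also have "\<dots> = A powr s * (\<Sum>k<N. (\<rho> powr s) ^ k)"
        unfolding sum_distrib_left by (rule sum.reindex_bij_witness[of _ "\<lambda>i. i + K" "\<lambda>i. i - K"]) auto
      also have "\<dots> \<le> A powr s * (1 / (1 - \<rho> powr s))" by (intro mult_left_mono geo q) auto
      finally show ?thesis by simp
    qed
  qed
  moreover have "(\<Sum>k<N. E k) = (\<Sum>k\<in>?L. E k) + (\<Sum>k\<in>?H. E k)"
    by (subst sum.union_disjoint[symmetric]) (auto intro!: sum.cong)
  ultimately show ?thesis unfolding E_def ratio_sum_bound_def by simp
qed

lemma kernel_ratio_estimate: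
  assumes \<alpha>: "0 < \<alpha>" and \<zeta>: "norm \<zeta> = 1"
  defines "\<phi> \<equiv> \<lambda>k. (1 - a k) powr of_real \<alpha> * kernel \<alpha> \<zeta> (a k)"
  defines "C \<equiv> \<alpha> * (1 + (S + 1) powr (\<alpha> - 1)) + (S * (S + 1)) powr \<alpha>"
  shows "norm (1 - \<zeta>) \<le> r k \<Longrightarrow> norm (\<phi> k - 1) \<le> C * (norm (1 - \<zeta>) / r k)"
    and "\<not> norm (1 - \<zeta>) \<le> r k \<Longrightarrow> norm (\<phi> k) \<le> C * (r k / norm (1 - \<zeta>)) powr \<alpha>"
proof -
  let ?t = "norm (1 - \<zeta>)"
  define u where "u = 1 - a k"
  define v where "v = 1 - cnj \<zeta> * a k"
  have \<phi>: "\<phi> k = u powr of_real \<alpha> / v powr of_real \<alpha>" by (simp add: \<phi>_def u_def v_def kernel_def)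
  have Reu: "r k \<le> Re u" using complex_Re_le_cmod[of "a k"] by (simp add: u_def r_def)
  have Rev: "r k \<le> Re v" using complex_Re_le_cmod[of "cnj \<zeta> * a k"] \<zeta> by (simp add: v_def r_def norm_mult)
  have nz: "u \<noteq> 0" "v \<noteq> 0" using Reu Rev r_pos[of k] by auto
  have nu: "norm u \<le> S * r k" using stoltz_r by (simp add: u_def)
  have nv: "r k \<le> norm v" using Rev complex_Re_le_cmod[of v] by simp
  have nv': "norm (v powr of_real \<alpha>) = norm v powr \<alpha>" by (rule norm_powr_of_real[OF nz(2)])
  have nu': "norm (u powr of_real \<alpha>) = norm u powr \<alpha>" by (rule norm_powr_of_real[OF nz(1)])
  have C1: "\<alpha> * (1 + (S + 1) powr (\<alpha> - 1)) \<le> C" "(S * (S + 1)) powr \<alpha> \<le> C" using \<alpha> by (simp_all add: C_def)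
  {
    assume t: "?t \<le> r k"
    have "u - v = cnj (\<zeta> - 1) * a k" by (simp add: u_def v_def algebra_simps)
    then have uv: "norm (u - v) \<le> ?t"
      using in_disk[of k] mult_left_mono[of "norm (a k)" 1 "norm (\<zeta> - 1)"]
      by (simp add: norm_mult norm_minus_commute del: complex_cnj_diff)
    have nvR: "norm v \<le> (S + 1) * r k"
      using norm_triangle_ineq[of u "v - u"] uv t nu by (simp add: norm_minus_commute algebra_simps)
    have nuR: "norm u \<le> (S + 1) * r k" using nu r_pos[of k] by (simp add: algebra_simps)
    have "norm (u powr of_real \<alpha> - v powr of_real \<alpha>) \<le>
        \<bar>\<alpha>\<bar> * (r k powr (\<alpha> - 1) + ((S + 1) * r k) powr (\<alpha> - 1)) * norm (u - v)"
      by (rule complex_powr_diff_bound[OF r_pos Reu nuR Rev nvR])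
    also have "\<dots> \<le> \<bar>\<alpha>\<bar> * (r k powr (\<alpha> - 1) + ((S + 1) * r k) powr (\<alpha> - 1)) * ?t"
      by (intro mult_left_mono uv) auto
    also have "\<dots> = \<alpha> * (1 + (S + 1) powr (\<alpha> - 1)) * (r k powr (\<alpha> - 1)) * ?t"
    proof -
      have "((S + 1) * r k) powr (\<alpha> - 1) = (S + 1) powr (\<alpha> - 1) * r k powr (\<alpha> - 1)"
        by (rule powr_mult)
      then show ?thesis using \<alpha> by (simp add: algebra_simps)
    qed
    finally have d: "norm (u powr of_real \<alpha> - v powr of_real \<alpha>) \<le> \<alpha> * (1 + (S + 1) powr (\<alpha> - 1)) * (r k powr (\<alpha> - 1)) * ?t" .
    have "\<phi> k - 1 = (u powr of_real \<alpha> - v powr of_real \<alpha>) / v powr of_real \<alpha>"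
      using nz unfolding \<phi> by (simp add: diff_divide_distrib)
    then have "norm (\<phi> k - 1) = norm (u powr of_real \<alpha> - v powr of_real \<alpha>) / norm v powr \<alpha>"
      using nv' by (simp add: norm_divide)
    also have "\<dots> \<le> (\<alpha> * (1 + (S + 1) powr (\<alpha> - 1)) * (r k powr (\<alpha> - 1)) * ?t) / r k powr \<alpha>"
      using nv r_pos[of k] \<alpha> by (intro frac_le d powr_mono2) auto
    also have "\<dots> = \<alpha> * (1 + (S + 1) powr (\<alpha> - 1)) * (?t / r k)"
      using r_pos[of k] by (simp add: powr_diff)
    also have "\<dots> \<le> C * (?t / r k)" using r_pos[of k] by (intro mult_right_mono C1) auto
    finally show "norm (\<phi> k - 1) \<le> C * (?t / r k)" .
  next
    assume t: "\<not> ?t \<le> r k"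
    have "cnj \<zeta> * (\<zeta> - a k) = v"
      using \<zeta> by (simp add: v_def algebra_simps complex_norm_square[symmetric, of \<zeta>] mult.commute[of _ \<zeta>] flip: mult.assoc)
    then have "norm v = norm (\<zeta> - a k)" using \<zeta> by (metis complex_mod_cnj mult_1 norm_mult)
    then have "?t \<le> norm u + norm v"
      using norm_triangle_ineq4[of u "\<zeta> - a k"] by (simp add: u_def)
    also have "\<dots> \<le> (S + 1) * norm v"
    proof -
      have "S * r k \<le> S * norm v" using S(1) by (intro mult_left_mono nv) simp
      then show ?thesis using nu by (simp add: algebra_simps)
    qed
    finally have tv: "?t / (S + 1) \<le> norm v" using S(1) by (simp add: divide_le_eq mult.commute)
    have t0: "0 < ?t" using t r_pos[of k] by linarith
    have "norm (\<phi> k) = norm u powr \<alpha> / norm v powr \<alpha>" unfolding \<phi> norm_divide nu' nv' ..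
    also have "\<dots> \<le> (S * r k) powr \<alpha> / (?t / (S + 1)) powr \<alpha>"
      using nu tv \<alpha> t0 S(1) r_pos[of k] by (intro frac_le powr_mono2) auto
    also have "\<dots> = (S * (S + 1)) powr \<alpha> * (r k / ?t) powr \<alpha>"
      using S(1) t0 r_pos[of k] by (simp add: powr_mult powr_divide)
    also have "\<dots> \<le> C * (r k / ?t) powr \<alpha>" by (intro mult_right_mono C1) auto
    finally show "norm (\<phi> k) \<le> C * (r k / ?t) powr \<alpha>" .
  }
qed

lemma kernel_ratio_variation:
  assumes \<alpha>: "0 < \<alpha>"
  obtains B where "\<And>\<zeta> N. norm \<zeta> = 1 \<Longrightarrow>
    (\<Sum>k<N. norm ((1 - a (Suc k)) powr of_real \<alpha> * kernel \<alpha> \<zeta> (a (Suc k)) -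
                 (1 - a k) powr of_real \<alpha> * kernel \<alpha> \<zeta> (a k))) \<le> B"
proof -
  define C where "C = \<alpha> * (1 + (S + 1) powr (\<alpha> - 1)) + (S * (S + 1)) powr \<alpha>"
  have C0: "0 \<le> C" using \<alpha> by (simp add: C_def)
  have "(\<Sum>k<N. norm ((1 - a (Suc k)) powr of_real \<alpha> * kernel \<alpha> \<zeta> (a (Suc k)) -
                 (1 - a k) powr of_real \<alpha> * kernel \<alpha> \<zeta> (a k))) \<le> 1 + 2 * C * ratio_sum_bound \<alpha>"
    if \<zeta>: "norm \<zeta> = 1" for \<zeta> N
  proof -
    define \<phi> where "\<phi> k = (1 - a k) powr of_real \<alpha> * kernel \<alpha> \<zeta> (a k)" for k
    let ?t = "norm (1 - \<zeta>)"
    define E where "E k = (if ?t \<le> r k then ?t / r k else (r k / ?t) powr \<alpha>)" for k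
    define h where "h k = (if ?t \<le> r k then 1 else 0 :: real)" for k
    have E0: "0 \<le> E k" for k using r_pos[of k] by (simp add: E_def)
    have d: "norm (\<phi> k - of_real (h k)) \<le> C * E k" for k
      using kernel_ratio_estimate[OF \<alpha> \<zeta>, of k] by (simp add: \<phi>_def E_def h_def C_def)
    have hd: "h (Suc k) \<le> h k" for k using r_mono[of k "Suc k"] by (simp add: h_def)
    have "norm (\<phi> (Suc k) - \<phi> k) \<le> C * E (Suc k) + C * E k + (h k - h (Suc k))" for k
    proof -
      have "\<phi> (Suc k) - \<phi> k = (\<phi> (Suc k) - of_real (h (Suc k))) - (\<phi> k - of_real (h k)) - of_real (h k - h (Suc k))" by simp
      also have "norm \<dots> \<le> norm (\<phi> (Suc k) - of_real (h (Suc k))) + norm (\<phi> k - of_real (h k)) + norm (of_real (h k - h (Suc k)) :: complex)"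
        by (intro order_trans[OF norm_triangle_ineq4] add_mono norm_triangle_ineq4 order_refl)
      also have "\<dots> \<le> C * E (Suc k) + C * E k + (h k - h (Suc k))"
        unfolding norm_of_real using d[of k] d[of "Suc k"] hd[of k] by simp
      finally show ?thesis .
    qed
    then have "(\<Sum>k<N. norm (\<phi> (Suc k) - \<phi> k)) \<le> (\<Sum>k<N. C * E (Suc k) + C * E k + (h k - h (Suc k)))"
      by (intro sum_mono)
    also have "\<dots> = C * (\<Sum>k<N. E (Suc k)) + C * (\<Sum>k<N. E k) + (h 0 - h N)"
      by (simp add: sum.distrib sum_distrib_left sum_lessThan_telescope')
    also have "\<dots> \<le> C * ratio_sum_bound \<alpha> + C * ratio_sum_bound \<alpha> + 1"
    proof (intro add_mono mult_left_mono C0)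
      show s: "(\<Sum>k<N. E k) \<le> ratio_sum_bound \<alpha>" for N unfolding E_def by (rule ratio_sum[OF \<alpha>]) simp
      have "(\<Sum>k<N. E (Suc k)) \<le> (\<Sum>k<Suc N. E k)" using E0[of 0] by (simp add: sum.lessThan_Suc_shift del: sum.lessThan_Suc)
      then show "(\<Sum>k<N. E (Suc k)) \<le> ratio_sum_bound \<alpha>" using s[of "Suc N"] by simp
      show "h 0 - h N \<le> 1" by (simp add: h_def)
    qed
    finally show ?thesis by (simp add: \<phi>_def)
  qed
  then show ?thesis by (rule that)
qed

end

lemma rep_kernel_1: "rep \<alpha> (kernel \<alpha> 1) 1"
proof (rule rep_superposition[where M = "return borel (0::real)" and h = "\<lambda>_. 1" and \<eta> = "\<lambda>x. x"])
  interpret prob_space "return borel (0::real)" by (rule prob_space_return) simp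
  show "integrable (return borel (0::real)) (\<lambda>_. 1::complex)" by simp
  show "(\<integral>\<^sup>+x. ennreal (norm (1::complex)) \<partial>return borel (0::real)) \<le> ennreal 1"
    by (simp add: nn_integral_return)
  show "kernel \<alpha> 1 z = (LINT x|return borel (0::real). 1 * kernel \<alpha> (cis x) z)" if "norm z < 1" for z
    using kernel_measurable_cis[OF that] by (simp add: integral_return)
qed simp_all

context lacunary
begin

lemma multiplier_values_bounded_variation:
  assumes \<alpha>: "0 < \<alpha>" and f: "f \<in> multipliers \<alpha>"
  shows "(\<lambda>k. f (a k)) \<in> bounded_variation_seqs"
proof -
  have "kernel \<alpha> 1 \<in> F_space \<alpha>" by (rule rep_imp_F_space[OF rep_kernel_1])
  then have "(\<lambda>z. f z * kernel \<alpha> 1 z) \<in> F_space \<alpha>" using f by (simp add: multipliers_def)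
  then obtain V where "rep \<alpha> (\<lambda>z. f z * kernel \<alpha> 1 z) V" by (rule F_space_imp_rep)
  then obtain N where "rep_measure \<alpha> (\<lambda>z. f z * kernel \<alpha> 1 z) V N" by (rule repE)
  note N = rep_measureD[OF this]
  interpret N: finite_measure N by (rule N)
  have setsN [measurable_cong]: "sets N = sets (borel \<Otimes>\<^sub>M borel)" using N(1) by (simp only: borel_prod)
  obtain B where B: "\<And>\<zeta> n. norm \<zeta> = 1 \<Longrightarrow>
    (\<Sum>k<n. norm ((1 - a (Suc k)) powr of_real \<alpha> * kernel \<alpha> \<zeta> (a (Suc k)) -
                 (1 - a k) powr of_real \<alpha> * kernel \<alpha> \<zeta> (a k))) \<le> B"
    using kernel_ratio_variation[OF \<alpha>] by blast
  define \<phi> where "\<phi> k x = (1 - a k) powr of_real \<alpha> * kernel \<alpha> (cis (snd x)) (a k)" for k and x :: "real \<times> real"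
  have m [measurable]: "\<phi> k \<in> borel_measurable N" for k
  proof -
    note [measurable] = measurable_compose[OF _ kernel_measurable_cis[OF in_disk[of k]]]
    show ?thesis unfolding \<phi>_def by measurable
  qed
  have int: "integrable N (\<lambda>x. cis (fst x) * \<phi> k x)" for k
  proof -
    obtain D where D: "\<And>\<zeta>. norm \<zeta> \<le> 1 \<Longrightarrow> norm (kernel \<alpha> \<zeta> (a k)) \<le> D"
      using kernel_bounded[OF in_disk[of k]] by blast
    show ?thesis
    proof (rule N.integrable_const_bound[of _ "norm ((1 - a k) powr of_real \<alpha>) * D"])
      show "AE x in N. norm (cis (fst x) * \<phi> k x) \<le> norm ((1 - a k) powr of_real \<alpha>) * D"
        using D by (intro AE_I2) (simp add: \<phi>_def norm_mult mult_left_mono)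
    qed measurable
  qed
  have fa: "f (a k) = (LINT x|N. cis (fst x) * \<phi> k x)" for k
  proof -
    have "Re (1 - a k) > 0" using complex_Re_le_cmod[of "a k"] in_disk[of k] by simp
    then have "1 - a k \<noteq> 0" by auto
    then have "(1 - a k) powr of_real \<alpha> * kernel \<alpha> 1 (a k) = 1" by (simp add: kernel_def)
    then have "f (a k) = (1 - a k) powr of_real \<alpha> * (f (a k) * kernel \<alpha> 1 (a k))" by (simp add: mult_ac)
    also have "\<dots> = (LINT x|N. (1 - a k) powr of_real \<alpha> * (cis (fst x) * kernel \<alpha> (cis (snd x)) (a k)))"
      unfolding N(5)[OF in_disk] by simp
    also have "\<dots> = (LINT x|N. cis (fst x) * \<phi> k x)"
      by (intro Bochner_Integration.integral_cong refl) (simp add: \<phi>_def mult_ac)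
    finally show ?thesis .
  qed
  have id: "integrable N (\<lambda>x. norm (\<phi> (Suc k) x - \<phi> k x))" for k
  proof -
    have "integrable N (\<lambda>x. norm (cis (fst x) * \<phi> (Suc k) x - cis (fst x) * \<phi> k x))"
      by (intro integrable_norm Bochner_Integration.integrable_diff int)
    moreover have "norm (cis (fst x) * \<phi> (Suc k) x - cis (fst x) * \<phi> k x) = norm (\<phi> (Suc k) x - \<phi> k x)" for x
      by (simp add: norm_mult flip: right_diff_distrib)
    ultimately show ?thesis by simp
  qed
  have "(\<Sum>k<n. norm (f (a (Suc k)) - f (a k))) \<le> B * measure N (space N)" for n
  proof -
    have "(\<Sum>k<n. norm (f (a (Suc k)) - f (a k))) \<le> (\<Sum>k<n. (LINT x|N. norm (\<phi> (Suc k) x - \<phi> k x)))"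
    proof (rule sum_mono)
      fix k
      have "f (a (Suc k)) - f (a k) = (LINT x|N. cis (fst x) * \<phi> (Suc k) x - cis (fst x) * \<phi> k x)"
        unfolding fa using int by simp
      also have "norm \<dots> \<le> (LINT x|N. norm (\<phi> (Suc k) x - \<phi> k x))"
      proof (rule norm_integral_le[OF _ id])
        show "integrable N (\<lambda>x. cis (fst x) * \<phi> (Suc k) x - cis (fst x) * \<phi> k x)" using int by simp
      qed (simp add: norm_mult flip: right_diff_distrib)
      finally show "norm (f (a (Suc k)) - f (a k)) \<le> (LINT x|N. norm (\<phi> (Suc k) x - \<phi> k x))" .
    qed
    also have "\<dots> = (LINT x|N. (\<Sum>k<n. norm (\<phi> (Suc k) x - \<phi> k x)))"
      by (rule Bochner_Integration.integral_sum[OF id, symmetric])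
    also have "\<dots> \<le> (LINT x|N. B)"
    proof (rule integral_mono)
      show "(\<Sum>k<n. norm (\<phi> (Suc k) x - \<phi> k x)) \<le> B" for x unfolding \<phi>_def by (rule B) simp
    qed (use id in auto)
    finally show ?thesis by (simp add: mult.commute)
  qed
  then have "summable (\<lambda>k. norm (f (a (Suc k)) - f (a k)))"
  proof -
    assume *: "\<And>n. (\<Sum>k<n. norm (f (a (Suc k)) - f (a k))) \<le> B * measure N (space N)"
    show ?thesis
    proof (rule bounded_imp_summable)
      show "(\<Sum>k\<le>n. norm (f (a (Suc k)) - f (a k))) \<le> B * measure N (space N)" for n
        using *[of "Suc n"] by (simp only: lessThan_Suc_atMost)
    qed simp
  qed
  then show ?thesis by (simp add: bounded_variation_seqs_def)
qed

end

section \<open>Interpolation\<close>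

lemma mult_bound_cong:
  assumes f: "mult_bound \<alpha> C f" and eq: "\<And>z. norm z < 1 \<Longrightarrow> f z = g z"
  shows "mult_bound \<alpha> C g"
  unfolding mult_bound_def
proof (intro conjI ballI allI impI)
  show "g holomorphic_on unit_disk"
    by (rule holomorphic_transform[OF mult_boundD(1)[OF f]]) (simp add: eq)
  show "norm (g z) \<le> C" if "z \<in> unit_disk" for z using mult_boundD(2)[OF f, of z] eq[of z] that by simp
  show "rep \<alpha> (\<lambda>z. g z * h z) (C * V)" if "rep \<alpha> h V" for h V
    by (rule rep_cong[OF mult_boundD(4)[OF f that]]) (simp add: eq)
qed

lemma mult_bound_imp_multiplier:
  assumes f: "mult_bound \<alpha> C f" shows "f \<in> multipliers \<alpha>"
  unfolding multipliers_def
proof (intro CollectI conjI ballI)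
  show "f holomorphic_on unit_disk" by (rule mult_boundD(1)[OF f])
  fix g assume "g \<in> F_space \<alpha>"
  then obtain V where "rep \<alpha> g V" by (rule F_space_imp_rep)
  then show "(\<lambda>z. f z * g z) \<in> F_space \<alpha>" by (rule rep_imp_F_space[OF mult_boundD(4)[OF f]])
qed

definition pole_bound :: "real \<Rightarrow> real" where "pole_bound \<alpha> = 2 + 4 * \<bar>\<alpha> - 1\<bar> / \<alpha>"

lemma pole_bound_ge: "0 < \<alpha> \<Longrightarrow> 2 \<le> pole_bound \<alpha>" by (simp add: pole_bound_def)

lemma norm_one_minus_ge: "norm u \<le> 1 \<Longrightarrow> 1 - norm z \<le> norm (1 - u * z)" for u z :: complex
  using norm_triangle_ineq2[of 1 "u * z"] mult_right_mono[of "norm u" 1 "norm z"] by (simp add: norm_mult)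

lemma mult_bound_outer_pole:
  assumes \<alpha>: "0 < \<alpha>" and v: "norm v < 1" shows "mult_bound \<alpha> (pole_bound \<alpha>) (outer_pole v)"
  unfolding mult_bound_def
proof (intro conjI ballI allI impI)
  show "outer_pole v holomorphic_on unit_disk"
    unfolding outer_pole_def using one_minus_cnj_mult_nonzero[OF v] by (intro holomorphic_intros) auto
  show "norm (outer_pole v z) \<le> pole_bound \<alpha>" if "z \<in> unit_disk" for z
  proof -
    have z: "norm z < 1" using that by simp
    have ge: "1 - norm v \<le> norm (1 - cnj v * z)"
      using norm_one_minus_ge[of z "cnj v"] z by (simp add: mult.commute)
    have "norm (outer_pole v z) = (1 - norm v) * norm z / norm (1 - cnj v * z)"
      using v unfolding outer_pole_def norm_divide norm_mult norm_of_real by simp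
    also have "\<dots> \<le> (1 - norm v) * 1 / (1 - norm v)" using v z ge by (intro frac_le mult_left_mono) auto
    also have "\<dots> \<le> pole_bound \<alpha>" using v pole_bound_ge[OF \<alpha>] by simp
    finally show ?thesis .
  qed
  show "rep \<alpha> (\<lambda>z. outer_pole v z * g z) (pole_bound \<alpha> * V)" if "rep \<alpha> g V" for g V
    unfolding pole_bound_def by (rule rep_outer_pole[OF \<alpha> v that])
qed

lemma mult_bound_blaschke:
  assumes \<alpha>: "0 < \<alpha>" and u: "norm u < 1" shows "mult_bound \<alpha> (1 + 2 * pole_bound \<alpha>) (blaschke u)"
proof (rule mult_bound_cong)
  have b: "mult_bound \<alpha> (norm u + norm (- of_real (1 + norm u) :: complex) * pole_bound \<alpha>)
      (\<lambda>z. u + (- of_real (1 + norm u)) * outer_pole u z)"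
    by (intro mult_bound_add mult_bound_const mult_bound_cmult mult_bound_outer_pole \<alpha> u)
  have n: "\<bar>1 + norm u\<bar> = 1 + norm u" by simp
  have "(1 + norm u) * pole_bound \<alpha> \<le> 2 * pole_bound \<alpha>"
    using u pole_bound_ge[OF \<alpha>] by (intro mult_right_mono) auto
  then have "norm u + norm (- of_real (1 + norm u) :: complex) * pole_bound \<alpha> \<le> 1 + 2 * pole_bound \<alpha>"
    unfolding norm_minus_cancel norm_of_real n using u by linarith
  then show "mult_bound \<alpha> (1 + 2 * pole_bound \<alpha>) (\<lambda>z. u + (- of_real (1 + norm u)) * outer_pole u z)"
    by (rule mult_bound_mono[OF b])
  show "u + (- of_real (1 + norm u)) * outer_pole u z = blaschke u z" if "norm z < 1" for z
  proof -
    have nz: "1 - cnj u * z \<noteq> 0" using one_minus_cnj_mult_nonzero[OF u, of z] that by simp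
    have gen: "u + (- (1 + n)) * ((1 - n) * z / d) = (u * d - (1 - n * n) * z) / d" if "d \<noteq> 0" for n d
      using that by (simp add: field_simps)
    have nn: "complex_of_real (norm u) * complex_of_real (norm u) = u * cnj u"
      using complex_norm_square[of u] by (simp add: power2_eq_square)
    have "u + (- of_real (1 + norm u)) * outer_pole u z =
        (u * (1 - cnj u * z) - (1 - u * cnj u) * z) / (1 - cnj u * z)"
      unfolding outer_pole_def of_real_add of_real_diff of_real_1 using gen[OF nz, of "of_real (norm u)"] by (simp only: nn)
    also have "u * (1 - cnj u * z) - (1 - u * cnj u) * z = u - z" by (simp add: algebra_simps)
    finally show ?thesis by (simp only: blaschke_def)
  qed
qed

definition index_dist :: "nat \<Rightarrow> nat \<Rightarrow> nat" where "index_dist j k = (j - k) + (k - j)"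

lemma index_dist_triangle: "index_dist j n \<le> index_dist j k + index_dist k n"
  by (simp add: index_dist_def)

lemma sum_power_index_dist_le:
  fixes \<rho> :: real
  assumes \<rho>: "0 < \<rho>" "\<rho> < 1" and J: "finite J" "\<And>j. j \<in> J \<Longrightarrow> M < index_dist j n"
  shows "(\<Sum>j\<in>J. \<rho> ^ index_dist j n) \<le> 2 * \<rho> ^ M / (1 - \<rho>)"
proof -
  have half: "(\<Sum>j\<in>X. \<rho> ^ index_dist j n) \<le> \<rho> ^ M / (1 - \<rho>)"
    if X: "X \<subseteq> J" "inj_on (\<lambda>j. index_dist j n) X" for X
  proof -
    have fX: "finite X" using X(1) J(1) finite_subset by blast
    have "(\<Sum>j\<in>X. \<rho> ^ index_dist j n) = (\<Sum>i\<in>(\<lambda>j. index_dist j n - M) ` X. \<rho> ^ (i + M))"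
    proof (rule sum.reindex_cong[symmetric])
      show "inj_on (\<lambda>j. index_dist j n - M) X"
      proof (rule inj_onI)
        fix x y assume xy: "x \<in> X" "y \<in> X" "index_dist x n - M = index_dist y n - M"
        then have "M < index_dist x n" "M < index_dist y n" using X(1) J(2) by auto
        then have "index_dist x n = index_dist y n" using xy(3) by linarith
        then show "x = y" using X(2) xy by (auto dest: inj_onD)
      qed
      show "\<rho> ^ (index_dist x n - M + M) = \<rho> ^ index_dist x n" if "x \<in> X" for x
        using J(2)[of x] X(1) that by auto
    qed simp
    also have "\<dots> = \<rho> ^ M * (\<Sum>i\<in>(\<lambda>j. index_dist j n - M) ` X. \<rho> ^ i)"
      by (simp add: power_add sum_distrib_left mult.commute)
    also have "(\<Sum>i\<in>(\<lambda>j. index_dist j n - M) ` X. \<rho> ^ i) \<le> (\<Sum>i. \<rho> ^ i)"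
      using \<rho> fX by (intro sum_le_suminf) (auto simp: summable_geometric)
    also have "\<dots> = 1 / (1 - \<rho>)" using \<rho> by (simp add: suminf_geometric)
    finally show ?thesis using \<rho> by (simp add: mult_left_mono)
  qed
  have "J = {j\<in>J. j < n} \<union> {j\<in>J. \<not> j < n}" by auto
  then have "(\<Sum>j\<in>J. \<rho> ^ index_dist j n) = (\<Sum>j\<in>{j\<in>J. j < n} \<union> {j\<in>J. \<not> j < n}. \<rho> ^ index_dist j n)" by simp
  also have "\<dots> = (\<Sum>j\<in>{j\<in>J. j < n}. \<rho> ^ index_dist j n) + (\<Sum>j\<in>{j\<in>J. \<not> j < n}. \<rho> ^ index_dist j n)"
    using J(1) by (intro sum.union_disjoint) auto
  also have "\<dots> \<le> \<rho> ^ M / (1 - \<rho>) + \<rho> ^ M / (1 - \<rho>)"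
    by (intro add_mono half) (auto simp: inj_on_def index_dist_def)
  finally show ?thesis by simp
qed

lemma card_index_ball: "finite {k. index_dist k n \<le> M}" "card {k. index_dist k n \<le> M} \<le> 2 * M + 1"
proof -
  have sub: "{k. index_dist k n \<le> M} \<subseteq> {n - M..n + M}" by (auto simp: index_dist_def)
  show "finite {k. index_dist k n \<le> M}" by (rule finite_subset[OF sub]) simp
  have "card {k. index_dist k n \<le> M} \<le> card {n - M..n + M}" by (intro card_mono sub) simp
  also have "\<dots> \<le> 2 * M + 1" by simp
  finally show "card {k. index_dist k n \<le> M} \<le> 2 * M + 1" .
qed

context lacunary
begin

text \<open>At the points \<open>a j\<close>, \<open>step n\<close> is close to \<open>1\<close> for \<open>j\<close> well above \<open>n\<close> and to \<open>0\<close> for \<open>j\<close> well below; \<open>bump k\<close> is concentrated near \<open>j = k\<close>.\<close>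

definition step :: "nat \<Rightarrow> complex \<Rightarrow> complex" where
  "step n = outer_pole (of_real (norm (a n)))"

definition bump :: "nat \<Rightarrow> complex \<Rightarrow> complex" where
  "bump k z = (of_real (r k) + of_real (norm (a k)) * step k z) * (1 - step k z)"

lemma step_eq:
  assumes "norm z < 1"
  shows "1 - of_real (norm (a n)) * z \<noteq> 0"
    and "step n z = of_real (r n) * z / (1 - of_real (norm (a n)) * z)"
    and "1 - step n z = (1 - z) / (1 - of_real (norm (a n)) * z)"
    and "of_real (r n) + of_real (norm (a n)) * step n z = of_real (r n) / (1 - of_real (norm (a n)) * z)"
proof -
  show nz: "1 - of_real (norm (a n)) * z \<noteq> 0"
    using one_minus_cnj_mult_nonzero[of "of_real (norm (a n))" z] in_disk[of n] assms by simp
  show st: "step n z = of_real (r n) * z / (1 - of_real (norm (a n)) * z)"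
    by (simp add: step_def outer_pole_def r_def)
  show "1 - step n z = (1 - z) / (1 - of_real (norm (a n)) * z)"
    using nz unfolding st r_def of_real_diff by (simp add: field_simps)
  have "of_real (r n) + q * (of_real (r n) * z / d) = of_real (r n) / d" if "d = 1 - q * z" "d \<noteq> 0" for q d :: complex
    using that(2) unfolding that(1) by (simp add: field_simps)
  then show "of_real (r n) + of_real (norm (a n)) * step n z = of_real (r n) / (1 - of_real (norm (a n)) * z)"
    using nz unfolding st by blast
qed

lemma denominator_ge: "r j \<le> norm (1 - of_real (norm (a n)) * a j)" "r n \<le> norm (1 - of_real (norm (a n)) * a j)"
  using norm_one_minus_ge[of "of_real (norm (a n))" "a j"] norm_one_minus_ge[of "a j" "of_real (norm (a n))"]
    in_disk[of n] in_disk[of j] by (simp_all add: r_def mult.commute)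

lemma step_bounds:
  "norm (step n (a j)) \<le> r n / r j" "norm (1 - step n (a j)) \<le> S * r j / r n"
  "norm (of_real (r n) + of_real (norm (a n)) * step n (a j)) \<le> r n / r j"
  "norm (of_real (r n) + of_real (norm (a n)) * step n (a j)) \<le> 1"
  "norm (1 - step n (a j)) \<le> 2"
proof -
  note eq = step_eq[OF in_disk[of j], of n]
  note p = r_pos[of j] r_pos[of n]
  show "norm (step n (a j)) \<le> r n / r j"
    unfolding eq(2) norm_divide norm_mult norm_of_real
    using p denominator_ge(1)[where j = j and n = n] in_disk[of j] mult_left_mono[of "norm (a j)" 1 "r n"] by (intro frac_le) auto
  show "norm (1 - step n (a j)) \<le> S * r j / r n"
    unfolding eq(3) norm_divide using p S(1) denominator_ge(2)[where j = j and n = n] stoltz_r[of j] by (intro frac_le) auto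
  show "norm (of_real (r n) + of_real (norm (a n)) * step n (a j)) \<le> r n / r j"
    unfolding eq(4) norm_divide norm_of_real using p denominator_ge(1)[where j = j and n = n] by (intro frac_le) auto
  have "norm (of_real (r n) + of_real (norm (a n)) * step n (a j)) \<le> r n / r n"
    unfolding eq(4) norm_divide norm_of_real using p denominator_ge(2)[where j = j and n = n] by (intro frac_le) auto
  then show "norm (of_real (r n) + of_real (norm (a n)) * step n (a j)) \<le> 1" using p by simp
  have "norm (step n (a j)) \<le> r n / r n"
    unfolding eq(2) norm_divide norm_mult norm_of_real
    using p denominator_ge(2)[where j = j and n = n] in_disk[of j] mult_left_mono[of "norm (a j)" 1 "r n"] by (intro frac_le) auto
  then show "norm (1 - step n (a j)) \<le> 2"
    using p norm_triangle_ineq4[of 1 "step n (a j)"] by simp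
qed

lemma decay_ratio: "k \<le> j \<Longrightarrow> r j / r k \<le> A * \<rho> ^ (j - k)"
  using r_decay[of k j] r_pos[of k] by (simp add: divide_le_eq)

definition step_error :: "nat \<Rightarrow> nat \<Rightarrow> complex" where
  "step_error n j = (if n < j then 1 else 0) - step n (a j)"

lemma norm_step_error_le: "norm (step_error n j) \<le> S * A * \<rho> ^ index_dist j n"
proof (cases "n < j")
  case True
  have "norm (step_error n j) \<le> S * (r j / r n)" using step_bounds(2)[of n j] True by (simp add: step_error_def)
  also have "\<dots> \<le> S * (A * \<rho> ^ (j - n))" using True S(1) by (intro mult_left_mono decay_ratio) auto
  finally show ?thesis using True by (simp add: index_dist_def)
next
  case False
  have "norm (step_error n j) \<le> r n / r j" using step_bounds(1)[of n j] False by (simp add: step_error_def)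
  also have "\<dots> \<le> A * \<rho> ^ (n - j)" using False by (intro decay_ratio) auto
  also have "\<dots> \<le> S * (A * \<rho> ^ (n - j))" using S(1) A \<rho> by (simp add: mult_left_mono[of 1 S, simplified])
  finally show ?thesis using False by (simp add: index_dist_def)
qed

lemma norm_bump_le: "norm (bump k (a j)) \<le> 2 * S * A * \<rho> ^ index_dist j k"
proof (cases "k \<le> j")
  case True
  have "norm (bump k (a j)) \<le> 1 * (S * r j / r k)"
    unfolding bump_def norm_mult by (intro mult_mono step_bounds) auto
  also have "\<dots> = S * (r j / r k)" by simp
  also have "\<dots> \<le> S * (A * \<rho> ^ (j - k))" using True S(1) by (intro mult_left_mono decay_ratio) auto
  also have "\<dots> \<le> 2 * (S * (A * \<rho> ^ (j - k)))" using S(1) A \<rho> by simp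
  finally show ?thesis using True by (simp add: index_dist_def)
next
  case False
  have "norm (bump k (a j)) \<le> (r k / r j) * 2"
    unfolding bump_def norm_mult using r_pos[of k] r_pos[of j] by (intro mult_mono step_bounds) auto
  also have "\<dots> \<le> (A * \<rho> ^ (k - j)) * 2" using False by (intro mult_right_mono decay_ratio) auto
  also have "\<dots> \<le> S * ((A * \<rho> ^ (k - j)) * 2)" using S(1) A \<rho> by (simp add: mult_left_mono[of 1 S, simplified])
  finally show ?thesis using False by (simp add: index_dist_def)
qed

lemma norm_bump_diag_ge: "1 / (S + 1)\<^sup>2 \<le> norm (bump k (a k))"
proof -
  note eq = step_eq[OF in_disk[of k], of k]
  let ?d = "norm (1 - of_real (norm (a k)) * a k)"
  have "1 - of_real (norm (a k)) * a k = (1 - a k) + of_real (r k) * a k" by (simp add: r_def algebra_simps)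
  then have "?d \<le> norm (1 - a k) + norm (of_real (r k) * a k)" by (metis norm_triangle_ineq)
  also have "\<dots> \<le> S * r k + r k"
  proof -
    have "r k * norm (a k) \<le> r k * 1" using in_disk[of k] r_pos[of k] by (intro mult_left_mono) auto
    moreover have "norm (of_real (r k) * a k) = r k * norm (a k)" using r_pos[of k] by (simp add: norm_mult)
    ultimately show ?thesis using stoltz_r[of k] by linarith
  qed
  finally have d: "?d \<le> (S + 1) * r k" by (simp add: algebra_simps)
  have d0: "0 < ?d" using eq(1) by simp
  have n1: "r k \<le> norm (1 - a k)" using norm_triangle_ineq2[of 1 "a k"] by (simp add: r_def)
  have q: "1 / (S + 1) \<le> r k / ?d"
    using d d0 S(1) by (simp add: divide_le_eq pos_le_divide_eq mult.commute)
  then have q': "1 / (S + 1) \<le> norm (1 - a k) / ?d"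
    using n1 d0 by (meson divide_right_mono less_imp_le order_trans)
  have "1 / (S + 1) * (1 / (S + 1)) \<le> (r k / ?d) * (norm (1 - a k) / ?d)"
    using S(1) r_pos[of k] d0 by (intro mult_mono q q') auto
  also have "\<dots> = norm (bump k (a k))"
    unfolding bump_def eq(3) eq(4) norm_mult norm_divide norm_of_real using r_pos[of k] by simp
  finally show ?thesis by (simp add: power2_eq_square)
qed

definition lagrange :: "nat set \<Rightarrow> nat \<Rightarrow> complex \<Rightarrow> complex" where
  "lagrange I k z = (1 / ((\<Prod>i\<in>I. blaschke (a i) (a k)) * bump k (a k))) * ((\<Prod>i\<in>I. blaschke (a i) z) * bump k z)"

lemma lagrange_denominator:
  assumes "finite I" "k \<notin> I"
  shows "(\<Prod>i\<in>I. blaschke (a i) (a k)) * bump k (a k) \<noteq> 0"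
    "norm (1 / ((\<Prod>i\<in>I. blaschke (a i) (a k)) * bump k (a k))) \<le> (S + 1)\<^sup>2 / \<delta>"
proof -
  let ?D = "(\<Prod>i\<in>I. blaschke (a i) (a k)) * bump k (a k)"
  have "\<delta> * (1 / (S + 1)\<^sup>2) \<le> norm (\<Prod>i\<in>I. blaschke (a i) (a k)) * norm (bump k (a k))"
    using \<delta>(2)[OF assms] \<delta>(1) norm_bump_diag_ge[of k] by (intro mult_mono) (auto simp: prod_norm)
  then have ge: "\<delta> / (S + 1)\<^sup>2 \<le> norm ?D" by (simp add: norm_mult)
  have pos: "0 < \<delta> / (S + 1)\<^sup>2" using \<delta>(1) S(1) by simp
  then show "?D \<noteq> 0" using ge by auto
  have "norm (1 / ?D) = 1 / norm ?D" by (simp add: norm_divide)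
  also have "\<dots> \<le> 1 / (\<delta> / (S + 1)\<^sup>2)" using pos ge by (intro divide_left_mono[OF ge] mult_pos_pos) linarith+
  finally show "norm (1 / ?D) \<le> (S + 1)\<^sup>2 / \<delta>" by simp
qed

lemma lagrange_values:
  assumes "finite I" "k \<notin> I"
  shows "lagrange I k (a k) = 1" "j \<in> I \<Longrightarrow> lagrange I k (a j) = 0"
    "norm (lagrange I k (a j)) \<le> (S + 1)\<^sup>2 / \<delta> * (2 * S * A) * \<rho> ^ index_dist j k"
proof -
  show "lagrange I k (a k) = 1" using lagrange_denominator(1)[OF assms] unfolding lagrange_def by simp
  show "lagrange I k (a j) = 0" if "j \<in> I"
  proof -
    have "(\<Prod>i\<in>I. blaschke (a i) (a j)) = 0" using that assms(1) by (intro prod_zero) (auto simp: blaschke_def)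
    then show ?thesis by (simp add: lagrange_def)
  qed
  have "norm (\<Prod>i\<in>I. blaschke (a i) (a j)) \<le> 1"
    unfolding prod_norm[symmetric] by (intro prod_le_1 conjI norm_blaschke_le_1 in_disk) auto
  then have "norm (lagrange I k (a j)) \<le> (S + 1)\<^sup>2 / \<delta> * (1 * (2 * S * A * \<rho> ^ index_dist j k))"
    unfolding lagrange_def norm_mult[of "1 / _"] norm_mult[of "prod _ _"]
    using \<delta>(1) S(1) A \<rho> by (intro mult_mono lagrange_denominator(2) assms norm_bump_le) auto
  then show "norm (lagrange I k (a j)) \<le> (S + 1)\<^sup>2 / \<delta> * (2 * S * A) * \<rho> ^ index_dist j k" by (simp add: mult_ac)
qed

lemma mult_bound_step:
  assumes \<alpha>: "0 < \<alpha>" shows "mult_bound \<alpha> (pole_bound \<alpha>) (step n)"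
  unfolding step_def using in_disk[of n] by (intro mult_bound_outer_pole \<alpha>) simp

lemma mult_bound_bump:
  assumes \<alpha>: "0 < \<alpha>" shows "mult_bound \<alpha> ((1 + pole_bound \<alpha>)\<^sup>2) (bump k)"
proof -
  have "mult_bound \<alpha> (norm (complex_of_real (r k)) + norm (complex_of_real (norm (a k))) * pole_bound \<alpha>)
      (\<lambda>z. of_real (r k) + of_real (norm (a k)) * step k z)"
    by (intro mult_bound_add mult_bound_const mult_bound_cmult mult_bound_step \<alpha>)
  moreover have "norm (complex_of_real (r k)) + norm (complex_of_real (norm (a k))) * pole_bound \<alpha> \<le> 1 + pole_bound \<alpha>"
  proof -
    have "norm (a k) * pole_bound \<alpha> \<le> 1 * pole_bound \<alpha>"
      using in_disk[of k] pole_bound_ge[OF \<alpha>] by (intro mult_right_mono) auto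
    then show ?thesis using r_pos[of k] r_le_1[of k] by simp
  qed
  ultimately have 1: "mult_bound \<alpha> (1 + pole_bound \<alpha>) (\<lambda>z. of_real (r k) + of_real (norm (a k)) * step k z)"
    by (rule mult_bound_mono)
  have "mult_bound \<alpha> (norm (1::complex) + norm (-1::complex) * pole_bound \<alpha>) (\<lambda>z. 1 + (-1) * step k z)"
    by (intro mult_bound_add mult_bound_const mult_bound_cmult mult_bound_step \<alpha>)
  then have 2: "mult_bound \<alpha> (1 + pole_bound \<alpha>) (\<lambda>z. 1 - step k z)" by simp
  show ?thesis
    using mult_bound_mult[OF 1 2] by (simp add: bump_def[abs_def] power2_eq_square)
qed

definition lagrange_bound :: "real \<Rightarrow> nat \<Rightarrow> real" where
  "lagrange_bound \<alpha> m = (S + 1)\<^sup>2 / \<delta> * ((1 + 2 * pole_bound \<alpha>) ^ m * (1 + pole_bound \<alpha>)\<^sup>2)"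

lemma mult_bound_lagrange:
  assumes \<alpha>: "0 < \<alpha>" and I: "finite I" "k \<notin> I" "card I \<le> m"
  shows "mult_bound \<alpha> (lagrange_bound \<alpha> m) (lagrange I k)"
proof (rule mult_bound_mono)
  show "mult_bound \<alpha> (norm (1 / ((\<Prod>i\<in>I. blaschke (a i) (a k)) * bump k (a k))) *
      ((1 + 2 * pole_bound \<alpha>) ^ card I * (1 + pole_bound \<alpha>)\<^sup>2)) (lagrange I k)"
    unfolding lagrange_def
    by (intro mult_bound_cmult mult_bound_mult mult_bound_prod mult_bound_bump mult_bound_blaschke \<alpha> I in_disk)
  have "(1 + 2 * pole_bound \<alpha>) ^ card I \<le> (1 + 2 * pole_bound \<alpha>) ^ m"
    using pole_bound_ge[OF \<alpha>] I(3) by (intro power_increasing) auto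
  then show "norm (1 / ((\<Prod>i\<in>I. blaschke (a i) (a k)) * bump k (a k))) *
      ((1 + 2 * pole_bound \<alpha>) ^ card I * (1 + pole_bound \<alpha>)\<^sup>2) \<le> lagrange_bound \<alpha> m"
    unfolding lagrange_bound_def using pole_bound_ge[OF \<alpha>] \<delta>(1)
    by (intro mult_mono lagrange_denominator(2) I) auto
qed

lemma approximate_step:
  assumes \<alpha>: "0 < \<alpha>"
  obtains C where "\<And>n. \<exists>G. mult_bound \<alpha> C G \<and>
    (\<forall>J. (\<Sum>j<J. norm ((if n < j then 1 else 0) - G (a j))) \<le> 1 / 6)"
proof -
  define B where "B = (S + 1)\<^sup>2 / \<delta> * (2 * S * A)"
  have B: "0 \<le> B" using \<delta>(1) S(1) A by (simp add: B_def)
  define c where "c M = S * A * (1 + B * (2 * real M + 1)) * (2 * \<rho> ^ M / (1 - \<rho>))" for M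
  have "c \<longlonglongrightarrow> 0"
  proof -
    have l1: "(\<lambda>M. \<rho> ^ M) \<longlonglongrightarrow> 0" using \<rho> by (intro LIMSEQ_power_zero) simp
    have l2: "(\<lambda>M. real M * \<rho> ^ M) \<longlonglongrightarrow> 0" using powser_times_n_limit_0[of \<rho>] \<rho> by simp
    have "(\<lambda>M. S * A * 2 / (1 - \<rho>) * ((1 + B) * \<rho> ^ M + 2 * B * (real M * \<rho> ^ M))) \<longlonglongrightarrow>
      S * A * 2 / (1 - \<rho>) * ((1 + B) * 0 + 2 * B * 0)"
      by (intro tendsto_intros l1 l2)
    moreover have "c = (\<lambda>M. S * A * 2 / (1 - \<rho>) * ((1 + B) * \<rho> ^ M + 2 * B * (real M * \<rho> ^ M)))"
      by (rule ext) (simp add: c_def algebra_simps add_divide_distrib)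
    ultimately show ?thesis by simp
  qed
  then have "\<forall>\<^sub>F M in sequentially. c M < 1 / 6" by (rule order_tendstoD) simp
  then obtain M where M: "c M < 1 / 6" by (auto simp: eventually_sequentially)
  define C where "C = pole_bound \<alpha> + real (2 * M + 1) * (S * A * lagrange_bound \<alpha> (2 * M + 1))"
  have "\<exists>G. mult_bound \<alpha> C G \<and> (\<forall>J. (\<Sum>j<J. norm ((if n < j then 1 else 0) - G (a j))) \<le> 1 / 6)" for n
  proof -
    define W where "W = {k. index_dist k n \<le> M}"
    have W: "finite W" "card W \<le> 2 * M + 1" unfolding W_def by (rule card_index_ball)+
    define G where "G z = step n z + (\<Sum>k\<in>W. step_error n k * lagrange (W - {k}) k z)" for z
    have LB0: "0 \<le> lagrange_bound \<alpha> (2 * M + 1)"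
      using \<delta>(1) pole_bound_ge[OF \<alpha>] by (simp add: lagrange_bound_def)
    have e: "norm (step_error n k) \<le> S * A" for k
    proof -
      have "S * A * \<rho> ^ index_dist k n \<le> S * A * 1"
        using S(1) A \<rho> by (intro mult_left_mono power_le_one) auto
      then show ?thesis using norm_step_error_le[of n k] by simp
    qed
    have m1: "mult_bound \<alpha> (pole_bound \<alpha> + (\<Sum>k\<in>W. norm (step_error n k) * lagrange_bound \<alpha> (2 * M + 1))) G"
      unfolding G_def
    proof (intro mult_bound_add mult_bound_sum mult_bound_step mult_bound_cmult mult_bound_lagrange \<alpha> W)
      show "card (W - {k}) \<le> 2 * M + 1" for k using W card_Diff1_le[of W k] by linarith
    qed (use W in auto)
    have m2: "(\<Sum>k\<in>W. norm (step_error n k) * lagrange_bound \<alpha> (2 * M + 1)) \<le> real (2 * M + 1) * (S * A * lagrange_bound \<alpha> (2 * M + 1))"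
    proof -
      have "(\<Sum>k\<in>W. norm (step_error n k) * lagrange_bound \<alpha> (2 * M + 1)) \<le> (\<Sum>k\<in>W. S * A * lagrange_bound \<alpha> (2 * M + 1))"
        by (intro sum_mono mult_right_mono e LB0)
      also have "\<dots> = real (card W) * (S * A * lagrange_bound \<alpha> (2 * M + 1))" by simp
      also have "\<dots> \<le> real (2 * M + 1) * (S * A * lagrange_bound \<alpha> (2 * M + 1))"
        using W(2) LB0 S(1) A by (intro mult_right_mono) auto
      finally show ?thesis .
    qed
    have GC: "mult_bound \<alpha> C G"
      unfolding C_def by (rule mult_bound_mono[OF m1 add_left_mono[OF m2]])
    let ?R = "\<lambda>j. (if n < j then 1 else 0) - G (a j)"
    have R: "?R j = step_error n j - (\<Sum>k\<in>W. step_error n k * lagrange (W - {k}) k (a j))" for j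
      by (simp add: G_def step_error_def)
    have R0: "?R j = 0" if j: "j \<in> W" for j
    proof -
      have "(\<Sum>k\<in>W. step_error n k * lagrange (W - {k}) k (a j)) = (\<Sum>k\<in>W. if k = j then step_error n j else 0)"
      proof (rule sum.cong[OF refl])
        fix k assume k: "k \<in> W"
        show "step_error n k * lagrange (W - {k}) k (a j) = (if k = j then step_error n j else 0)"
          using lagrange_values(1)[of "W - {k}" k] lagrange_values(2)[of "W - {k}" k j] W(1) j by auto
      qed
      also have "\<dots> = step_error n j" using j W(1) by simp
      finally show ?thesis unfolding R by simp
    qed
    have R1: "norm (?R j) \<le> S * A * (1 + B * (2 * real M + 1)) * \<rho> ^ index_dist j n" for j
    proof -
      have "norm (?R j) \<le> norm (step_error n j) + norm (\<Sum>k\<in>W. step_error n k * lagrange (W - {k}) k (a j))"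
        unfolding R by (rule norm_triangle_ineq4)
      also have "norm (\<Sum>k\<in>W. step_error n k * lagrange (W - {k}) k (a j)) \<le> (\<Sum>k\<in>W. S * A * B * \<rho> ^ index_dist j n)"
      proof (intro sum_norm_le)
        fix k assume "k \<in> W"
        have "norm (step_error n k * lagrange (W - {k}) k (a j)) \<le> (S * A * \<rho> ^ index_dist k n) * (B * \<rho> ^ index_dist j k)"
          unfolding norm_mult B_def using W(1) S(1) A \<rho>
          by (intro mult_mono norm_step_error_le lagrange_values(3)) auto
        also have "\<dots> = S * A * B * \<rho> ^ (index_dist j k + index_dist k n)" by (simp add: power_add mult_ac)
        also have "\<dots> \<le> S * A * B * \<rho> ^ index_dist j n"
          using S(1) A B \<rho> by (intro mult_left_mono power_decreasing index_dist_triangle) auto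
        finally show "norm (step_error n k * lagrange (W - {k}) k (a j)) \<le> S * A * B * \<rho> ^ index_dist j n" .
      qed
      also have "\<dots> = real (card W) * (S * A * B * \<rho> ^ index_dist j n)" by simp
      also have "\<dots> \<le> (2 * real M + 1) * (S * A * B * \<rho> ^ index_dist j n)"
        using W(2) S(1) A B \<rho> by (intro mult_right_mono) auto
      finally have "norm (?R j) \<le> norm (step_error n j) + (2 * real M + 1) * (S * A * B * \<rho> ^ index_dist j n)" by simp
      then show ?thesis using norm_step_error_le[of n j] by (simp add: algebra_simps)
    qed
    have "(\<Sum>j<J. norm (?R j)) \<le> 1 / 6" for J
    proof -
      have "(\<Sum>j<J. norm (?R j)) = (\<Sum>j\<in>{..<J} - W. norm (?R j))"
        using R0 by (intro sum.mono_neutral_right) auto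
      also have "\<dots> \<le> (\<Sum>j\<in>{..<J} - W. S * A * (1 + B * (2 * real M + 1)) * \<rho> ^ index_dist j n)"
        by (intro sum_mono R1)
      also have "\<dots> = S * A * (1 + B * (2 * real M + 1)) * (\<Sum>j\<in>{..<J} - W. \<rho> ^ index_dist j n)"
        by (simp add: sum_distrib_left)
      also have "\<dots> \<le> c M"
        unfolding c_def using S(1) A B
        by (intro mult_left_mono sum_power_index_dist_le \<rho>) (auto simp: W_def)
      finally show ?thesis using M by simp
    qed
    then show ?thesis using GC by blast
  qed
  then show ?thesis by (rule that)
qed

end

definition bv_norm :: "(nat \<Rightarrow> complex) \<Rightarrow> real" where
  "bv_norm x = norm (x 0) + (\<Sum>k. norm (x (Suc k) - x k))"

lemma norm_le_bv_norm:
  assumes "x \<in> bounded_variation_seqs" shows "norm (x j) \<le> bv_norm x"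
proof -
  have s: "summable (\<lambda>k. norm (x (Suc k) - x k))" using assms by (simp add: bounded_variation_seqs_def)
  have "norm (x j) \<le> norm (x 0) + (\<Sum>k<j. norm (x (Suc k) - x k))"
  proof -
    have "x j = x 0 + (\<Sum>k<j. x (Suc k) - x k)" by (simp add: sum_lessThan_telescope)
    then have "norm (x j) \<le> norm (x 0) + norm (\<Sum>k<j. x (Suc k) - x k)" by (metis norm_triangle_ineq)
    also have "norm (\<Sum>k<j. x (Suc k) - x k) \<le> (\<Sum>k<j. norm (x (Suc k) - x k))" by (rule norm_sum)
    finally show ?thesis by simp
  qed
  also have "(\<Sum>k<j. norm (x (Suc k) - x k)) \<le> (\<Sum>k. norm (x (Suc k) - x k))"
    by (rule sum_le_suminf[OF s]) auto
  finally show ?thesis by (simp add: bv_norm_def)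
qed

lemma bv_norm_le_of_l1:
  assumes "\<And>J. (\<Sum>j<J. norm (y j)) \<le> B"
  shows "y \<in> bounded_variation_seqs" "bv_norm y \<le> 3 * B"
proof -
  have p: "norm (y 0) + (\<Sum>k<n. norm (y (Suc k) - y k)) \<le> 3 * B" for n
  proof -
    have "(\<Sum>k<n. norm (y (Suc k) - y k)) \<le> (\<Sum>k<n. norm (y (Suc k)) + norm (y k))"
      by (intro sum_mono norm_triangle_ineq4)
    also have "\<dots> = (\<Sum>k<n. norm (y (Suc k))) + (\<Sum>k<n. norm (y k))" by (rule sum.distrib)
    also have "(\<Sum>k<n. norm (y (Suc k))) = (\<Sum>k<Suc n. norm (y k)) - norm (y 0)"
      by (simp add: sum.lessThan_Suc_shift del: sum.lessThan_Suc)
    finally have "norm (y 0) + (\<Sum>k<n. norm (y (Suc k) - y k)) \<le> (\<Sum>k<Suc n. norm (y k)) + (\<Sum>k<n. norm (y k))" by simp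
    also have "\<dots> \<le> B + B" by (intro add_mono assms)
    also have "\<dots> \<le> 3 * B" using assms[of 0] by simp
    finally show ?thesis .
  qed
  have s: "summable (\<lambda>k. norm (y (Suc k) - y k))"
  proof (rule bounded_imp_summable)
    show "(\<Sum>k\<le>n. norm (y (Suc k) - y k)) \<le> 3 * B" for n
      using p[of "Suc n"] norm_ge_zero[of "y 0"] unfolding lessThan_Suc_atMost by linarith
  qed simp
  then show "y \<in> bounded_variation_seqs" by (simp add: bounded_variation_seqs_def)
  have "(\<Sum>k. norm (y (Suc k) - y k)) \<le> 3 * B - norm (y 0)"
    by (rule suminf_le_const[OF s]) (use p in \<open>simp add: algebra_simps\<close>)
  then show "bv_norm y \<le> 3 * B" by (simp add: bv_norm_def)
qed

context lacunary
begin

lemma approximate_interpolation: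
  assumes \<alpha>: "0 < \<alpha>"
  obtains C where "0 \<le> C" "\<And>x. x \<in> bounded_variation_seqs \<Longrightarrow> \<exists>f. mult_bound \<alpha> (C * bv_norm x) f \<and>
    (\<lambda>j. x j - f (a j)) \<in> bounded_variation_seqs \<and> bv_norm (\<lambda>j. x j - f (a j)) \<le> bv_norm x / 2"
proof -
  obtain C where "\<And>n. \<exists>G. mult_bound \<alpha> C G \<and>
    (\<forall>J. (\<Sum>j<J. norm ((if n < j then 1 else 0) - G (a j))) \<le> 1 / 6)"
    using approximate_step[OF \<alpha>] by blast
  then obtain G where G: "\<And>n. mult_bound \<alpha> C (G n)"
    "\<And>n J. (\<Sum>j<J. norm ((if n < j then 1 else 0) - G n (a j))) \<le> 1 / 6" by metis
  have C: "0 \<le> C" by (rule mult_boundD(3)[OF G(1)])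
  show ?thesis
  proof (rule that[of "1 + C"])
    show "0 \<le> 1 + C" using C by simp
    fix x assume x: "x \<in> bounded_variation_seqs"
    define d where "d n = x (Suc n) - x n" for n
    have sd: "summable (\<lambda>n. norm (d n))" using x by (simp add: bounded_variation_seqs_def d_def)
    define f where "f z = x 0 + (\<Sum>n. d n * G n z)" for z
    have mb: "\<And>n. mult_bound \<alpha> (norm (d n) * C) (\<lambda>z. d n * G n z)" by (rule mult_bound_cmult[OF G(1)])
    have sdC: "summable (\<lambda>n. norm (d n) * C)" by (rule summable_mult2[OF sd])
    have f: "mult_bound \<alpha> ((1 + C) * bv_norm x) f"
    proof (rule mult_bound_mono)
      show "mult_bound \<alpha> (norm (x 0) + (\<Sum>n. norm (d n) * C)) f"
        unfolding f_def by (intro mult_bound_add mult_bound_const mult_bound_suminf(1)[OF mb sdC])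
      have "(\<Sum>n. norm (d n) * C) = (\<Sum>n. norm (d n)) * C" by (rule suminf_mult2[OF sd, symmetric])
      moreover have "0 \<le> (\<Sum>n. norm (d n))" by (intro suminf_nonneg sd) simp
      ultimately show "norm (x 0) + (\<Sum>n. norm (d n) * C) \<le> (1 + C) * bv_norm x"
        using C unfolding bv_norm_def d_def[symmetric] by (simp add: algebra_simps add_nonneg_nonneg)
    qed
    let ?y = "\<lambda>j. x j - f (a j)"
    let ?e = "\<lambda>n j. (if n < j then 1 else 0) - G n (a j)"
    have sums: "(\<lambda>n. d n * ?e n j) sums ?y j" for j
    proof -
      have "(\<lambda>n. d n * (if n < j then 1 else 0)) sums (\<Sum>n<j. d n * (if n < j then 1 else 0))"
        by (rule sums_finite) auto
      also have "(\<Sum>n<j. d n * (if n < j then 1 else 0)) = x j - x 0"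
        unfolding d_def by (simp add: sum_lessThan_telescope)
      finally have s1: "(\<lambda>n. d n * (if n < j then 1 else 0)) sums (x j - x 0)" .
      have s2: "(\<lambda>n. d n * G n (a j)) sums (\<Sum>n. d n * G n (a j))"
        by (rule summable_sums[OF mult_bound_suminf(2)[OF mb sdC in_disk]])
      have "(\<lambda>n. d n * ?e n j) sums (x j - x 0 - (\<Sum>n. d n * G n (a j)))"
        using sums_diff[OF s1 s2] by (simp only: right_diff_distrib)
      then show ?thesis by (simp only: f_def diff_diff_eq)
    qed
    have "(\<Sum>j<J. norm (?y j)) \<le> bv_norm x / 6" for J
    proof -
      have le16: "norm (?e n j) \<le> 1 / 6" for n j
      proof -
        have "0 \<le> (\<Sum>j<j. norm (?e n j))" by (rule sum_nonneg) simp
        then show ?thesis using G(2)[of n "Suc j"] unfolding sum.lessThan_Suc by linarith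
      qed
      have sj: "summable (\<lambda>n. norm (d n) * norm (?e n j))" for j
      proof (rule summable_comparison_test'[OF summable_mult2[OF sd, of "1/6"], of 0])
        fix n
        have "norm (norm (d n) * norm (?e n j)) = norm (d n) * norm (?e n j)" by (simp only: real_norm_def abs_mult abs_norm_cancel)
        also have "\<dots> \<le> norm (d n) * (1 / 6)" by (intro mult_left_mono le16) simp
        finally show "norm (norm (d n) * norm (?e n j)) \<le> norm (d n) * (1 / 6)" .
      qed
      have "(\<Sum>j<J. norm (?y j)) \<le> (\<Sum>j<J. \<Sum>n. norm (d n) * norm (?e n j))"
      proof (rule sum_mono)
        fix j
        have "?y j = (\<Sum>n. d n * ?e n j)" by (rule sums_unique[OF sums])
        also have "norm \<dots> \<le> (\<Sum>n. norm (d n * ?e n j))"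
          by (rule summable_norm) (use sj[of j] in \<open>simp only: norm_mult\<close>)
        finally show "norm (?y j) \<le> (\<Sum>n. norm (d n) * norm (?e n j))" by (simp only: norm_mult)
      qed
      also have "\<dots> = (\<Sum>n. \<Sum>j<J. norm (d n) * norm (?e n j))"
        by (rule suminf_sum[symmetric]) (rule sj)
      also have "\<dots> \<le> (\<Sum>n. norm (d n) * (1 / 6))"
      proof (rule suminf_le)
        show "(\<Sum>j<J. norm (d n) * norm (?e n j)) \<le> norm (d n) * (1 / 6)" for n
          unfolding sum_distrib_left[symmetric] by (intro mult_left_mono G(2)) simp
        show "summable (\<lambda>n. \<Sum>j<J. norm (d n) * norm (?e n j))" by (intro summable_sum sj)
        show "summable (\<lambda>n. norm (d n) * (1 / 6))" by (rule summable_mult2[OF sd])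
      qed
      also have "\<dots> = (\<Sum>n. norm (d n)) * (1 / 6)" by (rule suminf_mult2[OF sd, symmetric])
      also have "\<dots> \<le> bv_norm x / 6" by (simp add: bv_norm_def d_def)
      finally show ?thesis .
    qed
    from bv_norm_le_of_l1[OF this]
    show "\<exists>f. mult_bound \<alpha> ((1 + C) * bv_norm x) f \<and> (\<lambda>j. x j - f (a j)) \<in> bounded_variation_seqs \<and>
        bv_norm (\<lambda>j. x j - f (a j)) \<le> bv_norm x / 2"
      using f by (intro exI[of _ f]) simp
  qed
qed

lemma interpolation:
  assumes \<alpha>: "0 < \<alpha>" and x: "x \<in> bounded_variation_seqs"
  shows "\<exists>f\<in>multipliers \<alpha>. \<forall>k. f (a k) = x k"
proof -
  obtain C where C: "0 \<le> C" and ex: "\<And>x. x \<in> bounded_variation_seqs \<Longrightarrow> \<exists>f. mult_bound \<alpha> (C * bv_norm x) f \<and>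
    (\<lambda>j. x j - f (a j)) \<in> bounded_variation_seqs \<and> bv_norm (\<lambda>j. x j - f (a j)) \<le> bv_norm x / 2"
    by (rule approximate_interpolation[OF \<alpha>]) blast
  then obtain \<Phi> where \<Phi>: "\<And>x. x \<in> bounded_variation_seqs \<Longrightarrow> mult_bound \<alpha> (C * bv_norm x) (\<Phi> x)"
    "\<And>x. x \<in> bounded_variation_seqs \<Longrightarrow> (\<lambda>j. x j - \<Phi> x (a j)) \<in> bounded_variation_seqs"
    "\<And>x. x \<in> bounded_variation_seqs \<Longrightarrow> bv_norm (\<lambda>j. x j - \<Phi> x (a j)) \<le> bv_norm x / 2" by metis
  define X where "X i = ((\<lambda>x j. x j - \<Phi> x (a j)) ^^ i) x" for i
  have X_Suc: "X (Suc i) = (\<lambda>j. X i j - \<Phi> (X i) (a j))" for i by (simp add: X_def)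
  have X: "X i \<in> bounded_variation_seqs \<and> bv_norm (X i) \<le> bv_norm x * (1/2) ^ i" for i
  proof (induction i)
    case 0
    then show ?case using x by (simp add: X_def)
  next
    case (Suc i)
    then have Xi: "X i \<in> bounded_variation_seqs" by simp
    show ?case unfolding X_Suc using \<Phi>(2)[OF Xi] \<Phi>(3)[OF Xi] Suc by simp
  qed
  define f where "f z = (\<Sum>i. \<Phi> (X i) z)" for z
  have mb: "mult_bound \<alpha> (C * (bv_norm x * (1/2) ^ i)) (\<Phi> (X i))" for i
    by (rule mult_bound_mono[OF \<Phi>(1)]) (use X[of i] C in \<open>auto intro!: mult_left_mono\<close>)
  have sC: "summable (\<lambda>i. C * (bv_norm x * (1/2) ^ i))"
    by (intro summable_mult summable_geometric) simp
  have "f \<in> multipliers \<alpha>"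
    unfolding f_def by (rule mult_bound_imp_multiplier[OF mult_bound_suminf(1)[OF mb sC]])
  moreover have "f (a k) = x k" for k
  proof -
    have part: "(\<Sum>i<n. \<Phi> (X i) (a k)) = x k - X n k" for n
      by (induction n) (simp_all add: X_Suc, simp add: X_def)
    have "(\<lambda>n. X n k) \<longlonglongrightarrow> 0"
    proof (rule Lim_null_comparison)
      show "\<forall>\<^sub>F n in sequentially. norm (X n k) \<le> bv_norm x * (1/2) ^ n"
        using X norm_le_bv_norm order_trans by (intro always_eventually allI) blast
      have "(\<lambda>n. bv_norm x * (1/2::real) ^ n) \<longlonglongrightarrow> bv_norm x * 0"
        by (intro tendsto_intros LIMSEQ_power_zero) simp
      then show "(\<lambda>n. bv_norm x * (1/2::real) ^ n) \<longlonglongrightarrow> 0" by simp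
    qed
    then have "(\<lambda>n. x k - X n k) \<longlonglongrightarrow> x k - 0" by (intro tendsto_intros)
    then have "(\<lambda>i. \<Phi> (X i) (a k)) sums x k" unfolding sums_def part by simp
    then show ?thesis unfolding f_def by (rule sums_unique[symmetric])
  qed
  ultimately show ?thesis by blast
qed

end

theorem theorem1:
  fixes \<alpha> :: real and a :: "nat \<Rightarrow> complex"
  assumes "\<alpha> > 0"
    and "range a \<subseteq> unit_disk"
    and "\<And>k n. k \<noteq> n \<Longrightarrow> a k \<noteq> a n"
    and "\<And>k. norm (a k) \<le> norm (a (Suc k))"
    and "newman_carleson a"
    and "stoltz a"
  shows "(\<forall>f\<in>multipliers \<alpha>. (\<lambda>k. f (a k)) \<in> bounded_variation_seqs) \<and>
         (\<forall>x\<in>bounded_variation_seqs. \<exists>f\<in>multipliers \<alpha>. \<forall>k. f (a k) = x k)"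
proof -
  have "norm (a k) < 1" for k
  proof -
    have "a k \<in> unit_disk" using assms(2) by blast
    then show ?thesis by simp
  qed
  then obtain S A \<rho> \<delta> where "lacunary a S A \<rho> \<delta>"
    using newman_carleson_stoltz_lacunary[OF _ assms(4-6)] by blast
  then interpret lacunary a S A \<rho> \<delta> .
  show ?thesis using multiplier_values_bounded_variation[OF assms(1)] interpolation[OF assms(1)] by blast
qed

end
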